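(* Let $\eta_1,\eta_2,\ldots$ be independent copies of a real random variable $\eta$ with $\mathbb{E}[\eta]=0$ and $\sigma^2=\mathbb{E}[\eta^2]\in(0,\infty)$. Then $$\Big(\frac{1}{(\log 1/s)^{1/2}}\sum_p\frac{\eta_p}{p^{1/2+s^t}}\Big)_{t\geq 0}\ \Longrightarrow\ (\sigma B(t))_{t\geq 0},\qquad s\to 0+,$$ on $C[0,\infty)$, where $(B(t))_{t\geq 0}$ is a standard Brownian motion.
   Context: $\sum_p$ denotes summation over the set of prime numbers (taken in increasing order). For each $u>0$ the series $X(u):=\sum_p \eta_p p^{-1/2-u}$ converges almost surely, and $u\mapsto X(u)$ is a.s. a continuous function on $(0,\infty)$; the process in the claim is $t\mapsto (\log 1/s)^{-1/2}X(s^t)$ for $s\in(0,1)$. $C[0,\infty)$ is the space of real-valued continuous functions on $[0,\infty)$ equipped with the topology of locally uniform convergence, and $\Longrightarrow$ denotes weak convergence (of probability laws) in this function space. *)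

theory Defs
  imports "HOL-Probability.Probability" "HOL-Library.Infinite_Set"
    "HOL-Computational_Algebra.Primes"
begin

(* C[0,oo): a path is stored as a function on the reals that is "undefined" off the half-line,
   so that equality of paths is equality of their values on the half-line. *)
typedef cpath = "{f :: real \<Rightarrow> real. continuous_on {0..} f \<and> f \<in> extensional {0..}}"
  morphisms cpath_apply Abs_cpath
proof
  have "continuous_on {0..} (restrict (\<lambda>_. 0) {0..} :: real \<Rightarrow> real)"
    by (rule continuous_on_eq[of _ "\<lambda>_. 0"]) auto
  then show "restrict (\<lambda>_. 0) {0..} \<in>
      {f :: real \<Rightarrow> real. continuous_on {0..} f \<and> f \<in> extensional {0..}}"
    by simp
qed

(* Meaningful only if f is continuous on the half-line. *)
definition cpath_of :: "(real \<Rightarrow> real) \<Rightarrow> cpath" where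
  "cpath_of f = Abs_cpath (restrict f {0..})"

lemma cpath_apply_cpath_of:
  assumes "continuous_on {0..} f" and "0 \<le> t"
  shows "cpath_apply (cpath_of f) t = f t"
proof -
  have "continuous_on {0..} (restrict f {0..})"
    using assms(1) by (rule continuous_on_eq) simp
  then show ?thesis
    using assms(2) by (simp add: cpath_of_def Abs_cpath_inverse)
qed

(* Topology of locally uniform convergence: every compact subset of the half-line lies in some
   interval [0,T], so the sets of paths uniformly e-close to f on [0,T] form a base of
   neighbourhoods of f. *)
instantiation cpath :: topological_space
begin

definition open_cpath :: "cpath set \<Rightarrow> bool" where
  "open_cpath U \<longleftrightarrow> (\<forall>f\<in>U. \<exists>T\<ge>0. \<exists>e>0. \<forall>g.
     (\<forall>t\<in>{0..T}. \<bar>cpath_apply g t - cpath_apply f t\<bar> < e) \<longrightarrow> g \<in> U)"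

instance
proof
  show "open (UNIV :: cpath set)"
    unfolding open_cpath_def by (auto intro: exI[of _ 0] exI[of _ 1])
next
  fix U V :: "cpath set"
  assume U: "open U" and V: "open V"
  show "open (U \<inter> V)"
    unfolding open_cpath_def
  proof
    fix f assume f: "f \<in> U \<inter> V"
    obtain T d where T: "T \<ge> 0" "d > 0"
      "\<And>g. (\<forall>t\<in>{0..T}. \<bar>cpath_apply g t - cpath_apply f t\<bar> < d) \<Longrightarrow> g \<in> U"
      using U f unfolding open_cpath_def by blast
    obtain S e where S: "S \<ge> 0" "e > 0"
      "\<And>g. (\<forall>t\<in>{0..S}. \<bar>cpath_apply g t - cpath_apply f t\<bar> < e) \<Longrightarrow> g \<in> V"
      using V f unfolding open_cpath_def by blast
    have "g \<in> U \<inter> V"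
      if "\<forall>t\<in>{0..max T S}. \<bar>cpath_apply g t - cpath_apply f t\<bar> < min d e" for g
      proof
      show "g \<in> U" using that by (intro T(3)) auto
      show "g \<in> V" using that by (intro S(3)) auto
    qed
    then show "\<exists>R\<ge>0. \<exists>r>0. \<forall>g.
        (\<forall>t\<in>{0..R}. \<bar>cpath_apply g t - cpath_apply f t\<bar> < r) \<longrightarrow> g \<in> U \<inter> V"
      using T(1,2) S(1,2) by (intro exI[of _ "max T S"] conjI exI[of _ "min d e"]) auto
  qed
next
  fix K :: "cpath set set"
  assume K: "\<forall>U\<in>K. open U"
  show "open (\<Union>K)"
    unfolding open_cpath_def
  proof
    fix f assume "f \<in> \<Union>K"
    then obtain U where U: "U \<in> K" "f \<in> U" by blast
    then obtain T e where "T \<ge> 0" "e > 0"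
      "\<forall>g. (\<forall>t\<in>{0..T}. \<bar>cpath_apply g t - cpath_apply f t\<bar> < e) \<longrightarrow> g \<in> U"
      using K unfolding open_cpath_def by blast
    then show "\<exists>T\<ge>0. \<exists>e>0. \<forall>g.
        (\<forall>t\<in>{0..T}. \<bar>cpath_apply g t - cpath_apply f t\<bar> < e) \<longrightarrow> g \<in> \<Union>K"
      using U(1) by blast
  qed
qed

end

(* The first two conjuncts are not automatic for measures of the form distr M borel X: the law
   of X is a probability measure only if X is measurable. *)
definition weakly_converges ::
    "('i \<Rightarrow> 'a :: topological_space measure) \<Rightarrow> 'a measure \<Rightarrow> 'i filter \<Rightarrow> bool" where
  "weakly_converges \<mu> \<nu> F \<longleftrightarrow>
     (\<forall>\<^sub>F i in F. prob_space (\<mu> i) \<and> sets (\<mu> i) = sets borel) \<and>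
     (prob_space \<nu> \<and> sets \<nu> = sets borel) \<and>
     (\<forall>f :: 'a \<Rightarrow> real. continuous_on UNIV f \<and> bounded (range f) \<longrightarrow>
        ((\<lambda>i. \<integral>x. f x \<partial>\<mu> i) \<longlongrightarrow> (\<integral>x. f x \<partial>\<nu>)) F)"

definition standard_brownian_motion :: "'b measure \<Rightarrow> (real \<Rightarrow> 'b \<Rightarrow> real) \<Rightarrow> bool" where
  "standard_brownian_motion N B \<longleftrightarrow>
     prob_space N \<and>
     (\<forall>t\<ge>0. B t \<in> borel_measurable N) \<and>
     (AE \<omega> in N. B 0 \<omega> = 0) \<and>
     (\<forall>(n :: nat) (\<tau> :: nat \<Rightarrow> real). 0 \<le> \<tau> 0 \<and> (\<forall>i<n. \<tau> i \<le> \<tau> (Suc i)) \<longrightarrow>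
        prob_space.indep_vars N (\<lambda>_. borel) (\<lambda>i \<omega>. B (\<tau> (Suc i)) \<omega> - B (\<tau> i) \<omega>) {..<n}) \<and>
     (\<forall>r t. 0 \<le> r \<and> r < t \<longrightarrow>
        distributed N lborel (\<lambda>\<omega>. B t \<omega> - B r \<omega>) (normal_density 0 (sqrt (t - r)))) \<and>
     (\<forall>\<omega>\<in>space N. continuous_on {0..} (\<lambda>t. B t \<omega>))"

(* Indexed from 0: nth_prime 0 = 2. *)
definition nth_prime :: "nat \<Rightarrow> nat" where
  "nth_prime = enumerate {p. prime p}"

definition prime_series_term :: "(nat \<Rightarrow> real) \<Rightarrow> real \<Rightarrow> nat \<Rightarrow> real" where
  "prime_series_term a u k = a (nth_prime k) / real (nth_prime k) powr (1/2 + u)"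

definition prime_series :: "(nat \<Rightarrow> real) \<Rightarrow> real \<Rightarrow> real" where
  "prime_series a u = (\<Sum>k. prime_series_term a u k)"

definition regular_coeffs :: "(nat \<Rightarrow> real) \<Rightarrow> bool" where
  "regular_coeffs a \<longleftrightarrow>
     (\<forall>u>0. summable (prime_series_term a u)) \<and> continuous_on {0<..} (prime_series a)"

(* For random coefficients as in the theorem, regular_coeffs holds almost surely; on the
   exceptional event the path is set to 0, so that all paths are continuous. *)
definition prime_process :: "(nat \<Rightarrow> 'a \<Rightarrow> real) \<Rightarrow> real \<Rightarrow> 'a \<Rightarrow> real" where
  "prime_process \<eta> u \<omega> =
     (if regular_coeffs (\<lambda>n. \<eta> n \<omega>) then prime_series (\<lambda>n. \<eta> n \<omega>) u else 0)"

end

theory Submission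
  imports Defs "HOL-Real_Asymp.Real_Asymp"
begin

text \<open>
  Write \<open>L = ln (1/s)\<close>, \<open>X u\<close> for the value of the series at \<open>u\<close>, and \<open>S y\<close> for the sum of
  \<open>\<eta> p / sqrt p\<close> over the primes with \<open>1 < ln p \<le> y\<close>. The factor \<open>p powr -u\<close> is close to 1 as long
  as \<open>ln p\<close> is far below \<open>1/u\<close>, and it makes the series negligible beyond; quantitatively,
  \<open>X u - S (1/u)\<close> is bounded in L2 uniformly in \<open>u \<le> 1\<close> (second_moment_cutoff_le), and division by
  \<open>sqrt L\<close> removes the difference. For \<open>u = s powr t\<close> the cut-off is \<open>(1/s) powr t\<close>, and the variance
  of \<open>S ((1/s) powr t)\<close> is \<open>\<sigma>\<^sup>2\<close> times the sum of \<open>1/p\<close> over the primes concerned, which is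
  \<open>t L\<close> up to a bounded error by a weak form of Mertens' theorem (prime_reciprocal_sum_bounds).
  Increments of \<open>t \<mapsto> S ((1/s) powr t)\<close> run over disjoint blocks of primes. They are therefore
  independent, and asymptotically normal because every single weight is at most \<open>1 / sqrt L\<close>
  (block_increment_weak_conv). This is the Brownian structure of the limit.

  Weak convergence of the paths needs an estimate of their oscillation, while \<open>\<eta>\<close> has two moments
  only. The coefficients are truncated at \<open>\<bar>\<eta> p\<bar> \<le> sqrt p\<close>. What is cut off is summable against
  \<open>1 / sqrt p\<close> with expectation at most \<open>4 \<sigma>\<^sup>2\<close> (remainder_summable), since the sum of
  \<open>1 / sqrt n\<close> over \<open>n < x\<^sup>2\<close> is at most \<open>2 \<bar>x\<bar>\<close>; it disappears uniformly in \<open>t\<close> after the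
  normalisation. In the truncated series, an increment between \<open>u < v\<close> has variance
  at most \<open>\<sigma>\<^sup>2 ln (v/u)\<close>, and each of its terms is at most \<open>2 sqrt (ln (v/u))\<close>. Hence the increment,
  divided by \<open>2 sqrt (ln (v/u))\<close>, has a bounded exponential moment, and its fourth moment is at most a
  constant times \<open>(ln (v/u))\<^sup>2\<close> (fourth_moment_increment_le). For \<open>u = s powr t\<close>, \<open>v = s powr r\<close> the
  logarithm is \<open>(t - r) L\<close>, so that the normalised process has fourth moments of increments at most
  \<open>C (t - r)\<^sup>2\<close> with \<open>C\<close> independent of \<open>s\<close>, and dyadic chaining bounds the oscillation between
  neighbouring grid points (dyadic_oscillation_expectation). The same exponential moments give the
  almost sure convergence and continuity of the series (bounded_part_regular). The arithmetic
  behind the variance bound is that the sum of \<open>ln p * p powr (-1-u)\<close> over the primes is at most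
  \<open>1/u\<close> (prime_log_sum_le).

  For the passage to the limit it suffices to test with bounded functionals that are Lipschitz for the
  supremum norm on some interval \<open>[0, K]\<close>, because every bounded continuous functional is a
  pointwise limit from below of such functionals (weakly_converges_lipschitzI). For these, a path may be
  replaced by the interpolation of block sums on a dyadic grid, at a cost that is uniform in \<open>s\<close> up to
  a vanishing term (interpolation_error_le). On a fixed grid finitely many independent variables
  converge jointly (joint_weak_convergence), and refining the grid is harmless for the Brownian path
  because it is continuous (brownian_interpolation_tendsto).
\<close>

section \<open>Dirichlet series with slowly growing coefficient sums\<close>

lemma abel_summation:
  fixes d g :: "nat \<Rightarrow> real"
  shows "(\<Sum>n<N. d n * g n) =
    (\<Sum>k<N. d k) * g N + (\<Sum>n<N. (\<Sum>k<Suc n. d k) * (g n - g (Suc n)))"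
  by (induction N) (auto simp: algebra_simps)

lemma powr_neg_difference:
  fixes x v :: real
  assumes "x > 0" "v \<ge> 0"
  shows "x powr -v - (x + 1) powr -v \<le> v * x powr (-v - 1)"
    and "v * (x + 1) powr (-v - 1) \<le> x powr -v - (x + 1) powr -v"
    and "0 \<le> x powr -v - (x + 1) powr -v"
proof -
  have "\<exists>z. x < z \<and> z < x + 1 \<and>
      (x + 1) powr -v - x powr -v = (x + 1 - x) * (-v * z powr (-v - 1))"
    using assms by (intro MVT2) (auto intro!: derivative_eq_intros)
  then obtain z where z: "x < z" "z < x + 1" "(x + 1) powr -v - x powr -v = -v * z powr (-v - 1)"
    by auto
  have "z powr (-v - 1) \<le> x powr (-v - 1)"
    using z assms by (intro powr_mono2') auto
  then show "x powr -v - (x + 1) powr -v \<le> v * x powr (-v - 1)"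
    using z assms mult_left_mono[of "z powr (-v - 1)" "x powr (-v - 1)" v] by simp
  have "(x + 1) powr (-v - 1) \<le> z powr (-v - 1)"
    using z assms by (intro powr_mono2') auto
  then show "v * (x + 1) powr (-v - 1) \<le> x powr -v - (x + 1) powr -v"
    using z assms mult_left_mono[of "(x + 1) powr (-v - 1)" "z powr (-v - 1)" v] by simp
  show "0 \<le> x powr -v - (x + 1) powr -v"
    using powr_mono2'[of "-v" x "x + 1"] assms by simp
qed

text \<open>
  Summation by parts turns the series into one whose terms are partial sums of \<open>d\<close> times
  differences of consecutive powers. These are of order \<open>n powr (\<alpha> - v - 1)\<close>, hence summable,
  locally uniformly in \<open>v\<close>. Two cases are needed: \<open>\<alpha> = 0\<close>, where convergence at one point gives
  convergence and continuity to the right of it, and \<open>\<alpha> > 1/2\<close>, the growth of random partial sums.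
\<close>

lemma dirichlet_series_of_partial_sum_bound:
  fixes d :: "nat \<Rightarrow> real" and \<alpha> C :: real
  assumes bound: "\<And>n. \<bar>\<Sum>k<n. d k\<bar> \<le> C * real (Suc n) powr \<alpha>" and "\<alpha> \<ge> 0"
  shows "v > \<alpha> \<Longrightarrow> summable (\<lambda>n. d n * real (Suc n) powr -v)"
    and "continuous_on {\<alpha><..} (\<lambda>v. \<Sum>n. d n * real (Suc n) powr -v)"
proof -
  define A where "A n = (\<Sum>k<n. d k)" for n
  define h where "h n v = A (Suc n) * (real (Suc n) powr -v - real (Suc (Suc n)) powr -v)" for n v
  have C: "C \<ge> 0" using bound[of 0] by simp
  define m where "m v1 v2 n = C * 2 powr \<alpha> * v2 * real (Suc n) powr (\<alpha> - v1 - 1)" for v1 v2 n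
  have h: "norm (h n v) \<le> m v1 v2 n" if "\<alpha> < v1" "v1 \<le> v" "v \<le> v2" for v1 v2 v n
  proof -
    have d1: "real (Suc n) powr -v - real (Suc (Suc n)) powr -v \<le> v * real (Suc n) powr (-v - 1)"
      and d2: "0 \<le> real (Suc n) powr -v - real (Suc (Suc n)) powr -v"
      using powr_neg_difference[of "real (Suc n)" v] that \<open>\<alpha> \<ge> 0\<close>
      by (simp_all add: add.commute)
    have "\<bar>A (Suc n)\<bar> \<le> C * real (Suc (Suc n)) powr \<alpha>"
      unfolding A_def by (rule bound)
    also have "\<dots> \<le> C * (2 * real (Suc n)) powr \<alpha>"
      using C \<open>\<alpha> \<ge> 0\<close> by (intro mult_left_mono powr_mono2) auto
    also have "\<dots> = C * 2 powr \<alpha> * real (Suc n) powr \<alpha>"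
      by (subst powr_mult) auto
    finally have A: "\<bar>A (Suc n)\<bar> \<le> C * 2 powr \<alpha> * real (Suc n) powr \<alpha>" .
    have "norm (h n v) \<le> (C * 2 powr \<alpha> * real (Suc n) powr \<alpha>) * (v * real (Suc n) powr (-v - 1))"
      unfolding h_def real_norm_def abs_mult
      using A d1 d2 C by (intro mult_mono) auto
    also have "\<dots> = C * 2 powr \<alpha> * v * real (Suc n) powr (\<alpha> - v - 1)"
      by (simp add: powr_add[symmetric] algebra_simps flip: powr_add)
    also have "\<dots> \<le> C * 2 powr \<alpha> * v2 * real (Suc n) powr (\<alpha> - v1 - 1)"
      using that C \<open>\<alpha> \<ge> 0\<close> by (intro mult_mono powr_mono) auto
    finally show ?thesis unfolding m_def .
  qed
  have m: "summable (m v1 v2)" if "\<alpha> < v1" for v1 v2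
  proof -
    have "summable (\<lambda>n. real n powr (\<alpha> - v1 - 1))"
      using that by (subst summable_real_powr_iff) auto
    then have "summable (\<lambda>n. real (Suc n) powr (\<alpha> - v1 - 1))"
      by (subst summable_Suc_iff)
    then show ?thesis unfolding m_def by (rule summable_mult)
  qed
  \<comment> \<open>The boundary term of the summation by parts.\<close>
  have boundary: "(\<lambda>n. A n * real (Suc n) powr -v) \<longlonglongrightarrow> 0" if "v > \<alpha>" for v
  proof (rule Lim_null_comparison)
    show "\<forall>\<^sub>F n in sequentially. norm (A n * real (Suc n) powr -v) \<le> C * real (Suc n) powr (\<alpha> - v)"
    proof (intro always_eventually allI)
      fix n
      have "\<bar>A n\<bar> * real (Suc n) powr -v \<le> C * real (Suc n) powr \<alpha> * real (Suc n) powr -v"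
        using bound[of n] unfolding A_def by (intro mult_right_mono) auto
      then show "norm (A n * real (Suc n) powr -v) \<le> C * real (Suc n) powr (\<alpha> - v)"
        by (simp add: abs_mult powr_add[symmetric] mult.assoc)
    qed
    have "(\<lambda>n. real n powr (\<alpha> - v)) \<longlonglongrightarrow> 0"
      using that by (intro tendsto_neg_powr filterlim_real_sequentially) auto
    then have "(\<lambda>n. real (Suc n) powr (\<alpha> - v)) \<longlonglongrightarrow> 0"
      by (rule LIMSEQ_Suc)
    from tendsto_mult_left[OF this, of C]
    show "(\<lambda>n. C * real (Suc n) powr (\<alpha> - v)) \<longlonglongrightarrow> 0" by simp
  qed
  have sums: "(\<lambda>n. d n * real (Suc n) powr -v) sums (\<Sum>n. h n v)" if "v > \<alpha>" for v
  proof -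
    have "summable (\<lambda>n. h n v)"
      using h[of v v v] m[of v v] that by (intro summable_comparison_test[OF _ m[of v v]]) auto
    then have "(\<lambda>N. A N * real (Suc N) powr -v + (\<Sum>n<N. h n v)) \<longlonglongrightarrow> 0 + (\<Sum>n. h n v)"
      by (intro tendsto_add boundary that summable_LIMSEQ)
    then show ?thesis
      unfolding sums_def h_def A_def
      using abel_summation[of d "\<lambda>n. real (Suc n) powr -v"] by simp
  qed
  show "summable (\<lambda>n. d n * real (Suc n) powr -v)" if "v > \<alpha>" for v
    using sums[OF that] by (rule sums_summable)
  have cont: "continuous_on {v1..v2} (\<lambda>v. \<Sum>n. h n v)" if "\<alpha> < v1" for v1 v2
  proof (rule uniform_limit_theorem)
    show "uniform_limit {v1..v2} (\<lambda>n v. \<Sum>i<n. h i v) (\<lambda>v. \<Sum>n. h n v) sequentially"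
      using h that by (intro Weierstrass_m_test[OF _ m[OF that, of v2]]) auto
    show "\<forall>\<^sub>F n in sequentially. continuous_on {v1..v2} (\<lambda>v. \<Sum>i<n. h i v)"
      unfolding h_def by (intro always_eventually allI continuous_intros) auto
  qed simp
  have "continuous_on {\<alpha><..} (\<lambda>v. \<Sum>n. h n v)"
  proof (rule continuous_at_imp_continuous_on, rule ballI)
    fix v assume v: "v \<in> {\<alpha><..}"
    have "continuous_on {(\<alpha> + v) / 2<..<v + 1} (\<lambda>v. \<Sum>n. h n v)"
      by (rule continuous_on_subset[OF cont[of "(\<alpha> + v) / 2" "v + 1"]]) (use v in auto)
    then show "isCont (\<lambda>v. \<Sum>n. h n v) v"
      using v by (subst (asm) continuous_on_eq_continuous_at) auto
  qed
  then show "continuous_on {\<alpha><..} (\<lambda>v. \<Sum>n. d n * real (Suc n) powr -v)"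
    by (rule continuous_on_eq) (use sums in \<open>auto simp: sums_iff\<close>)
qed

section \<open>Sums over primes\<close>

text \<open>
  The product of the distinct primes dividing \<open>n\<close> divides \<open>n\<close>.
\<close>

lemma sum_ln_prime_divisors_le:
  fixes n :: nat
  assumes "n > 0"
  shows "(\<Sum>p | prime p \<and> p dvd n. ln (real p)) \<le> ln (real n)"
proof -
  have pf: "{p. prime p \<and> p dvd n} = prime_factors n"
    using assms by (auto simp: prime_factors_dvd)
  have "real n = real (\<Prod>p\<in>prime_factors n. p ^ multiplicity p n)"
    using prime_factorization_nat[OF assms] by simp
  also have "\<dots> = (\<Prod>p\<in>prime_factors n. real p ^ multiplicity p n)"
    by simp
  finally have n: "real n = (\<Prod>p\<in>prime_factors n. real p ^ multiplicity p n)" .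
  have "ln (real n) = (\<Sum>p\<in>prime_factors n. real (multiplicity p n) * ln (real p))"
    by (subst n, subst ln_prod) (auto simp: ln_realpow prime_gt_0_nat in_prime_factors_iff dest: prime_gt_0_nat)
  moreover have "ln (real p) \<le> real (multiplicity p n) * ln (real p)" if "p \<in> prime_factors n" for p
  proof -
    have "p \<ge> 1" "multiplicity p n \<ge> 1"
      using that assms prime_ge_1_nat
      by (auto simp: in_prime_factors_iff prime_factors_multiplicity Suc_le_eq)
    then show ?thesis
      using mult_right_mono[of 1 "real (multiplicity p n)" "ln (real p)"] by simp
  qed
  ultimately show ?thesis
    unfolding pf by (simp add: sum_mono)
qed

lemma sum_powr_tail_le:
  fixes u :: real
  assumes "u > 0" "m > 0"
  shows "(\<Sum>n\<in>{m<..K}. real n powr (-u - 1)) \<le> real m powr -u / u"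
proof (cases "m \<le> K")
  case True
  have "u * (\<Sum>n\<in>{m<..K}. real n powr (-u - 1)) \<le> real m powr -u - real K powr -u"
    using True
  proof (induction K rule: dec_induct)
    case (step K)
    have "{m<..Suc K} = insert (Suc K) {m<..K}" using step by auto
    then show ?case
      using step powr_neg_difference(2)[of "real K" u] assms
      by (auto simp: distrib_left add.commute)
  qed simp
  then have "u * (\<Sum>n\<in>{m<..K}. real n powr (-u - 1)) \<le> real m powr -u"
    by (rule order_trans) simp
  then show ?thesis
    using assms by (simp add: pos_le_divide_eq mult.commute)
qed (use assms in auto)

text \<open>
  Replace \<open>ln n\<close> by the larger sum of \<open>1/m\<close> over \<open>m < n\<close> and sum over \<open>n > m\<close> first: the tail
  of the zeta series beyond \<open>m\<close> is at most \<open>m powr -u / u\<close>. In the limit this is the inequality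
  \<open>-\<zeta>' \<le> \<zeta> / u\<close> at \<open>1 + u\<close>.
\<close>

lemma sum_ln_powr_le:
  fixes u :: real
  assumes "u > 0"
  shows "(\<Sum>n\<in>{1..K}. ln (real n) * real n powr (-u - 1)) \<le> (\<Sum>n\<in>{1..K}. real n powr (-u - 1)) / u"
proof -
  have "ln (real n) \<le> (\<Sum>m | m \<in> {1..K} \<and> m < n. 1 / real m)" if "n \<in> {1..K}" for n
  proof -
    have "ln (real n) \<le> harm (n - 1)"
      using ln_le_harm[of "n - 1"] that by (simp add: of_nat_diff)
    also have "\<dots> = (\<Sum>m | m \<in> {1..K} \<and> m < n. 1 / real m)"
      unfolding harm_def using that by (intro sum.cong) (auto simp: field_simps)
    finally show ?thesis .
  qed
  then have "(\<Sum>n\<in>{1..K}. ln (real n) * real n powr (-u - 1)) \<le>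
      (\<Sum>n\<in>{1..K}. \<Sum>m | m \<in> {1..K} \<and> m < n. 1 / real m * real n powr (-u - 1))"
    unfolding sum_distrib_right[symmetric] by (intro sum_mono mult_right_mono) auto
  also have "\<dots> = (\<Sum>m\<in>{1..K}. \<Sum>n | n \<in> {1..K} \<and> m < n. 1 / real m * real n powr (-u - 1))"
    by (rule sum.swap_restrict) auto
  also have "\<dots> \<le> (\<Sum>m\<in>{1..K}. 1 / real m * (real m powr -u / u))"
    unfolding sum_distrib_left[symmetric]
  proof (intro sum_mono mult_left_mono)
    fix m assume "m \<in> {1..K}"
    then have "{n. n \<in> {1..K} \<and> m < n} = {m<..K}" by auto
    then show "(\<Sum>n | n \<in> {1..K} \<and> m < n. real n powr (-u - 1)) \<le> real m powr -u / u"
      using sum_powr_tail_le[OF assms, of m K] \<open>m \<in> {1..K}\<close> by simp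
  qed auto
  also have "\<dots> = (\<Sum>n\<in>{1..K}. real n powr (-u - 1)) / u"
    unfolding sum_divide_distrib
    by (intro sum.cong) (auto simp: powr_diff)
  finally show ?thesis .
qed

text \<open>
  Multiplying out, the number \<open>n = p * m\<close> receives the total weight of \<open>ln p\<close> over the primes
  dividing it, which is at most \<open>ln n\<close>.
\<close>

lemma prime_log_sum_times_zeta_le:
  fixes s :: real
  shows "(\<Sum>p | prime p \<and> p \<le> N. ln (real p) * real p powr s) * (\<Sum>m\<in>{1..M}. real m powr s)
    \<le> (\<Sum>n\<in>{1..N * M}. ln (real n) * real n powr s)"
proof -
  let ?P = "{p. prime p \<and> p \<le> N}"
  have fin: "finite ?P" by (rule finite_subset[of _ "{..N}"]) auto
  have pos: "p > 0" if "p \<in> ?P" for p using that prime_gt_0_nat by auto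
  have "(\<Sum>p\<in>?P. ln (real p) * real p powr s) * (\<Sum>m\<in>{1..M}. real m powr s)
      = (\<Sum>p\<in>?P. \<Sum>m\<in>{1..M}. ln (real p) * real (p * m) powr s)"
    unfolding sum_product by (intro sum.cong) (auto simp: powr_mult)
  also have "\<dots> \<le> (\<Sum>p\<in>?P. \<Sum>n | n \<in> {1..N * M} \<and> p dvd n. ln (real p) * real n powr s)"
  proof (intro sum_mono)
    fix p assume p: "p \<in> ?P"
    have "(\<Sum>m\<in>{1..M}. ln (real p) * real (p * m) powr s) =
        (\<Sum>n\<in>(\<lambda>m. p * m) ` {1..M}. ln (real p) * real n powr s)"
      using pos[OF p] by (subst sum.reindex) (auto simp: inj_on_def)
    also have "\<dots> \<le> (\<Sum>n | n \<in> {1..N * M} \<and> p dvd n. ln (real p) * real n powr s)"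
    proof (rule sum_mono2)
      show "(\<lambda>m. p * m) ` {1..M} \<subseteq> {n. n \<in> {1..N * M} \<and> p dvd n}"
        using p pos[OF p] by (auto intro!: mult_le_mono)
      have "ln (real p) \<ge> 0" using pos[OF p] by simp
      then show "0 \<le> ln (real p) * real n powr s" for n by simp
    qed simp
    finally show "(\<Sum>m\<in>{1..M}. ln (real p) * real (p * m) powr s) \<le>
        (\<Sum>n | n \<in> {1..N * M} \<and> p dvd n. ln (real p) * real n powr s)" .
  qed
  also have "\<dots> = (\<Sum>n\<in>{1..N * M}. \<Sum>p | p \<in> ?P \<and> p dvd n. ln (real p) * real n powr s)"
    by (rule sum.swap_restrict) (use fin in auto)
  also have "\<dots> \<le> (\<Sum>n\<in>{1..N * M}. ln (real n) * real n powr s)"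
    unfolding sum_distrib_right[symmetric]
  proof (intro sum_mono mult_right_mono)
    fix n assume n: "n \<in> {1..N * M}"
    have "(\<Sum>p | p \<in> ?P \<and> p dvd n. ln (real p)) \<le> (\<Sum>p | prime p \<and> p dvd n. ln (real p))"
    proof (rule sum_mono2)
      have "{p. prime p \<and> p dvd n} \<subseteq> {..n}"
        using n by (auto intro: dvd_imp_le)
      then show "finite {p. prime p \<and> p dvd n}" by (rule finite_subset) simp
      show "0 \<le> ln (real p)" if "p \<in> {p. prime p \<and> p dvd n} - {p \<in> ?P. p dvd n}" for p
        using that prime_ge_1_nat[of p] by simp
    qed auto
    also have "\<dots> \<le> ln (real n)"
      using n by (intro sum_ln_prime_divisors_le) auto
    finally show "(\<Sum>p | p \<in> ?P \<and> p dvd n. ln (real p)) \<le> ln (real n)" .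
  qed auto
  finally show ?thesis .
qed

text \<open>
  An elementary form of \<open>-\<zeta>'/\<zeta> \<le> 1/u\<close> at \<open>1 + u\<close>: the product of the left-hand side with the
  zeta series is at most the zeta series divided by \<open>u\<close>, and the zeta series cancels.
\<close>

lemma prime_log_sum_le:
  fixes u :: real
  assumes "u > 0"
  shows "(\<Sum>p | prime p \<and> p \<le> N. ln (real p) * real p powr (-u - 1)) \<le> 1 / u"
proof -
  define Q where "Q = (\<Sum>p | prime p \<and> p \<le> N. ln (real p) * real p powr (-u - 1))"
  define Z where "Z M = (\<Sum>m\<in>{1..M}. real m powr (-u - 1))" for M :: nat
  define Zinf where "Zinf = (\<Sum>n. real n powr (-u - 1))"
  have summ: "summable (\<lambda>n. real n powr (-u - 1))"
    using assms by (subst summable_real_powr_iff) auto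
  have Z_eq: "Z M = (\<Sum>n<Suc M. real n powr (-u - 1))" for M
    unfolding Z_def by (subst lessThan_Suc_atMost, rule sum.mono_neutral_left) (auto simp: not_le)
  have Z_lim: "Z \<longlonglongrightarrow> Zinf"
    unfolding Z_eq Zinf_def using summable_LIMSEQ[OF summ] by (rule LIMSEQ_Suc)
  have Z_le: "Z M \<le> Zinf" for M
    unfolding Z_eq Zinf_def by (rule sum_le_suminf[OF summ]) auto
  have Zinf_pos: "Zinf > 0"
    using Z_le[of 1] by (simp add: Z_def)
  have "Q * Z M \<le> Zinf / u" for M
  proof -
    have "Q * Z M \<le> (\<Sum>n\<in>{1..N * M}. ln (real n) * real n powr (-u - 1))"
      unfolding Q_def Z_def by (rule prime_log_sum_times_zeta_le)
    also have "\<dots> \<le> Z (N * M) / u"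
      unfolding Z_def by (rule sum_ln_powr_le[OF assms])
    also have "\<dots> \<le> Zinf / u"
      using Z_le assms by (simp add: divide_right_mono)
    finally show ?thesis .
  qed
  then have "Q * Zinf \<le> Zinf / u"
    by (intro LIMSEQ_le_const2[OF tendsto_mult_left[OF Z_lim]]) auto
  then show ?thesis
    using Zinf_pos assms unfolding Q_def[symmetric] by (simp add: field_simps)
qed

text \<open>
  By the bound on the logarithmic sum, \<open>w \<mapsto> (\<Sum>p. p powr (-w-1)) + ln w\<close> has a nonnegative
  derivative.
\<close>

lemma prime_sum_difference_le:
  fixes u v :: real
  assumes "0 < u" "u \<le> v"
  shows "(\<Sum>p | prime p \<and> p \<le> N. real p powr (-u - 1) - real p powr (-v - 1)) \<le> ln (v / u)"
proof -
  define f where "f w = (\<Sum>p | prime p \<and> p \<le> N. real p powr (-w - 1)) + ln w" for w :: real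
  have "f u \<le> f v"
  proof (rule DERIV_nonneg_imp_nondecreasing[of u v f, OF \<open>u \<le> v\<close>])
    fix w assume w: "u \<le> w" "w \<le> v"
    have "(f has_real_derivative
        (\<Sum>p | prime p \<and> p \<le> N. - (ln (real p) * real p powr (-w - 1))) + 1 / w) (at w)"
      unfolding f_def
    proof (intro DERIV_add DERIV_sum)
      fix p assume "p \<in> {p. prime p \<and> p \<le> N}"
      then have "real p > 0" by (auto simp: prime_gt_0_nat)
      then show "((\<lambda>w. real p powr (-w - 1)) has_real_derivative
          - (ln (real p) * real p powr (-w - 1))) (at w)"
        by (auto intro!: derivative_eq_intros)
    qed (use w assms in \<open>auto intro!: derivative_eq_intros\<close>)
    moreover have "0 \<le> (\<Sum>p | prime p \<and> p \<le> N. - (ln (real p) * real p powr (-w - 1))) + 1 / w"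
      using prime_log_sum_le[of w N] w assms by (simp add: sum_negf)
    ultimately show "\<exists>y. (f has_real_derivative y) (at w) \<and> 0 \<le> y" by blast
  qed
  then show ?thesis
    using assms by (simp add: f_def sum_subtractf ln_div)
qed

text \<open>
  For \<open>0 \<le> b \<le> a\<close> one has \<open>(a - b)\<^sup>2 \<le> a\<^sup>2 - b\<^sup>2\<close>, which reduces the square to a difference of
  prime sums at \<open>2u\<close> and \<open>2v\<close>. This is the variance of an increment of the random series.
\<close>

lemma prime_square_increment_le:
  fixes u v :: real
  assumes "0 < u" "u \<le> v"
  shows "(\<Sum>p | prime p \<and> p \<le> N. (real p powr (-u) - real p powr (-v))\<^sup>2 / real p) \<le> ln (v / u)"
proof -
  have "(real p powr (-u) - real p powr (-v))\<^sup>2 / real p \<le>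
      real p powr (-2 * u - 1) - real p powr (-2 * v - 1)" if "prime p" for p
  proof -
    have p: "real p \<ge> 1" using prime_ge_1_nat[OF that] by simp
    define a b where "a = real p powr (-u)" and "b = real p powr (-v)"
    have "b \<le> a" unfolding a_def b_def using p assms by (intro powr_mono) auto
    moreover have "b \<ge> 0" unfolding b_def by simp
    ultimately have "(a - b)\<^sup>2 \<le> a\<^sup>2 - b\<^sup>2"
      using mult_right_mono[of b a b] by (simp add: power2_eq_square algebra_simps)
    moreover have "real p powr (-2 * u - 1) = a\<^sup>2 / real p" "real p powr (-2 * v - 1) = b\<^sup>2 / real p"
      using p unfolding a_def b_def by (simp_all add: powr_diff power2_eq_square flip: powr_add)
    ultimately show ?thesis
      using p unfolding a_def[symmetric] b_def[symmetric]
      by (simp add: diff_divide_distrib[symmetric] divide_right_mono)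
  qed
  then have "(\<Sum>p | prime p \<and> p \<le> N. (real p powr (-u) - real p powr (-v))\<^sup>2 / real p) \<le>
      (\<Sum>p | prime p \<and> p \<le> N. real p powr (-2 * u - 1) - real p powr (-2 * v - 1))"
    by (intro sum_mono) auto
  also have "\<dots> \<le> ln (2 * v / (2 * u))"
    using prime_sum_difference_le[of "2 * u" "2 * v" N] assms by simp
  finally show ?thesis by simp
qed


text \<open>
  Every number is a square times a product of distinct primes, so the harmonic sum is at most the
  sum of the inverse squares, which is at most 2, times the product of \<open>1 + 1/p\<close>.
\<close>

lemma harmonic_sum_le_prime_exponential:
  "(\<Sum>n\<in>{1..N}. 1 / real n) \<le> 2 * exp (\<Sum>p | prime p \<and> p \<le> N. 1 / real p)"
proof -
  let ?P = "{p. prime p \<and> p \<le> N}"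
  have fin: "finite ?P" by (rule finite_subset[of _ "{..N}"]) auto
  define m :: "nat \<Rightarrow> nat" where "m n = (\<Prod>p\<in>prime_factors n. p ^ (multiplicity p n div 2))" for n
  define S where "S n = {p \<in> prime_factors n. odd (multiplicity p n)}" for n :: nat
  define h where "h = (\<lambda>(k :: nat, T :: nat set). (1 / real k ^ 2) * (\<Prod>p\<in>T. 1 / real p))"
  have parity: "p ^ k = (p ^ (k div 2)) ^ 2 * (if odd k then p else 1)" for p k :: nat
    by (cases "odd k") (auto elim!: oddE evenE simp: power_even_eq)
  have decomp: "n = m n ^ 2 * \<Prod>(S n)" if "n > 0" for n
  proof -
    have "n = (\<Prod>p\<in>prime_factors n. p ^ multiplicity p n)"
      using prime_factorization_nat[OF that] .
    also have "\<dots> = (\<Prod>p\<in>prime_factors n. (p ^ (multiplicity p n div 2)) ^ 2 *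
        (if odd (multiplicity p n) then p else 1))"
    proof (rule prod.cong[OF refl])
      fix p
      show "p ^ multiplicity p n = (p ^ (multiplicity p n div 2)) ^ 2 *
          (if odd (multiplicity p n) then p else 1)"
        by (rule parity)
    qed
    also have "\<dots> = m n ^ 2 * (\<Prod>p\<in>prime_factors n. if odd (multiplicity p n) then p else 1)"
      by (simp add: prod.distrib m_def prod_power_distrib)
    also have "(\<Prod>p\<in>prime_factors n. if odd (multiplicity p n) then p else 1) = \<Prod>(S n)"
      unfolding S_def by (subst prod.inter_filter) auto
    finally show ?thesis .
  qed
  have inj: "inj_on (\<lambda>n. (m n, S n)) {1..N}"
  proof (rule inj_onI)
    fix n k assume "n \<in> {1..N}" "k \<in> {1..N}" "(m n, S n) = (m k, S k)"
    then show "n = k" using decomp[of n] decomp[of k] by simp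
  qed
  have h_eq: "h (m n, S n) = 1 / real n" if "n \<in> {1..N}" for n
  proof -
    have "n = m n ^ 2 * \<Prod>(S n)" using that by (intro decomp) auto
    then have "real n = real (m n ^ 2 * \<Prod>(S n))" by (rule arg_cong)
    then have "real n = real (m n) ^ 2 * (\<Prod>p\<in>S n. real p)" by simp
    then show ?thesis by (simp add: h_def prod_dividef)
  qed
  have img: "(\<lambda>n. (m n, S n)) ` {1..N} \<subseteq> {1..N} \<times> Pow ?P"
  proof safe
    fix n assume n: "n \<in> {1..N}"
    have mpos: "m n > 0" unfolding m_def by (auto intro!: prod_pos simp: in_prime_factors_iff prime_gt_0_nat)
    have "m n dvd n"
    proof (rule dvdI)
      show "n = m n * (m n * \<Prod>(S n))"
        using decomp[of n] n by (simp add: power2_eq_square mult.assoc)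
    qed
    then have "m n \<le> n" using n by (intro dvd_imp_le) auto
    then show "m n \<in> {1..N}" using n mpos by auto
    fix p assume "p \<in> S n"
    then have p: "prime p" "p dvd n" by (auto simp: S_def in_prime_factors_iff)
    show "prime p" by (rule p)
    show "p \<le> N" using dvd_imp_le[OF p(2)] n by auto
  qed
  have squares: "(\<Sum>k\<in>{1..N}. 1 / real k ^ 2) \<le> 2"
  proof (cases "N \<ge> 1")
    case True
    then have "{1..N} = insert 1 {1<..N}" by auto
    then have "(\<Sum>k\<in>{1..N}. 1 / real k ^ 2) = 1 + (\<Sum>k\<in>{1<..N}. real k powr (-1 - 1))"
      by (simp add: powr_minus powr_numeral divide_inverse)
    also have "\<dots> \<le> 1 + real 1 powr -1 / 1"
      by (intro add_left_mono sum_powr_tail_le) auto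
    finally show ?thesis by simp
  qed simp
  have "(\<Sum>n\<in>{1..N}. 1 / real n) = (\<Sum>x\<in>(\<lambda>n. (m n, S n)) ` {1..N}. h x)"
    by (subst sum.reindex[OF inj]) (use h_eq in simp)
  also have "\<dots> \<le> (\<Sum>x\<in>{1..N} \<times> Pow ?P. h x)"
  proof (rule sum_mono2[OF _ img])
    show "0 \<le> h x" for x by (auto simp: h_def split: prod.split intro!: mult_nonneg_nonneg divide_nonneg_nonneg prod_nonneg)
  qed (use fin in auto)
  also have "\<dots> = (\<Sum>k\<in>{1..N}. 1 / real k ^ 2) * (\<Sum>T\<in>Pow ?P. \<Prod>p\<in>T. 1 / real p)"
    by (simp add: h_def sum_product sum.cartesian_product)
  also have "(\<Sum>T\<in>Pow ?P. \<Prod>p\<in>T. 1 / real p) = (\<Prod>p\<in>?P. 1 / real p + 1)"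
    using fin by (subst prod_add) auto
  also have "\<dots> \<le> (\<Prod>p\<in>?P. exp (1 / real p))"
    by (intro prod_mono) (auto simp: add.commute[of _ 1] intro!: exp_ge_add_one_self add_nonneg_nonneg)
  also have "\<dots> = exp (\<Sum>p\<in>?P. 1 / real p)"
    using fin by (simp add: exp_sum)
  finally have "(\<Sum>n\<in>{1..N}. 1 / real n) \<le> (\<Sum>k\<in>{1..N}. 1 / real k ^ 2) * exp (\<Sum>p\<in>?P. 1 / real p)"
    by (simp add: mult_left_mono sum_nonneg)
  also have "\<dots> \<le> 2 * exp (\<Sum>p\<in>?P. 1 / real p)"
    using squares by (intro mult_right_mono) auto
  finally show ?thesis .
qed

lemma primes_ln_le_eq:
  "{p::nat. prime p \<and> ln (real p) \<le> y} = {p. prime p \<and> p \<le> nat \<lfloor>exp y\<rfloor>}"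
proof -
  have "ln (real p) \<le> y \<longleftrightarrow> p \<le> nat \<lfloor>exp y\<rfloor>" if "prime p" for p :: nat
  proof -
    have "ln (real p) \<le> y \<longleftrightarrow> real p \<le> exp y"
      using prime_gt_0_nat[OF that] by (metis exp_le_cancel_iff exp_ln of_nat_0_less_iff)
    also have "\<dots> \<longleftrightarrow> p \<le> nat \<lfloor>exp y\<rfloor>"
      by (simp add: le_nat_iff le_floor_iff)
    finally show ?thesis .
  qed
  then show ?thesis by auto
qed

lemma finite_primes_ln_le: "finite {p::nat. prime p \<and> ln (real p) \<le> y}"
  unfolding primes_ln_le_eq by (rule finite_subset[of _ "{..nat \<lfloor>exp y\<rfloor>}"]) auto

text \<open>
  Up to the cut-off \<open>ln p \<le> 1/u\<close> the factor \<open>p powr -u\<close> may be inserted at the cost of \<open>exp 1 \<le> 3\<close>.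
\<close>

lemma inverse_prime_le_exp_powr:
  fixes u :: real
  assumes "prime p" "u * ln (real p) \<le> 1"
  shows "1 / real p \<le> 3 * real p powr (-u - 1)"
proof -
  have p: "real p > 0" using prime_gt_0_nat[OF assms(1)] by simp
  have "real p powr u \<le> exp 1"
    using p assms(2) by (simp add: powr_def mult.commute)
  also have "\<dots> \<le> 3" by (rule exp_le)
  finally show ?thesis
    using p by (simp add: powr_diff powr_minus field_simps)
qed

lemma one_minus_powr_le:
  fixes u x :: real
  assumes "x \<ge> 1" "u \<ge> 0"
  shows "1 - x powr -u \<le> u * ln x" "0 \<le> 1 - x powr -u" "x powr -u \<le> 1"
proof -
  show "1 - x powr -u \<le> u * ln x"
    using exp_ge_add_one_self[of "-u * ln x"] assms by (simp add: powr_def)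
  show "x powr -u \<le> 1" using powr_mono[of "-u" 0 x] assms by simp
  then show "0 \<le> 1 - x powr -u" by simp
qed

text \<open>
  Mertens' second theorem with a bounded error. For the upper bound the sum is compared with the full
  series at the exponent \<open>1 + 1/y\<close>, whose logarithmic sum controls the loss; the lower bound comes from
  the harmonic sum up to \<open>exp y\<close>.
\<close>

lemma prime_reciprocal_sum_bounds:
  assumes "y \<ge> 1"
  shows "(\<Sum>p | prime p \<and> ln (real p) \<le> y. 1 / real p) \<le> ln y + 5"
    and "ln y - 1 \<le> (\<Sum>p | prime p \<and> ln (real p) \<le> y. 1 / real p)"
proof -
  define N where "N = nat \<lfloor>exp y\<rfloor>"
  define u where "u = 1 / y"
  have u: "0 < u" "u \<le> 1" using assms by (auto simp: u_def)
  let ?P = "{p. prime p \<and> p \<le> N}"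
  have P: "{p. prime p \<and> ln (real p) \<le> y} = ?P"
    unfolding N_def by (rule primes_ln_le_eq)
  have P1: "(\<Sum>p\<in>?P. real p powr (-1 - 1)) \<le> 1"
  proof -
    have "(\<Sum>p\<in>?P. real p powr (-1 - 1)) \<le> (\<Sum>n\<in>{1<..N}. real n powr (-1 - 1))"
      by (intro sum_mono2) (auto dest: prime_gt_1_nat)
    also have "\<dots> \<le> real 1 powr -1 / 1" by (rule sum_powr_tail_le) auto
    finally show ?thesis by simp
  qed
  have "1 / real p \<le> real p powr (-u - 1) + 3 * u * (ln (real p) * real p powr (-u - 1))"
    if p: "p \<in> ?P" for p
  proof -
    have p1: "real p \<ge> 1" using p prime_ge_1_nat[of p] by simp
    have "ln (real p) \<le> y" using p P by blast
    then have le: "u * ln (real p) \<le> 1" using assms by (simp add: u_def field_simps)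
    have "1 / real p = real p powr (-u - 1) + (1 - real p powr -u) * (1 / real p)"
      using p1 by (simp add: powr_diff field_simps)
    also have "\<dots> \<le> real p powr (-u - 1) + (u * ln (real p)) * (3 * real p powr (-u - 1))"
      using p p1 u le inverse_prime_le_exp_powr[of p u] one_minus_powr_le[OF p1, of u]
      by (intro add_left_mono mult_mono) auto
    finally show ?thesis by (simp add: mult_ac)
  qed
  then have "(\<Sum>p\<in>?P. 1 / real p) \<le>
      (\<Sum>p\<in>?P. real p powr (-u - 1) + 3 * u * (ln (real p) * real p powr (-u - 1)))"
    by (rule sum_mono)
  also have "\<dots> = (\<Sum>p\<in>?P. real p powr (-u - 1)) +
      3 * u * (\<Sum>p\<in>?P. ln (real p) * real p powr (-u - 1))"
    by (simp add: sum.distrib sum_distrib_left)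
  also have "(\<Sum>p\<in>?P. real p powr (-u - 1)) \<le> ln (1 / u) + 1"
    using prime_sum_difference_le[of u 1 N] u P1 by (simp add: sum_subtractf)
  also have "3 * u * (\<Sum>p\<in>?P. ln (real p) * real p powr (-u - 1)) \<le> 3 * u * (1 / u)"
    using u by (intro mult_left_mono prime_log_sum_le) auto
  finally show "(\<Sum>p | prime p \<and> ln (real p) \<le> y. 1 / real p) \<le> ln y + 5"
    unfolding P using u by (simp add: u_def)
  have "y \<le> ln (real N + 1)"
  proof -
    have "exp y \<le> real N + 1" unfolding N_def by linarith
    then show ?thesis by (simp add: ln_ge_iff)
  qed
  also have "\<dots> \<le> harm N" by (rule ln_le_harm)
  also have "\<dots> \<le> 2 * exp (\<Sum>p\<in>?P. 1 / real p)"
    using harmonic_sum_le_prime_exponential[of N] by (simp add: harm_def divide_inverse)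
  finally have "ln y \<le> ln (2 * exp (\<Sum>p\<in>?P. 1 / real p))"
    using assms by simp
  also have "\<dots> = ln 2 + (\<Sum>p\<in>?P. 1 / real p)"
    by (simp add: ln_mult)
  finally show "ln y - 1 \<le> (\<Sum>p | prime p \<and> ln (real p) \<le> y. 1 / real p)"
    unfolding P using ln_2_less_1 by simp
qed

text \<open>
  Replacing \<open>p powr -u\<close> by the indicator of \<open>1 < ln p \<le> 1/u\<close> costs only a bounded amount of
  variance: there are boundedly many primes with \<open>ln p \<le> 1\<close>, and everywhere else the squared
  error is at most a constant times \<open>u ln p * p powr -u\<close>.
\<close>

lemma prime_cutoff_weights_le:
  assumes "0 < u" "u \<le> 1"
  shows "(\<Sum>p | prime p \<and> p \<le> N.
    (real p powr (-u) - (if 1 < ln (real p) \<and> ln (real p) \<le> 1 / u then 1 else 0))\<^sup>2 / real p) \<le> 8"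
proof -
  let ?P = "{p. prime p \<and> p \<le> N}"
  define w where "w p = real p powr (-u) - (if 1 < ln (real p) \<and> ln (real p) \<le> 1 / u then 1 else 0)" for p :: nat
  define A where "A = {p::nat. prime p \<and> ln (real p) \<le> 1}"
  have fin: "finite ?P" "finite A"
    unfolding A_def by (auto intro: finite_subset[of _ "{..N}"] finite_primes_ln_le)
  have "(w p)\<^sup>2 / real p \<le> (if p \<in> A then 1 / real p else 0) + 3 * u * (ln (real p) * real p powr (-u - 1))"
    if p: "p \<in> ?P" for p
  proof -
    have p1: "real p \<ge> 1" using p prime_ge_1_nat[of p] by simp
    note b = one_minus_powr_le[OF p1, of u]
    consider "p \<in> A" | "p \<notin> A" "ln (real p) \<le> 1 / u" | "p \<notin> A" "ln (real p) > 1 / u" by linarith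
    then show ?thesis
    proof cases
      case 1
      then have "(w p)\<^sup>2 \<le> 1" using b assms by (simp add: w_def A_def power_le_one_iff abs_le_square_iff)
      then have "(w p)\<^sup>2 / real p \<le> 1 / real p" using p1 by (simp add: divide_right_mono)
      moreover have "0 \<le> 3 * u * (ln (real p) * real p powr (-u - 1))" using assms p1 by simp
      ultimately show ?thesis using 1 by simp
    next
      case 2
      then have "1 < ln (real p)" using p by (auto simp: A_def)
      then have w: "(w p)\<^sup>2 = (1 - real p powr -u)\<^sup>2"
        using 2 by (simp add: w_def power2_commute)
      have le: "u * ln (real p) \<le> 1" using 2 assms by (simp add: field_simps)
      have "(1 - real p powr -u)\<^sup>2 \<le> u * ln (real p) * 1"
        unfolding power2_eq_square using b assms le by (intro mult_mono) auto
      then have "(w p)\<^sup>2 * (1 / real p) \<le> (u * ln (real p)) * (3 * real p powr (-u - 1))"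
        using p p1 le assms unfolding w
        by (intro mult_mono inverse_prime_le_exp_powr) auto
      then show ?thesis using 2 by (simp add: mult_ac)
    next
      case 3
      have le: "1 \<le> u * ln (real p)" using 3 assms by (simp add: field_simps)
      have "(w p)\<^sup>2 = (real p powr -u)\<^sup>2" using 3 by (simp add: w_def)
      also have "\<dots> \<le> real p powr -u * 1"
        unfolding power2_eq_square using b assms by (intro mult_left_mono) auto
      finally have "(w p)\<^sup>2 / real p \<le> real p powr -u / real p"
        using p1 by (simp add: divide_right_mono)
      also have "\<dots> = 1 * real p powr (-u - 1)" using p1 by (simp add: powr_diff)
      also have "\<dots> \<le> (3 * (u * ln (real p))) * real p powr (-u - 1)"
        using le by (intro mult_right_mono) auto
      finally show ?thesis using 3 by (simp add: mult_ac)
    qed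
  qed
  then have "(\<Sum>p\<in>?P. (w p)\<^sup>2 / real p) \<le>
      (\<Sum>p\<in>?P. (if p \<in> A then 1 / real p else 0) + 3 * u * (ln (real p) * real p powr (-u - 1)))"
    by (rule sum_mono)
  also have "\<dots> = (\<Sum>p\<in>?P \<inter> A. 1 / real p) + 3 * u * (\<Sum>p\<in>?P. ln (real p) * real p powr (-u - 1))"
    using fin by (simp add: sum.distrib sum_distrib_left sum.inter_restrict)
  also have "(\<Sum>p\<in>?P \<inter> A. 1 / real p) \<le> (\<Sum>p\<in>A. 1 / real p)"
    using fin by (intro sum_mono2) auto
  also have "(\<Sum>p\<in>A. 1 / real p) \<le> ln 1 + 5"
    unfolding A_def by (rule prime_reciprocal_sum_bounds) simp
  also have "3 * u * (\<Sum>p\<in>?P. ln (real p) * real p powr (-u - 1)) \<le> 3 * u * (1 / u)"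
    using assms by (intro mult_left_mono prime_log_sum_le) auto
  finally show ?thesis unfolding w_def using assms by simp
qed

section \<open>Series over primes\<close>

text \<open>
  Setting the coefficients to 0 off the primes replaces the enumeration of the primes by sums over all
  natural numbers.
\<close>

definition prime_coeff :: "(nat \<Rightarrow> real) \<Rightarrow> nat \<Rightarrow> real" where
  "prime_coeff a n = (if prime n then a n else 0)"

lemma nth_prime_strict_mono: "strict_mono nth_prime"
  unfolding nth_prime_def by (rule strict_mono_enumerate) (rule primes_infinite)

lemma range_nth_prime: "range nth_prime = {p. prime p}"
  unfolding nth_prime_def by (rule range_enumerate) (rule primes_infinite)

lemma prime_series_sums_iff:
  "prime_series_term a u sums x \<longleftrightarrow> (\<lambda>n. prime_coeff a n * real n powr -(1/2 + u)) sums x"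
proof -
  define f where "f n = prime_coeff a n * real n powr -(1/2 + u)" for n
  have zero: "f n = 0" if "n \<notin> range nth_prime" for n
    using that by (simp add: f_def range_nth_prime prime_coeff_def)
  have "f (nth_prime k) = prime_series_term a u k" for k
  proof -
    have "nth_prime k \<in> {p. prime p}"
      unfolding range_nth_prime[symmetric] by (rule rangeI)
    then show ?thesis
      by (simp only: f_def prime_coeff_def prime_series_term_def powr_minus divide_inverse mem_Collect_eq if_True)
  qed
  then have "prime_series_term a u = (\<lambda>k. f (nth_prime k))" by (intro ext) (rule sym)
  moreover have "(\<lambda>k. f (nth_prime k)) sums x \<longleftrightarrow> f sums x"
    by (rule sums_mono_reindex[OF nth_prime_strict_mono zero])
  ultimately show ?thesis unfolding f_def by simp
qed

lemma summable_prime_series_iff: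
  "summable (prime_series_term a u) \<longleftrightarrow> summable (\<lambda>n. prime_coeff a n * real n powr -(1/2 + u))"
  unfolding summable_def prime_series_sums_iff ..

lemma prime_series_eq: "prime_series a u = (\<Sum>n. prime_coeff a n * real n powr -(1/2 + u))"
  unfolding prime_series_def suminf_def prime_series_sums_iff ..

text \<open>
  Convergence at one point gives convergence and continuity to the right of it, so countably many
  points suffice. This makes regularity a measurable event.
\<close>

lemma regular_coeffs_iff:
  "regular_coeffs a \<longleftrightarrow> (\<forall>m. summable (prime_series_term a (1 / real (Suc m))))"
proof
  assume R: "\<forall>m. summable (prime_series_term a (1 / real (Suc m)))"
  have *: "summable (prime_series_term a u) \<and> continuous_on {1 / real (Suc m)<..} (prime_series a)"
    if "u > 1 / real (Suc m)" for u m
  proof -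
    define u0 where "u0 = 1 / real (Suc m)"
    define d where "d n = prime_coeff a (Suc n) * real (Suc n) powr -(1/2 + u0)" for n
    have "summable (\<lambda>n. prime_coeff a n * real n powr -(1/2 + u0))"
      using R unfolding summable_prime_series_iff u0_def by blast
    then have "summable d" unfolding d_def by (subst summable_Suc_iff)
    then have "Bseq (\<lambda>n. \<Sum>k<n. d k)"
      by (intro convergent_imp_Bseq) (simp add: summable_iff_convergent)
    then obtain C where "\<And>n. norm (\<Sum>k<n. d k) \<le> C" by (auto simp: Bseq_def)
    then have bound: "\<bar>\<Sum>k<n. d k\<bar> \<le> C * real (Suc n) powr 0" for n by simp
    have eq: "d n * real (Suc n) powr -(w - u0) = prime_coeff a (Suc n) * real (Suc n) powr -(1/2 + w)" for n w
      unfolding d_def mult.assoc powr_add[symmetric] by simp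
    have summ: "summable (\<lambda>n. prime_coeff a n * real n powr -(1/2 + w))" if "w > u0" for w
      using dirichlet_series_of_partial_sum_bound(1)[OF bound, of "w - u0"] that
      unfolding eq using summable_Suc_iff[of "\<lambda>n. prime_coeff a n * real n powr -(1/2 + w)"] by simp
    have "continuous_on {u0<..} (\<lambda>w. \<Sum>n. d n * real (Suc n) powr -(w - u0))"
      by (rule continuous_on_compose2[OF dirichlet_series_of_partial_sum_bound(2)[OF bound order_refl]])
        (auto intro!: continuous_intros)
    then have "continuous_on {u0<..} (prime_series a)"
    proof (rule continuous_on_eq)
      fix w assume "w \<in> {u0<..}"
      then have "(\<Sum>n. prime_coeff a (Suc n) * real (Suc n) powr -(1/2 + w)) = prime_series a w"
        using suminf_split_head[OF summ[of w]] by (simp add: prime_series_eq)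
      then show "(\<Sum>n. d n * real (Suc n) powr -(w - u0)) = prime_series a w"
        unfolding eq .
    qed
    with summ that show ?thesis unfolding u0_def summable_prime_series_iff by blast
  qed
  have ex: "\<exists>m. 1 / real (Suc m) < u" if "u > 0" for u :: real
    using nat_approx_posE[OF that] by blast
  have "continuous_on {0<..} (prime_series a)"
  proof (rule continuous_at_imp_continuous_on, rule ballI)
    fix u :: real assume "u \<in> {0<..}"
    then obtain m where m: "1 / real (Suc m) < u" using ex by auto
    with * show "isCont (prime_series a) u"
      using continuous_on_eq_continuous_at[of "{1 / real (Suc m)<..}" "prime_series a"] by auto
  qed
  then show "regular_coeffs a"
    unfolding regular_coeffs_def using ex * by blast
qed (simp add: regular_coeffs_def)

lemma regular_coeffs_of_growth:
  assumes "\<And>\<delta>. \<delta> > 0 \<Longrightarrow> \<exists>C. \<forall>n. \<bar>\<Sum>k<n. prime_coeff a (Suc k)\<bar> \<le> C * real (Suc n) powr (1/2 + \<delta>)"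
  shows "regular_coeffs a"
  unfolding regular_coeffs_iff
proof
  fix m
  define u where "u = 1 / real (Suc m)"
  have u: "u > 0" by (simp add: u_def)
  then obtain C where C: "\<And>n. \<bar>\<Sum>k<n. prime_coeff a (Suc k)\<bar> \<le> C * real (Suc n) powr (1/2 + u/2)"
    using assms[of "u/2"] by auto
  have "summable (\<lambda>n. prime_coeff a (Suc n) * real (Suc n) powr -(1/2 + u))"
    by (rule dirichlet_series_of_partial_sum_bound(1)[OF C]) (use u in auto)
  then show "summable (prime_series_term a (1 / real (Suc m)))"
    unfolding summable_prime_series_iff u_def by (subst (asm) summable_Suc_iff)
qed

text \<open>
  This case applies to the coefficients left over by the truncation; the bound is uniform in \<open>u\<close>,
  hence survives the supremum over time.
\<close>

lemma prime_series_abs_summable: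
  assumes "summable (\<lambda>n. \<bar>prime_coeff a n\<bar> * real n powr -(1/2))"
  shows "regular_coeffs a"
    and "u \<ge> 0 \<Longrightarrow> \<bar>prime_series a u\<bar> \<le> (\<Sum>n. \<bar>prime_coeff a n\<bar> * real n powr -(1/2))"
proof -
  have le: "norm (prime_coeff a n * real n powr -(1/2 + u)) \<le> \<bar>prime_coeff a n\<bar> * real n powr -(1/2)"
    if "u \<ge> 0" for n u
  proof (cases "n = 0")
    case False
    then show ?thesis
      unfolding real_norm_def abs_mult using that by (intro mult_left_mono) (auto intro!: powr_mono)
  qed simp
  have summ: "summable (\<lambda>n. norm (prime_coeff a n * real n powr -(1/2 + u)))" if "u \<ge> 0" for u
    by (rule summable_comparison_test[OF _ assms]) (use le[OF that] in auto)
  show "regular_coeffs a"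
    unfolding regular_coeffs_iff summable_prime_series_iff
  proof
    fix m
    show "summable (\<lambda>n. prime_coeff a n * real n powr -(1/2 + 1 / real (Suc m)))"
      by (rule summable_norm_cancel, rule summ) simp
  qed
  assume u: "u \<ge> 0"
  have "\<bar>prime_series a u\<bar> \<le> (\<Sum>n. norm (prime_coeff a n * real n powr -(1/2 + u)))"
    unfolding prime_series_eq using summable_norm[OF summ[OF u]] by simp
  also have "\<dots> \<le> (\<Sum>n. \<bar>prime_coeff a n\<bar> * real n powr -(1/2))"
    by (intro suminf_le le[OF u] summ[OF u] assms)
  finally show "\<bar>prime_series a u\<bar> \<le> (\<Sum>n. \<bar>prime_coeff a n\<bar> * real n powr -(1/2))" .
qed

lemma prime_series_add:
  assumes "regular_coeffs a" "regular_coeffs b"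
  shows "regular_coeffs (\<lambda>n. a n + b n)"
    and "u > 0 \<Longrightarrow> prime_series (\<lambda>n. a n + b n) u = prime_series a u + prime_series b u"
proof -
  have eq: "prime_series_term (\<lambda>n. a n + b n) u k = prime_series_term a u k + prime_series_term b u k" for u k
    by (simp add: prime_series_term_def add_divide_distrib)
  show add: "prime_series (\<lambda>n. a n + b n) u = prime_series a u + prime_series b u" if "u > 0" for u
    unfolding prime_series_def eq using assms that
    by (intro suminf_add[symmetric]) (auto simp: regular_coeffs_def)
  have "continuous_on {0<..} (prime_series (\<lambda>n. a n + b n))"
  proof (rule continuous_on_eq)
    show "continuous_on {0<..} (\<lambda>u. prime_series a u + prime_series b u)"
      using assms by (intro continuous_on_add) (auto simp: regular_coeffs_def)
  qed (use add in auto)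
  then show "regular_coeffs (\<lambda>n. a n + b n)"
    using assms unfolding regular_coeffs_def eq by (auto intro: summable_add)
qed

section \<open>Moment bounds for sums of independent variables\<close>

lemma exp_le_quadratic:
  fixes x :: real
  assumes "x \<le> 1"
  shows "exp x \<le> 1 + x + x\<^sup>2"
proof (cases "x \<ge> 0")
  case True
  then show ?thesis using exp_bound[of x] assms by simp
next
  case False
  define y where "y = - x"
  have y: "y > 0" using False by (simp add: y_def)
  have "1 \<le> 1 + y ^ 3" using y by simp
  also have "\<dots> = (1 + y) * (1 - y + y\<^sup>2)" by (simp add: algebra_simps power2_eq_square power3_eq_cube)
  also have "\<dots> \<le> exp y * (1 - y + y\<^sup>2)"
  proof (intro mult_right_mono exp_ge_add_one_self)
    have "1 - y + y\<^sup>2 = (y - 1/2)\<^sup>2 + 3/4" by (simp add: power2_eq_square algebra_simps)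
    then show "0 \<le> 1 - y + y\<^sup>2" by simp
  qed
  finally have "exp (-y) \<le> 1 - y + y\<^sup>2"
    by (simp add: exp_minus field_simps)
  then show ?thesis by (simp add: y_def)
qed

lemma fourth_power_le_exp:
  fixes x :: real
  shows "x ^ 4 \<le> 24 * exp \<bar>x\<bar>"
proof -
  have "(\<lambda>n. \<bar>x\<bar> ^ n /\<^sub>R fact n) sums exp \<bar>x\<bar>" by (rule exp_converges)
  then have "(\<Sum>n\<in>{4}. \<bar>x\<bar> ^ n /\<^sub>R fact n) \<le> exp \<bar>x\<bar>"
    by (metis (no_types, lifting) abs_ge_zero finite.emptyI finite.insertI inverse_nonnegative_iff_nonnegative
        fact_ge_zero real_scaleR_def scaleR_nonneg_nonneg sum_le_suminf sums_iff zero_le_power)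
  then show ?thesis by (simp add: fact_numeral)
qed

context prob_space
begin

text \<open>
  For \<open>z \<le> 1\<close> one has \<open>exp z \<le> 1 + z + z\<^sup>2\<close>, so a centred factor has exponential moment at most
  \<open>exp\<close> of its variance, and the factors multiply by independence.
\<close>

lemma exp_sum_expectation_le:
  fixes Z :: "'i \<Rightarrow> 'a \<Rightarrow> real"
  assumes "finite I" and indep: "indep_vars (\<lambda>_. borel) Z I"
    and bnd: "\<And>i \<omega>. i \<in> I \<Longrightarrow> \<omega> \<in> space M \<Longrightarrow> \<bar>Z i \<omega>\<bar> \<le> 1"
    and mean: "\<And>i. i \<in> I \<Longrightarrow> expectation (Z i) = 0"
    and var: "(\<Sum>i\<in>I. expectation (\<lambda>\<omega>. (Z i \<omega>)\<^sup>2)) \<le> V"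
  shows "integrable M (\<lambda>\<omega>. exp (\<Sum>i\<in>I. Z i \<omega>))"
    and "expectation (\<lambda>\<omega>. exp (\<Sum>i\<in>I. Z i \<omega>)) \<le> exp V"
proof -
  have rv[measurable]: "Z i \<in> borel_measurable M" if "i \<in> I" for i
    using indep that by (auto simp: indep_vars_def)
  have int: "integrable M (Z i)" "integrable M (\<lambda>\<omega>. (Z i \<omega>)\<^sup>2)" "integrable M (\<lambda>\<omega>. exp (Z i \<omega>))"
    if "i \<in> I" for i
  proof -
    show "integrable M (Z i)" using that bnd by (intro integrable_const_bound[of _ 1]) auto
    show "integrable M (\<lambda>\<omega>. (Z i \<omega>)\<^sup>2)"
      using that bnd by (intro integrable_const_bound[of _ 1]) (auto simp: abs_square_le_1)
    have "exp (Z i \<omega>) \<le> exp 1" if "\<omega> \<in> space M" for \<omega>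
      using bnd[OF \<open>i \<in> I\<close> that] by simp
    then show "integrable M (\<lambda>\<omega>. exp (Z i \<omega>))"
      using that by (intro integrable_const_bound[of _ "exp 1"]) auto
  qed
  have indep': "indep_vars (\<lambda>_. borel) (\<lambda>i \<omega>. exp (Z i \<omega>)) I"
    by (rule indep_vars_compose2[OF indep]) simp
  have exp_sum': "exp (\<Sum>i\<in>I. Z i \<omega>) = (\<Prod>i\<in>I. exp (Z i \<omega>))" for \<omega>
    using assms(1) by (rule exp_sum)
  show "integrable M (\<lambda>\<omega>. exp (\<Sum>i\<in>I. Z i \<omega>))"
    unfolding exp_sum' by (rule indep_vars_integrable[OF assms(1) indep' int(3)])
  have "expectation (\<lambda>\<omega>. exp (\<Sum>i\<in>I. Z i \<omega>)) = (\<Prod>i\<in>I. expectation (\<lambda>\<omega>. exp (Z i \<omega>)))"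
    unfolding exp_sum' by (rule indep_vars_lebesgue_integral[OF assms(1) indep' int(3)])
  also have "\<dots> \<le> (\<Prod>i\<in>I. exp (expectation (\<lambda>\<omega>. (Z i \<omega>)\<^sup>2)))"
  proof (intro prod_mono conjI)
    fix i assume i: "i \<in> I"
    show "0 \<le> expectation (\<lambda>\<omega>. exp (Z i \<omega>))" by simp
    have "expectation (\<lambda>\<omega>. exp (Z i \<omega>)) \<le> expectation (\<lambda>\<omega>. 1 + Z i \<omega> + (Z i \<omega>)\<^sup>2)"
      using bnd[OF i] int[OF i] by (intro integral_mono exp_le_quadratic) (auto dest: abs_le_D1)
    also have "\<dots> = 1 + expectation (\<lambda>\<omega>. (Z i \<omega>)\<^sup>2)"
      using int[OF i] mean[OF i] by (simp add: prob_space)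
    also have "\<dots> \<le> exp (expectation (\<lambda>\<omega>. (Z i \<omega>)\<^sup>2))"
      by (rule exp_ge_add_one_self)
    finally show "expectation (\<lambda>\<omega>. exp (Z i \<omega>)) \<le> exp (expectation (\<lambda>\<omega>. (Z i \<omega>)\<^sup>2))" .
  qed
  also have "\<dots> \<le> exp V" using assms(1) var by (simp flip: exp_sum)
  finally show "expectation (\<lambda>\<omega>. exp (\<Sum>i\<in>I. Z i \<omega>)) \<le> exp V" .
qed

lemma exp_abs_sum_expectation_le:
  fixes Z :: "'i \<Rightarrow> 'a \<Rightarrow> real"
  assumes "finite I" and indep: "indep_vars (\<lambda>_. borel) Z I"
    and bnd: "\<And>i \<omega>. i \<in> I \<Longrightarrow> \<omega> \<in> space M \<Longrightarrow> \<bar>Z i \<omega>\<bar> \<le> 1"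
    and mean: "\<And>i. i \<in> I \<Longrightarrow> expectation (Z i) = 0"
    and var: "(\<Sum>i\<in>I. expectation (\<lambda>\<omega>. (Z i \<omega>)\<^sup>2)) \<le> V"
  shows "(\<integral>\<^sup>+\<omega>. ennreal (exp \<bar>\<Sum>i\<in>I. Z i \<omega>\<bar>) \<partial>M) \<le> ennreal (2 * exp V)"
proof -
  have neg: "indep_vars (\<lambda>_. borel) (\<lambda>i \<omega>. - Z i \<omega>) I"
    by (rule indep_vars_compose2[OF indep]) simp
  have pos_part: "integrable M (\<lambda>\<omega>. exp (\<Sum>i\<in>I. Z i \<omega>))" "expectation (\<lambda>\<omega>. exp (\<Sum>i\<in>I. Z i \<omega>)) \<le> exp V"
    using exp_sum_expectation_le[OF assms] by auto
  have neg_part: "integrable M (\<lambda>\<omega>. exp (\<Sum>i\<in>I. - Z i \<omega>))"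
    "expectation (\<lambda>\<omega>. exp (\<Sum>i\<in>I. - Z i \<omega>)) \<le> exp V"
    using exp_sum_expectation_le[OF assms(1) neg, of V] bnd mean var by auto
  have "(\<integral>\<^sup>+\<omega>. ennreal (exp \<bar>\<Sum>i\<in>I. Z i \<omega>\<bar>) \<partial>M) \<le>
      (\<integral>\<^sup>+\<omega>. ennreal (exp (\<Sum>i\<in>I. Z i \<omega>) + exp (\<Sum>i\<in>I. - Z i \<omega>)) \<partial>M)"
    by (intro nn_integral_mono ennreal_leI) (auto simp: abs_if sum_negf)
  also have "\<dots> = ennreal (expectation (\<lambda>\<omega>. exp (\<Sum>i\<in>I. Z i \<omega>) + exp (\<Sum>i\<in>I. - Z i \<omega>)))"
    by (intro nn_integral_eq_integral Bochner_Integration.integrable_add pos_part neg_part)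
      (auto intro: add_nonneg_nonneg)
  also have "\<dots> \<le> ennreal (2 * exp V)"
    using pos_part neg_part by (intro ennreal_leI) simp
  finally show ?thesis .
qed

lemma fourth_moment_sum_le:
  fixes Z :: "'i \<Rightarrow> 'a \<Rightarrow> real"
  assumes "finite I" and indep: "indep_vars (\<lambda>_. borel) Z I"
    and bnd: "\<And>i \<omega>. i \<in> I \<Longrightarrow> \<omega> \<in> space M \<Longrightarrow> \<bar>Z i \<omega>\<bar> \<le> 1"
    and mean: "\<And>i. i \<in> I \<Longrightarrow> expectation (Z i) = 0"
    and var: "(\<Sum>i\<in>I. expectation (\<lambda>\<omega>. (Z i \<omega>)\<^sup>2)) \<le> V"
  shows "(\<integral>\<^sup>+\<omega>. ennreal ((\<Sum>i\<in>I. Z i \<omega>) ^ 4) \<partial>M) \<le> ennreal (48 * exp V)"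
proof -
  have [measurable]: "Z i \<in> borel_measurable M" if "i \<in> I" for i
    using indep that by (auto simp: indep_vars_def)
  have "(\<integral>\<^sup>+\<omega>. ennreal ((\<Sum>i\<in>I. Z i \<omega>) ^ 4) \<partial>M) \<le>
      (\<integral>\<^sup>+\<omega>. ennreal (24 * exp \<bar>\<Sum>i\<in>I. Z i \<omega>\<bar>) \<partial>M)"
    by (intro nn_integral_mono ennreal_leI fourth_power_le_exp)
  also have "\<dots> = (\<integral>\<^sup>+\<omega>. ennreal 24 * ennreal (exp \<bar>\<Sum>i\<in>I. Z i \<omega>\<bar>) \<partial>M)"
    by (subst ennreal_mult') auto
  also have "\<dots> = ennreal 24 * (\<integral>\<^sup>+\<omega>. ennreal (exp \<bar>\<Sum>i\<in>I. Z i \<omega>\<bar>) \<partial>M)"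
    by (rule nn_integral_cmult) measurable
  also have "\<dots> \<le> ennreal 24 * ennreal (2 * exp V)"
    by (intro mult_left_mono exp_abs_sum_expectation_le[OF assms]) auto
  also have "\<dots> = ennreal (48 * exp V)" by (subst ennreal_mult'[symmetric]) auto
  finally show ?thesis .
qed

lemma second_moment_sum_indep:
  fixes Z :: "'i \<Rightarrow> 'a \<Rightarrow> real"
  assumes "finite I" and indep: "indep_vars (\<lambda>_. borel) Z I"
    and sq: "\<And>i. i \<in> I \<Longrightarrow> integrable M (\<lambda>\<omega>. (Z i \<omega>)\<^sup>2)"
    and mean: "\<And>i. i \<in> I \<Longrightarrow> expectation (Z i) = 0"
  shows "integrable M (\<lambda>\<omega>. (\<Sum>i\<in>I. Z i \<omega>)\<^sup>2)"
    and "expectation (\<lambda>\<omega>. (\<Sum>i\<in>I. Z i \<omega>)\<^sup>2) = (\<Sum>i\<in>I. expectation (\<lambda>\<omega>. (Z i \<omega>)\<^sup>2))"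
proof -
  have rv: "Z i \<in> borel_measurable M" if "i \<in> I" for i
    using indep that by (auto simp: indep_vars_def)
  have int: "integrable M (Z i)" if "i \<in> I" for i
    using square_integrable_imp_integrable[OF rv[OF that] sq[OF that]] .
  have cross: "integrable M (\<lambda>\<omega>. Z i \<omega> * Z j \<omega>) \<and>
      expectation (\<lambda>\<omega>. Z i \<omega> * Z j \<omega>) = (if i = j then expectation (\<lambda>\<omega>. (Z i \<omega>)\<^sup>2) else 0)"
    if "i \<in> I" "j \<in> I" for i j
  proof (cases "i = j")
    case True
    then show ?thesis using sq that by (simp add: power2_eq_square)
  next
    case False
    have *: "indep_vars (\<lambda>_. borel) Z {i, j}"
      by (rule indep_vars_subset[OF indep]) (use that in auto)
    have "integrable M (\<lambda>\<omega>. \<Prod>k\<in>{i, j}. Z k \<omega>)"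
      by (rule indep_vars_integrable[OF _ *]) (use that int in auto)
    moreover have "expectation (\<lambda>\<omega>. \<Prod>k\<in>{i, j}. Z k \<omega>) = (\<Prod>k\<in>{i, j}. expectation (Z k))"
      by (rule indep_vars_lebesgue_integral[OF _ *]) (use that int in auto)
    ultimately show ?thesis using False mean that by simp
  qed
  have expand: "(\<Sum>i\<in>I. Z i \<omega>)\<^sup>2 = (\<Sum>i\<in>I. \<Sum>j\<in>I. Z i \<omega> * Z j \<omega>)" for \<omega>
    by (simp add: power2_eq_square sum_product)
  show "integrable M (\<lambda>\<omega>. (\<Sum>i\<in>I. Z i \<omega>)\<^sup>2)"
    unfolding expand using cross by (intro Bochner_Integration.integrable_sum) auto
  have "expectation (\<lambda>\<omega>. (\<Sum>i\<in>I. Z i \<omega>)\<^sup>2) = (\<Sum>i\<in>I. \<Sum>j\<in>I. expectation (\<lambda>\<omega>. Z i \<omega> * Z j \<omega>))"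
    unfolding expand using cross
    by (subst Bochner_Integration.integral_sum, fastforce, intro sum.cong refl Bochner_Integration.integral_sum) auto
  also have "\<dots> = (\<Sum>i\<in>I. \<Sum>j\<in>I. if i = j then expectation (\<lambda>\<omega>. (Z i \<omega>)\<^sup>2) else 0)"
    using cross by (intro sum.cong refl) auto
  also have "\<dots> = (\<Sum>i\<in>I. expectation (\<lambda>\<omega>. (Z i \<omega>)\<^sup>2))"
    using assms(1) by (simp add: sum.delta)
  finally show "expectation (\<lambda>\<omega>. (\<Sum>i\<in>I. Z i \<omega>)\<^sup>2) = (\<Sum>i\<in>I. expectation (\<lambda>\<omega>. (Z i \<omega>)\<^sup>2))" .
qed

end

lemma nn_integral_suminf_le:
  fixes f :: "nat \<Rightarrow> 'a \<Rightarrow> real"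
  assumes [measurable]: "\<And>n. f n \<in> borel_measurable M" and nonneg: "\<And>n x. f n x \<ge> 0"
    and le: "\<And>n. (\<integral>\<^sup>+x. ennreal (f n x) \<partial>M) \<le> ennreal (c n)" and c: "\<And>n. c n \<ge> 0" "summable c"
  shows "AE x in M. summable (\<lambda>n. f n x)"
    and "(\<integral>\<^sup>+x. ennreal (\<Sum>n. f n x) \<partial>M) \<le> ennreal (\<Sum>n. c n)"
proof -
  have "(\<integral>\<^sup>+x. (\<Sum>n. ennreal (f n x)) \<partial>M) = (\<Sum>n. \<integral>\<^sup>+x. ennreal (f n x) \<partial>M)"
    by (rule nn_integral_suminf) measurable
  also have "\<dots> \<le> (\<Sum>n. ennreal (c n))"
    by (intro suminf_le le) auto
  also have "\<dots> = ennreal (\<Sum>n. c n)" by (rule suminf_ennreal2[OF c])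
  finally have total: "(\<integral>\<^sup>+x. (\<Sum>n. ennreal (f n x)) \<partial>M) \<le> ennreal (\<Sum>n. c n)" .
  then have "(\<integral>\<^sup>+x. (\<Sum>n. ennreal (f n x)) \<partial>M) \<noteq> \<infinity>" by (auto simp: top_unique)
  then have "AE x in M. (\<Sum>n. ennreal (f n x)) \<noteq> \<infinity>"
    by (intro nn_integral_noteq_infinite) auto
  then show AE: "AE x in M. summable (\<lambda>n. f n x)"
    by eventually_elim (auto intro!: summable_suminf_not_top nonneg)
  have "(\<integral>\<^sup>+x. ennreal (\<Sum>n. f n x) \<partial>M) = (\<integral>\<^sup>+x. (\<Sum>n. ennreal (f n x)) \<partial>M)"
    using AE by (intro nn_integral_cong_AE, eventually_elim) (simp add: suminf_ennreal2 nonneg)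
  with total show "(\<integral>\<^sup>+x. ennreal (\<Sum>n. f n x) \<partial>M) \<le> ennreal (\<Sum>n. c n)" by simp
qed

text \<open>
  Fatou's lemma; it transfers moment bounds from partial sums to the series.
\<close>

lemma nn_integral_limit_le:
  fixes f :: "nat \<Rightarrow> 'a \<Rightarrow> real"
  assumes [measurable]: "\<And>n. f n \<in> borel_measurable M"
    and lim: "AE x in M. (\<lambda>n. f n x) \<longlonglongrightarrow> g x"
    and le: "\<And>n. (\<integral>\<^sup>+x. ennreal (f n x) \<partial>M) \<le> C"
  shows "(\<integral>\<^sup>+x. ennreal (g x) \<partial>M) \<le> C"
proof -
  have "(\<integral>\<^sup>+x. ennreal (g x) \<partial>M) = (\<integral>\<^sup>+x. liminf (\<lambda>n. ennreal (f n x)) \<partial>M)"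
    using lim by (intro nn_integral_cong_AE, eventually_elim)
      (rule lim_imp_Liminf[symmetric], auto intro: tendsto_ennrealI)
  also have "\<dots> \<le> liminf (\<lambda>n. \<integral>\<^sup>+x. ennreal (f n x) \<partial>M)"
    by (rule nn_integral_liminf) measurable
  also have "\<dots> \<le> C"
    using le by (intro Liminf_le) auto
  finally show ?thesis .
qed

section \<open>The random series: truncation, regularity, moments\<close>

definition cutoff :: "nat \<Rightarrow> real \<Rightarrow> real" where
  "cutoff n x = (if \<bar>x\<bar> \<le> sqrt (real n) then x else 0)"

lemma cutoff_measurable [measurable]: "cutoff n \<in> borel_measurable borel"
  unfolding cutoff_def[abs_def] by measurable

lemma abs_cutoff_le: "\<bar>cutoff n x\<bar> \<le> sqrt (real n)" "\<bar>cutoff n x\<bar> \<le> \<bar>x\<bar>" "\<bar>x - cutoff n x\<bar> \<le> \<bar>x\<bar>"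
  "(cutoff n x)\<^sup>2 \<le> x\<^sup>2"
  by (auto simp: cutoff_def)

lemma powr_minus_half: "real n powr -(1/2) = 1 / sqrt (real n)"
  by (simp only: powr_minus powr_half_sqrt of_nat_0_le_iff inverse_eq_divide)

lemma sum_inverse_sqrt_le: "(\<Sum>n\<in>{1..k}. 1 / sqrt (real n)) \<le> 2 * sqrt (real k)"
proof (induction k)
  case (Suc k)
  define a b where "a = sqrt (real k)" and "b = sqrt (real (Suc k))"
  have ab: "a \<ge> 0" "b > 0" "b * b = a * a + 1" by (simp_all add: a_def b_def)
  have "2 * (a * b) \<le> a * a + b * b"
    using zero_le_square[of "a - b"] by (simp add: algebra_simps)
  then have "1 \<le> (2 * b - 2 * a) * b" using ab by (simp add: algebra_simps)
  then have "1 / b \<le> 2 * b - 2 * a" using ab by (subst pos_divide_le_eq)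
  moreover have "{1..Suc k} = insert (Suc k) {1..k}" by auto
  ultimately show ?case using Suc by (simp add: a_def b_def)
qed simp

text \<open>
  Only the indices \<open>n < x\<^sup>2\<close> contribute: the truncation level \<open>sqrt n\<close> matches a finite second
  moment.
\<close>

lemma cutoff_tail_sum_le:
  "(\<Sum>n\<in>{1..N}. real n powr -(1/2) * \<bar>x - cutoff n x\<bar>) \<le> 2 * x\<^sup>2"
proof -
  define k where "k = nat \<lfloor>x\<^sup>2\<rfloor>"
  have k: "real k \<le> x\<^sup>2" unfolding k_def by simp
  have "(\<Sum>n\<in>{1..N}. real n powr -(1/2) * \<bar>x - cutoff n x\<bar>)
      = (\<Sum>n\<in>{n\<in>{1..N}. sqrt (real n) < \<bar>x\<bar>}. \<bar>x\<bar> * (1 / sqrt (real n)))"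
    unfolding powr_minus_half by (subst sum.inter_filter) (auto simp: cutoff_def intro!: sum.cong)
  also have "\<dots> \<le> (\<Sum>n\<in>{1..k}. \<bar>x\<bar> * (1 / sqrt (real n)))"
  proof (rule sum_mono2)
    show "{n\<in>{1..N}. sqrt (real n) < \<bar>x\<bar>} \<subseteq> {1..k}"
    proof safe
      fix n assume "n \<in> {1..N}" "sqrt (real n) < \<bar>x\<bar>"
      then have "real n \<le> x\<^sup>2"
        by (metis less_imp_le of_nat_0_le_iff power2_abs real_sqrt_ge_0_iff real_sqrt_pow2 power_mono)
      then show "n \<in> {1..k}" using \<open>n \<in> {1..N}\<close> unfolding k_def by (simp add: le_nat_floor)
    qed
  qed auto
  also have "\<dots> \<le> \<bar>x\<bar> * (2 * sqrt (real k))"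
    unfolding sum_distrib_left[symmetric] by (intro mult_left_mono sum_inverse_sqrt_le) auto
  also have "\<dots> \<le> \<bar>x\<bar> * (2 * \<bar>x\<bar>)"
    using real_sqrt_le_mono[OF k] by (intro mult_left_mono) auto
  finally show ?thesis by (simp add: power2_eq_square)
qed

text \<open>
  The function \<open>w \<mapsto> x powr -w + ln w\<close> is nondecreasing because \<open>w ln x \<le> x powr w\<close>.
\<close>

lemma powr_difference_le_ln:
  fixes x u v :: real
  assumes "x \<ge> 1" "0 < u" "u \<le> v"
  shows "x powr -u - x powr -v \<le> ln (v / u)"
proof -
  define f where "f w = x powr -w + ln w" for w :: real
  have "f u \<le> f v"
  proof (rule DERIV_nonneg_imp_nondecreasing[of u v f, OF \<open>u \<le> v\<close>])
    fix w assume w: "u \<le> w" "w \<le> v"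
    have "(f has_real_derivative - (ln x * x powr -w) + 1 / w) (at w)"
      unfolding f_def using w assms by (auto intro!: derivative_eq_intros)
    moreover have "w * ln x \<le> x powr w"
      using assms order_trans[OF _ exp_ge_add_one_self[of "w * ln x"], of "w * ln x"] by (simp add: powr_def)
    then have "ln x * x powr -w \<le> 1 / w"
      using w assms by (simp add: powr_minus field_simps)
    ultimately show "\<exists>y. (f has_real_derivative y) (at w) \<and> 0 \<le> y"
      by (intro exI[of _ "- (ln x * x powr -w) + 1 / w"]) auto
  qed
  then show ?thesis using assms by (simp add: f_def ln_div)
qed

locale iid_coefficients = prob_space M
  for M :: "'a measure" and \<eta> :: "nat \<Rightarrow> 'a \<Rightarrow> real" and D :: "real measure" and \<sigma> :: real +
  assumes indep: "indep_vars (\<lambda>_. borel) \<eta> {1..}"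
    and law: "n \<ge> 1 \<Longrightarrow> distr M borel (\<eta> n) = D"
    and square_integrable: "integrable D (\<lambda>x. x\<^sup>2)"
    and mean_zero: "(\<integral>x. x \<partial>D) = 0"
    and variance: "(\<integral>x. x\<^sup>2 \<partial>D) = \<sigma>\<^sup>2"
begin

lemma coeff_measurable [measurable]: "n \<ge> 1 \<Longrightarrow> \<eta> n \<in> borel_measurable M"
  using indep by (auto simp: indep_vars_def)

lemma D_distribution: "real_distribution D"
proof -
  have "distr M borel (\<eta> 1) = D" by (rule law) simp
  moreover have "real_distribution (distr M borel (\<eta> 1))" by (rule real_distribution_distr) simp
  ultimately show ?thesis by simp
qed

sublocale D: real_distribution D by (rule D_distribution)

lemma integrable_D [simp]: "integrable D (\<lambda>x. x)"
  using D.square_integrable_imp_integrable[of "\<lambda>x. x"] square_integrable by simp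

lemma coeff_transfer:
  fixes g :: "real \<Rightarrow> real"
  assumes "n \<ge> 1" "g \<in> borel_measurable borel"
  shows "integrable M (\<lambda>\<omega>. g (\<eta> n \<omega>)) \<longleftrightarrow> integrable D g"
    and "expectation (\<lambda>\<omega>. g (\<eta> n \<omega>)) = (\<integral>x. g x \<partial>D)"
    and "(\<integral>\<^sup>+\<omega>. ennreal (g (\<eta> n \<omega>)) \<partial>M) = (\<integral>\<^sup>+x. ennreal (g x) \<partial>D)"
  using assms integrable_distr_eq[of "\<eta> n" M borel g] integral_distr[of "\<eta> n" M borel g]
    nn_integral_distr[of "\<eta> n" M borel "\<lambda>x. ennreal (g x)"] law[of n] by auto

definition cutoff_mean :: "nat \<Rightarrow> real" where
  "cutoff_mean n = (\<integral>x. cutoff n x \<partial>D)"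

text \<open>
  Subtracting the mean keeps the truncated coefficients centred.
\<close>

definition bounded_part :: "nat \<Rightarrow> 'a \<Rightarrow> real" where
  "bounded_part n \<omega> = cutoff n (\<eta> n \<omega>) - cutoff_mean n"

definition remainder :: "nat \<Rightarrow> 'a \<Rightarrow> real" where
  "remainder n \<omega> = \<eta> n \<omega> - bounded_part n \<omega>"

definition tail_mean :: "nat \<Rightarrow> real" where
  "tail_mean n = (\<integral>x. \<bar>x - cutoff n x\<bar> \<partial>D)"

lemma cutoff_integrable:
  "integrable D (cutoff n)" "integrable D (\<lambda>x. (cutoff n x)\<^sup>2)" "integrable D (\<lambda>x. \<bar>x - cutoff n x\<bar>)"
proof -
  show *: "integrable D (cutoff n)"
    by (rule Bochner_Integration.integrable_bound[OF integrable_D]) (auto simp: abs_cutoff_le)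
  show "integrable D (\<lambda>x. (cutoff n x)\<^sup>2)"
    by (rule Bochner_Integration.integrable_bound[OF square_integrable])
      (auto simp: abs_cutoff_le)
  show "integrable D (\<lambda>x. \<bar>x - cutoff n x\<bar>)"
    using * by (intro integrable_abs Bochner_Integration.integrable_diff) auto
qed

lemma bounded_part_measurable [measurable]: "n \<ge> 1 \<Longrightarrow> bounded_part n \<in> borel_measurable M"
  unfolding bounded_part_def[abs_def] by measurable

lemma remainder_measurable [measurable]: "n \<ge> 1 \<Longrightarrow> remainder n \<in> borel_measurable M"
  unfolding remainder_def[abs_def] by measurable

text \<open>
  Since \<open>D\<close> has mean 0, the mean of the truncation is minus the mean of what is cut off.
\<close>

lemma abs_cutoff_mean_le: "\<bar>cutoff_mean n\<bar> \<le> sqrt (real n)" "\<bar>cutoff_mean n\<bar> \<le> tail_mean n"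
proof -
  have "\<bar>cutoff_mean n\<bar> \<le> (\<integral>x. \<bar>cutoff n x\<bar> \<partial>D)"
    unfolding cutoff_mean_def by (rule integral_abs_bound)
  also have "\<dots> \<le> (\<integral>x. sqrt (real n) \<partial>D)"
    using cutoff_integrable abs_cutoff_le by (intro integral_mono) auto
  finally show "\<bar>cutoff_mean n\<bar> \<le> sqrt (real n)" using D.prob_space by simp
  have "cutoff_mean n = - (\<integral>x. x - cutoff n x \<partial>D)"
    unfolding cutoff_mean_def using cutoff_integrable by (simp add: mean_zero)
  then show "\<bar>cutoff_mean n\<bar> \<le> tail_mean n"
    unfolding tail_mean_def using integral_abs_bound[of D "\<lambda>x. x - cutoff n x"] by simp
qed

lemma abs_bounded_part_le: "\<bar>bounded_part n \<omega>\<bar> \<le> 2 * sqrt (real n)"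
  unfolding bounded_part_def
  using abs_cutoff_le(1)[of n "\<eta> n \<omega>"] abs_cutoff_mean_le(1)[of n] by linarith

lemma bounded_part_moments:
  assumes "n \<ge> 1"
  shows "expectation (bounded_part n) = 0"
    and "expectation (\<lambda>\<omega>. (bounded_part n \<omega>)\<^sup>2) \<le> \<sigma>\<^sup>2"
proof -
  have int: "integrable M (\<lambda>\<omega>. cutoff n (\<eta> n \<omega>))" "integrable M (\<lambda>\<omega>. (cutoff n (\<eta> n \<omega>))\<^sup>2)"
    using assms cutoff_integrable[of n] coeff_transfer(1)[of n "cutoff n"]
      coeff_transfer(1)[of n "\<lambda>x. (cutoff n x)\<^sup>2"] by auto
  have mean: "expectation (\<lambda>\<omega>. cutoff n (\<eta> n \<omega>)) = cutoff_mean n"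
    unfolding cutoff_mean_def using assms by (intro coeff_transfer) auto
  show "expectation (bounded_part n) = 0"
    unfolding bounded_part_def[abs_def] using int mean by (simp add: prob_space)
  have "expectation (\<lambda>\<omega>. (bounded_part n \<omega>)\<^sup>2) =
      expectation (\<lambda>\<omega>. (cutoff n (\<eta> n \<omega>))\<^sup>2) - (cutoff_mean n)\<^sup>2"
    unfolding bounded_part_def mean[symmetric] using int by (rule variance_eq)
  also have "\<dots> \<le> (\<integral>x. (cutoff n x)\<^sup>2 \<partial>D)"
    using assms coeff_transfer(2)[of n "\<lambda>x. (cutoff n x)\<^sup>2"] by simp
  also have "\<dots> \<le> (\<integral>x. x\<^sup>2 \<partial>D)"
    using cutoff_integrable square_integrable
    by (intro integral_mono) (auto simp: abs_cutoff_le)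
  finally show "expectation (\<lambda>\<omega>. (bounded_part n \<omega>)\<^sup>2) \<le> \<sigma>\<^sup>2" by (simp add: variance)
qed

lemma bounded_part_indep: "I \<subseteq> {1..} \<Longrightarrow> indep_vars (\<lambda>_. borel) (\<lambda>n \<omega>. c n * bounded_part n \<omega>) I"
  unfolding bounded_part_def
  by (rule indep_vars_compose2[where Y = "\<lambda>n x. c n * (cutoff n x - cutoff_mean n)", OF indep_vars_subset[OF indep]])
    auto

text \<open>
  The truncation level \<open>sqrt n\<close> gives terms of modulus at most \<open>2 sqrt n\<close>, so weights of modulus at
  most \<open>1 / (2 sqrt n)\<close> make the exponential bound applicable.
\<close>

lemma bounded_part_sum_moments:
  assumes "finite I" "I \<subseteq> {1..}" and c: "\<And>n. n \<in> I \<Longrightarrow> \<bar>c n\<bar> * (2 * sqrt (real n)) \<le> 1"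
    and V: "(\<Sum>n\<in>I. (c n)\<^sup>2) * \<sigma>\<^sup>2 \<le> V"
  shows "(\<integral>\<^sup>+\<omega>. ennreal (exp \<bar>\<Sum>n\<in>I. c n * bounded_part n \<omega>\<bar>) \<partial>M) \<le> ennreal (2 * exp V)"
    and "(\<integral>\<^sup>+\<omega>. ennreal ((\<Sum>n\<in>I. c n * bounded_part n \<omega>) ^ 4) \<partial>M) \<le> ennreal (48 * exp V)"
proof -
  have bnd: "\<bar>c n * bounded_part n \<omega>\<bar> \<le> 1" if "n \<in> I" for n \<omega>
  proof -
    have "\<bar>c n * bounded_part n \<omega>\<bar> \<le> \<bar>c n\<bar> * (2 * sqrt (real n))"
      unfolding abs_mult by (intro mult_left_mono abs_bounded_part_le) auto
    with c[OF that] show ?thesis by linarith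
  qed
  have mean: "expectation (\<lambda>\<omega>. c n * bounded_part n \<omega>) = 0" if "n \<in> I" for n
    using bounded_part_moments(1)[of n] that assms(2) by auto
  have "(\<Sum>n\<in>I. expectation (\<lambda>\<omega>. (c n * bounded_part n \<omega>)\<^sup>2)) \<le> (\<Sum>n\<in>I. (c n)\<^sup>2 * \<sigma>\<^sup>2)"
    unfolding power_mult_distrib using bounded_part_moments(2) assms(2)
    by (intro sum_mono) (auto intro!: mult_left_mono)
  also have "\<dots> \<le> V" using V by (simp add: sum_distrib_right)
  finally have var: "(\<Sum>n\<in>I. expectation (\<lambda>\<omega>. (c n * bounded_part n \<omega>)\<^sup>2)) \<le> V" .
  show "(\<integral>\<^sup>+\<omega>. ennreal (exp \<bar>\<Sum>n\<in>I. c n * bounded_part n \<omega>\<bar>) \<partial>M) \<le> ennreal (2 * exp V)"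
    by (rule exp_abs_sum_expectation_le[OF assms(1) bounded_part_indep[OF assms(2)] bnd mean var])
  show "(\<integral>\<^sup>+\<omega>. ennreal ((\<Sum>n\<in>I. c n * bounded_part n \<omega>) ^ 4) \<partial>M) \<le> ennreal (48 * exp V)"
    by (rule fourth_moment_sum_le[OF assms(1) bounded_part_indep[OF assms(2)] bnd mean var])
qed


lemma prime_coeff_measurable [measurable]:
  "(\<lambda>\<omega>. prime_coeff (\<lambda>n. \<eta> n \<omega>) n) \<in> borel_measurable M"
  "(\<lambda>\<omega>. prime_coeff (\<lambda>n. bounded_part n \<omega>) n) \<in> borel_measurable M"
  "(\<lambda>\<omega>. prime_coeff (\<lambda>n. remainder n \<omega>) n) \<in> borel_measurable M"
  unfolding prime_coeff_def using prime_ge_1_nat[of n] by (cases "prime n"; simp)+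

text \<open>
  A majorant of the remainder series that does not depend on \<open>u \<ge> 0\<close>.
\<close>

definition remainder_bound :: "'a \<Rightarrow> real" where
  "remainder_bound \<omega> = (\<Sum>n. \<bar>prime_coeff (\<lambda>n. remainder n \<omega>) n\<bar> * real n powr -(1/2))"

lemma tail_mean_nonneg: "tail_mean n \<ge> 0"
  unfolding tail_mean_def by simp

lemma tail_mean_sum_le: "(\<Sum>n\<in>{1..N}. real n powr -(1/2) * tail_mean n) \<le> 2 * \<sigma>\<^sup>2"
proof -
  have "(\<Sum>n\<in>{1..N}. real n powr -(1/2) * tail_mean n) =
      (\<integral>x. (\<Sum>n\<in>{1..N}. real n powr -(1/2) * \<bar>x - cutoff n x\<bar>) \<partial>D)"
    unfolding tail_mean_def using cutoff_integrable by (subst Bochner_Integration.integral_sum) auto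
  also have "\<dots> \<le> (\<integral>x. 2 * x\<^sup>2 \<partial>D)"
    using cutoff_integrable square_integrable
    by (intro integral_mono cutoff_tail_sum_le Bochner_Integration.integrable_sum integrable_mult_right) auto
  finally show ?thesis by (simp add: variance)
qed

lemma remainder_summable:
  shows "AE \<omega> in M. summable (\<lambda>n. \<bar>prime_coeff (\<lambda>n. remainder n \<omega>) n\<bar> * real n powr -(1/2))"
    and "(\<integral>\<^sup>+\<omega>. ennreal (remainder_bound \<omega>) \<partial>M) \<le> ennreal (4 * \<sigma>\<^sup>2)"
proof -
  define f where "f n \<omega> = \<bar>prime_coeff (\<lambda>n. remainder n \<omega>) n\<bar> * real n powr -(1/2)" for n \<omega>
  define c where "c n = (if n = 0 then 0 else 2 * (real n powr -(1/2) * tail_mean n))" for n :: nat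
  have c_nonneg: "c n \<ge> 0" for n by (simp add: c_def tail_mean_nonneg)
  have partial: "(\<Sum>n<N. c n) \<le> 4 * \<sigma>\<^sup>2" for N
  proof -
    have "(\<Sum>n<N. c n) \<le> (\<Sum>n\<in>{0..N}. c n)" by (intro sum_mono2) (auto simp: c_nonneg)
    also have "{0..N} = insert 0 {1..N}" by auto
    also have "(\<Sum>n\<in>insert 0 {1..N}. c n) = 2 * (\<Sum>n\<in>{1..N}. real n powr -(1/2) * tail_mean n)"
      by (simp add: c_def sum_distrib_left)
    finally show ?thesis using tail_mean_sum_le[of N] by simp
  qed
  have c_summable: "summable c"
    by (rule summableI_nonneg_bounded[OF c_nonneg partial])
  have c_suminf: "(\<Sum>n. c n) \<le> 4 * \<sigma>\<^sup>2"
    by (rule suminf_le_const[OF c_summable partial])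
  have f_meas: "f n \<in> borel_measurable M" for n unfolding f_def[abs_def] by measurable
  have f_nonneg: "f n \<omega> \<ge> 0" for n \<omega> by (simp add: f_def)
  have f_le: "(\<integral>\<^sup>+\<omega>. ennreal (f n \<omega>) \<partial>M) \<le> ennreal (c n)" for n
  proof (cases "prime n")
    case True
    then have n: "n \<ge> 1" by (rule prime_ge_1_nat)
    define g where "g x = real n powr -(1/2) * (\<bar>x - cutoff n x\<bar> + tail_mean n)" for x
    have [measurable]: "g \<in> borel_measurable borel" unfolding g_def[abs_def] by measurable
    have "f n \<omega> \<le> g (\<eta> n \<omega>)" for \<omega>
    proof -
      have "\<bar>remainder n \<omega>\<bar> \<le> \<bar>\<eta> n \<omega> - cutoff n (\<eta> n \<omega>)\<bar> + tail_mean n"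
        unfolding remainder_def bounded_part_def using abs_cutoff_mean_le(2)[of n] by linarith
      then show ?thesis
        unfolding f_def g_def prime_coeff_def using True by (subst mult.commute) (auto intro!: mult_left_mono)
    qed
    then have "(\<integral>\<^sup>+\<omega>. ennreal (f n \<omega>) \<partial>M) \<le> (\<integral>\<^sup>+\<omega>. ennreal (g (\<eta> n \<omega>)) \<partial>M)"
      by (intro nn_integral_mono ennreal_leI)
    also have "\<dots> = (\<integral>\<^sup>+x. ennreal (g x) \<partial>D)" by (rule coeff_transfer(3)[OF n]) measurable
    also have "\<dots> = ennreal (\<integral>x. g x \<partial>D)"
      unfolding g_def using cutoff_integrable[of n] tail_mean_nonneg[of n]
      by (intro nn_integral_eq_integral) auto
    also have "(\<integral>x. g x \<partial>D) = c n"
      unfolding g_def c_def using cutoff_integrable[of n] n D.prob_space by (simp add: tail_mean_def)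
    finally show ?thesis .
  qed (simp add: f_def prime_coeff_def)
  show "AE \<omega> in M. summable (\<lambda>n. \<bar>prime_coeff (\<lambda>n. remainder n \<omega>) n\<bar> * real n powr -(1/2))"
    using nn_integral_suminf_le(1)[OF f_meas f_nonneg f_le c_nonneg c_summable] unfolding f_def .
  have "(\<integral>\<^sup>+\<omega>. ennreal (remainder_bound \<omega>) \<partial>M) \<le> ennreal (\<Sum>n. c n)"
    using nn_integral_suminf_le(2)[OF f_meas f_nonneg f_le c_nonneg c_summable]
    unfolding f_def remainder_bound_def .
  also have "\<dots> \<le> ennreal (4 * \<sigma>\<^sup>2)" by (intro ennreal_leI c_suminf)
  finally show "(\<integral>\<^sup>+\<omega>. ennreal (remainder_bound \<omega>) \<partial>M) \<le> ennreal (4 * \<sigma>\<^sup>2)" .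
qed

text \<open>
  The partial sum of length \<open>n\<close>, divided by \<open>2 sqrt n\<close>, has a bounded exponential moment. Hence the
  exponentials divided by \<open>n\<^sup>2\<close> are almost surely summable, in particular bounded, and the partial sums
  are \<open>O(sqrt n * ln n)\<close>.
\<close>

lemma bounded_part_regular: "AE \<omega> in M. regular_coeffs (\<lambda>n. bounded_part n \<omega>)"
proof -
  define T where "T n \<omega> = (\<Sum>k<n. prime_coeff (\<lambda>n. bounded_part n \<omega>) (Suc k))" for n \<omega>
  \<comment> \<open>The factor of order 1 / n^2 makes the expectations summable.\<close>
  define f where "f n \<omega> = exp (\<bar>T (Suc n) \<omega>\<bar> / (2 * sqrt (real (Suc n)))) * real (Suc n) powr -2" for n \<omega>
  define c where "c n = 2 * exp (\<sigma>\<^sup>2) * real (Suc n) powr -2" for n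
  have f_meas: "f n \<in> borel_measurable M" for n unfolding f_def[abs_def] T_def by measurable
  have f_nonneg: "f n \<omega> \<ge> 0" for n \<omega> by (simp add: f_def)
  have c_nonneg: "c n \<ge> 0" for n by (simp add: c_def)
  have "summable (\<lambda>n. real n powr -2)" by (subst summable_real_powr_iff) simp
  then have c_summable: "summable c"
    unfolding c_def by (intro summable_mult) (subst summable_Suc_iff)
  have f_le: "(\<integral>\<^sup>+\<omega>. ennreal (f n \<omega>) \<partial>M) \<le> ennreal (c n)" for n
  proof -
    define I where "I = {k\<in>{1..Suc n}. prime k}"
    define a where "a = 1 / (2 * sqrt (real (Suc n)))"
    have I: "finite I" "I \<subseteq> {1..}" "card I \<le> Suc n"
    proof -
      have "I \<subseteq> {1..Suc n}" by (auto simp: I_def)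
      then show "finite I" "I \<subseteq> {1..}" "card I \<le> Suc n"
        using card_mono[of "{1..Suc n}" I] by (auto intro: finite_subset)
    qed
    have T: "T (Suc n) \<omega> = (\<Sum>k\<in>I. bounded_part k \<omega>)" for \<omega>
      unfolding T_def I_def prime_coeff_def
      by (subst sum.inter_filter, simp, rule sum.reindex_bij_witness[of _ "\<lambda>k. k - 1" Suc]) auto
    have "(\<integral>\<^sup>+\<omega>. ennreal (exp \<bar>\<Sum>k\<in>I. a * bounded_part k \<omega>\<bar>) \<partial>M) \<le> ennreal (2 * exp (\<sigma>\<^sup>2))"
    proof (rule bounded_part_sum_moments(1)[OF I(1,2), of "\<lambda>_. a"])
      fix k assume "k \<in> I"
      then have "sqrt (real k) \<le> sqrt (real (Suc n))" by (auto simp: I_def)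
      then show "\<bar>a\<bar> * (2 * sqrt (real k)) \<le> 1" unfolding a_def by (simp add: pos_divide_le_eq)
    next
      have "(\<Sum>k\<in>I. a\<^sup>2) * \<sigma>\<^sup>2 = real (card I) / (4 * real (Suc n)) * \<sigma>\<^sup>2"
        by (simp add: a_def power_divide power_mult_distrib)
      also have "\<dots> \<le> 1 * \<sigma>\<^sup>2"
        using I(3) by (intro mult_right_mono) (auto simp: pos_divide_le_eq)
      finally show "(\<Sum>k\<in>I. a\<^sup>2) * \<sigma>\<^sup>2 \<le> \<sigma>\<^sup>2" by simp
    qed
    also have "(\<lambda>\<omega>. \<bar>\<Sum>k\<in>I. a * bounded_part k \<omega>\<bar>) = (\<lambda>\<omega>. \<bar>T (Suc n) \<omega>\<bar> / (2 * sqrt (real (Suc n))))"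
      unfolding T sum_distrib_left[symmetric] by (simp add: a_def abs_mult)
    finally have *: "(\<integral>\<^sup>+\<omega>. ennreal (exp (\<bar>T (Suc n) \<omega>\<bar> / (2 * sqrt (real (Suc n))))) \<partial>M) \<le> ennreal (2 * exp (\<sigma>\<^sup>2))"
      by (simp add: fun_eq_iff)
    have "(\<integral>\<^sup>+\<omega>. ennreal (f n \<omega>) \<partial>M) =
        (\<integral>\<^sup>+\<omega>. ennreal (exp (\<bar>T (Suc n) \<omega>\<bar> / (2 * sqrt (real (Suc n))))) \<partial>M) * ennreal (real (Suc n) powr -2)"
      unfolding f_def T_def by (subst nn_integral_multc[symmetric]) (auto simp: ennreal_mult')
    also have "\<dots> \<le> ennreal (2 * exp (\<sigma>\<^sup>2)) * ennreal (real (Suc n) powr -2)"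
      by (intro mult_right_mono *) auto
    also have "\<dots> = ennreal (c n)" unfolding c_def by (subst ennreal_mult'[symmetric]) auto
    finally show ?thesis .
  qed
  have "AE \<omega> in M. summable (\<lambda>n. f n \<omega>)"
    by (rule nn_integral_suminf_le(1)[OF f_meas f_nonneg f_le c_nonneg c_summable])
  then show ?thesis
  proof eventually_elim
    case (elim \<omega>)
    define K where "K = max 1 (\<Sum>n. f n \<omega>)"
    have K: "f n \<omega> \<le> K" "K \<ge> 1" for n
      using sum_le_suminf[OF elim, of "{n}"] f_nonneg by (auto simp: K_def)
    have T_le: "\<bar>T (Suc n) \<omega>\<bar> \<le> 2 * sqrt (real (Suc n)) * (ln K + 2 * ln (real (Suc n)))" for n
    proof -
      have "exp (\<bar>T (Suc n) \<omega>\<bar> / (2 * sqrt (real (Suc n)))) \<le> K * real (Suc n) powr 2"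
        using K(1)[of n] unfolding f_def by (simp add: powr_minus field_simps)
      then have "\<bar>T (Suc n) \<omega>\<bar> / (2 * sqrt (real (Suc n))) \<le> ln (K * real (Suc n) powr 2)"
        using K by (subst ln_ge_iff) auto
      also have "\<dots> = ln K + 2 * ln (real (Suc n))" using K by (simp add: ln_mult ln_realpow)
      finally show ?thesis by (simp add: pos_divide_le_eq mult.commute)
    qed
    show ?case
    proof (rule regular_coeffs_of_growth)
      fix \<delta> :: real assume \<delta>: "\<delta> > 0"
      define C where "C = 2 * (ln K + 2 / \<delta>)"
      have C: "C \<ge> 0" using K(2) \<delta> by (simp add: C_def)
      have "\<bar>T n \<omega>\<bar> \<le> C * real (Suc n) powr (1/2 + \<delta>)" for n
      proof (cases n)
        case 0
        then show ?thesis using C by (simp add: T_def)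
      next
        case (Suc m)
        define x where "x = real (Suc m)"
        have x: "x \<ge> 1" by (simp add: x_def)
        have one: "1 \<le> x powr \<delta>" using x \<delta> by (simp add: ge_one_powr_ge_zero)
        have "ln K + 2 * ln x \<le> ln K * x powr \<delta> + 2 * (x powr \<delta> / \<delta>)"
          using ln_powr_bound[OF x \<delta>] K(2) one mult_left_mono[OF one, of "ln K"] by simp
        also have "\<dots> = (ln K + 2 / \<delta>) * x powr \<delta>" by (simp add: algebra_simps)
        finally have "2 * sqrt x * (ln K + 2 * ln x) \<le> 2 * sqrt x * ((ln K + 2 / \<delta>) * x powr \<delta>)"
          using x by (intro mult_left_mono) auto
        also have "\<dots> = C * x powr (1/2 + \<delta>)"
          using x by (simp add: C_def powr_add powr_half_sqrt)
        also have "\<dots> \<le> C * real (Suc n) powr (1/2 + \<delta>)"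
          using C \<delta> Suc by (intro mult_left_mono powr_mono2) (auto simp: x_def)
        finally show ?thesis using T_le[of m] unfolding x_def Suc by linarith
      qed
      then show "\<exists>C. \<forall>n. \<bar>\<Sum>k<n. prime_coeff (\<lambda>n. bounded_part n \<omega>) (Suc k)\<bar> \<le> C * real (Suc n) powr (1/2 + \<delta>)"
        unfolding T_def by blast
    qed
  qed
qed

lemma AE_good_event:
  "AE \<omega> in M. regular_coeffs (\<lambda>n. \<eta> n \<omega>) \<and> regular_coeffs (\<lambda>n. bounded_part n \<omega>) \<and>
    (\<forall>u>0. \<bar>prime_process \<eta> u \<omega> - prime_series (\<lambda>n. bounded_part n \<omega>) u\<bar> \<le> remainder_bound \<omega>)"
  using bounded_part_regular remainder_summable(1)
proof eventually_elim
  case (elim \<omega>)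
  have eq: "(\<lambda>n. \<eta> n \<omega>) = (\<lambda>n. bounded_part n \<omega> + remainder n \<omega>)"
    by (simp add: remainder_def)
  note R = prime_series_abs_summable[OF elim(2)]
  have "regular_coeffs (\<lambda>n. \<eta> n \<omega>)"
    unfolding eq by (rule prime_series_add(1)[OF elim(1) R(1)])
  moreover have "\<bar>prime_process \<eta> u \<omega> - prime_series (\<lambda>n. bounded_part n \<omega>) u\<bar> \<le> remainder_bound \<omega>"
    if "u > 0" for u
  proof -
    have "prime_process \<eta> u \<omega> = prime_series (\<lambda>n. bounded_part n \<omega>) u + prime_series (\<lambda>n. remainder n \<omega>) u"
      using calculation prime_series_add(2)[OF elim(1) R(1) that]
      unfolding prime_process_def eq by simp
    then show ?thesis using R(2)[of u] that unfolding remainder_bound_def by simp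
  qed
  ultimately show ?case using elim(1) by blast
qed

lemma regular_coeffs_measurable [measurable]: "{\<omega> \<in> space M. regular_coeffs (\<lambda>n. \<eta> n \<omega>)} \<in> sets M"
proof -
  have "{\<omega> \<in> space M. regular_coeffs (\<lambda>n. \<eta> n \<omega>)} = {\<omega> \<in> space M. \<forall>m.
      Cauchy (\<lambda>N. \<Sum>n<N. prime_coeff (\<lambda>n. \<eta> n \<omega>) n * real n powr -(1/2 + 1 / real (Suc m)))}"
    unfolding regular_coeffs_iff summable_prime_series_iff
    unfolding summable_iff_convergent Cauchy_convergent_iff ..
  also have "\<dots> \<in> sets M"
    by (intro sets.sets_Collect_countable_All sets_Collect_Cauchy borel_measurable_sum
        borel_measurable_times borel_measurable_const prime_coeff_measurable)
  finally show ?thesis .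
qed

lemma prime_process_measurable [measurable]: "prime_process \<eta> u \<in> borel_measurable M"
  unfolding prime_process_def[abs_def] prime_series_eq by measurable

lemma prime_process_continuous: "continuous_on {0<..} (\<lambda>u. prime_process \<eta> u \<omega>)"
proof (cases "regular_coeffs (\<lambda>n. \<eta> n \<omega>)")
  case True
  then show ?thesis unfolding prime_process_def by (simp add: regular_coeffs_def)
qed (simp add: prime_process_def)

text \<open>
  With \<open>x = ln (v/u)\<close>, divide the increment by \<open>2 sqrt x\<close>. The differences \<open>p powr -u - p powr -v\<close>
  lie below both 1 and \<open>x\<close>, hence below \<open>sqrt x\<close>, which bounds the terms by 1; the variance is bounded by
  the estimate for squared increments over the primes.
\<close>

lemma fourth_moment_increment_le:
  assumes "0 < u" "u \<le> v"
  shows "(\<integral>\<^sup>+\<omega>. ennreal ((prime_series (\<lambda>n. bounded_part n \<omega>) u - prime_series (\<lambda>n. bounded_part n \<omega>) v) ^ 4) \<partial>M)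
    \<le> ennreal (768 * exp (\<sigma>\<^sup>2) * (ln (v / u))\<^sup>2)"
proof (cases "u = v")
  case False
  define x where "x = ln (v / u)"
  have x: "x > 0" using assms False by (simp add: x_def)
  define b where "b n = real n powr -(1/2 + u) - real n powr -(1/2 + v)" for n
  define f where "f N \<omega> = (\<Sum>n<N. prime_coeff (\<lambda>n. bounded_part n \<omega>) n * b n) ^ 4" for N \<omega>
  show ?thesis
    unfolding x_def[symmetric]
  proof (rule nn_integral_limit_le[of f])
    show "f N \<in> borel_measurable M" for N unfolding f_def[abs_def] by measurable
    show "AE \<omega> in M. (\<lambda>N. f N \<omega>) \<longlonglongrightarrow>
        (prime_series (\<lambda>n. bounded_part n \<omega>) u - prime_series (\<lambda>n. bounded_part n \<omega>) v) ^ 4"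
      using bounded_part_regular
    proof eventually_elim
      case (elim \<omega>)
      have "(\<lambda>n. prime_coeff (\<lambda>n. bounded_part n \<omega>) n * real n powr -(1/2 + w)) sums
          prime_series (\<lambda>n. bounded_part n \<omega>) w" if "w > 0" for w
        using elim that unfolding prime_series_sums_iff[symmetric] prime_series_def regular_coeffs_def
        by (intro summable_sums) auto
      from sums_diff[OF this[of u] this[of v]] assms
      have "(\<lambda>n. prime_coeff (\<lambda>n. bounded_part n \<omega>) n * b n) sums
          (prime_series (\<lambda>n. bounded_part n \<omega>) u - prime_series (\<lambda>n. bounded_part n \<omega>) v)"
        by (simp add: b_def right_diff_distrib)
      then show ?case unfolding f_def sums_def by (intro tendsto_power)
    qed
    fix N :: nat
    define I where "I = {p. prime p \<and> p \<le> N} \<inter> {..<N}"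
    \<comment> \<open>The factor 2 compensates the bound 2 sqrt n of the truncated coefficients.\<close>
    define c where "c n = b n / (2 * sqrt x)" for n
    have I: "finite I" "I \<subseteq> {1..}" by (auto simp: I_def Suc_le_eq prime_gt_0_nat)
    have b: "b n = (real n powr -u - real n powr -v) / sqrt (real n)" for n
      unfolding b_def minus_add_distrib powr_add powr_minus_half by (simp add: diff_divide_distrib)
    have "(\<integral>\<^sup>+\<omega>. ennreal ((\<Sum>n\<in>I. c n * bounded_part n \<omega>) ^ 4) \<partial>M) \<le> ennreal (48 * exp (\<sigma>\<^sup>2))"
    proof (rule bounded_part_sum_moments(2)[OF I])
      fix n assume "n \<in> I"
      then have n: "real n \<ge> 1" using I by auto
      define y where "y = real n powr -u - real n powr -v"
      have y0: "y \<ge> 0" unfolding y_def using n assms by (simp add: powr_mono)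
      have "y \<le> 1"
        using one_minus_powr_le(3)[OF n, of u] assms powr_ge_zero[of "real n" "-v"] unfolding y_def by linarith
      moreover have "y \<le> x" unfolding y_def x_def by (rule powr_difference_le_ln[OF n assms])
      ultimately have "y * y \<le> 1 * x" using y0 by (intro mult_mono) auto
      then have "y \<le> sqrt x" by (intro real_le_rsqrt) (simp add: power2_eq_square)
      then show "\<bar>c n\<bar> * (2 * sqrt (real n)) \<le> 1"
        unfolding c_def b y_def[symmetric] using y0 x n by (simp add: abs_mult)
    next
      have "(\<Sum>n\<in>I. (c n)\<^sup>2) = (\<Sum>n\<in>I. (real n powr -u - real n powr -v)\<^sup>2 / real n) / (4 * x)"
        unfolding sum_divide_distrib
        by (intro sum.cong refl) (use x in \<open>simp add: c_def b power_divide power_mult_distrib mult_ac\<close>)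
      also have "\<dots> \<le> (\<Sum>p | prime p \<and> p \<le> N. (real p powr -u - real p powr -v)\<^sup>2 / real p) / (4 * x)"
        using x by (intro divide_right_mono sum_mono2) (auto simp: I_def)
      also have "\<dots> \<le> x / (4 * x)"
        using x prime_square_increment_le[OF assms, of N] by (intro divide_right_mono) (auto simp: x_def)
      also have "\<dots> \<le> 1" using x by simp
      finally show "(\<Sum>n\<in>I. (c n)\<^sup>2) * \<sigma>\<^sup>2 \<le> \<sigma>\<^sup>2"
        using mult_right_mono[of _ 1 "\<sigma>\<^sup>2"] by simp
    qed
    moreover have "f N \<omega> = (16 * x\<^sup>2) * (\<Sum>n\<in>I. c n * bounded_part n \<omega>) ^ 4" for \<omega>
    proof -
      have "(\<Sum>n<N. prime_coeff (\<lambda>n. bounded_part n \<omega>) n * b n) = (\<Sum>n\<in>I. b n * bounded_part n \<omega>)"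
        by (rule sum.mono_neutral_cong_right) (auto simp: I_def prime_coeff_def)
      also have "\<dots> = (2 * sqrt x) * (\<Sum>n\<in>I. c n * bounded_part n \<omega>)"
        unfolding sum_distrib_left c_def using x by (intro sum.cong) auto
      finally have "f N \<omega> = (2 * sqrt x) ^ 4 * (\<Sum>n\<in>I. c n * bounded_part n \<omega>) ^ 4"
        unfolding f_def by (simp only: power_mult_distrib)
      moreover have "(2 * sqrt x) ^ 4 = 16 * ((sqrt x)\<^sup>2)\<^sup>2" by (simp add: power_mult_distrib)
      ultimately show ?thesis using x by simp
    qed
    moreover have "(\<lambda>\<omega>. (\<Sum>n\<in>I. c n * bounded_part n \<omega>) ^ 4) \<in> borel_measurable M"
      using I(2) by (intro borel_measurable_power borel_measurable_sum borel_measurable_times bounded_part_measurable) auto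
    ultimately have "(\<integral>\<^sup>+\<omega>. ennreal (f N \<omega>) \<partial>M) \<le> ennreal (16 * x\<^sup>2) * ennreal (48 * exp (\<sigma>\<^sup>2))"
      by (simp add: ennreal_mult' nn_integral_cmult mult_left_mono)
    also have "\<dots> = ennreal (768 * exp (\<sigma>\<^sup>2) * x\<^sup>2)"
      by (subst ennreal_mult'[symmetric]) (auto simp: mult_ac)
    finally show "(\<integral>\<^sup>+\<omega>. ennreal (f N \<omega>) \<partial>M) \<le> ennreal (768 * exp (\<sigma>\<^sup>2) * x\<^sup>2)" .
  qed
qed simp

definition cutoff_sum :: "real \<Rightarrow> 'a \<Rightarrow> real" where
  "cutoff_sum y \<omega> = (\<Sum>p | prime p \<and> 1 < ln (real p) \<and> ln (real p) \<le> y. \<eta> p \<omega> / sqrt (real p))"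

text \<open>
  By independence the second moment of a partial sum of the difference is \<open>\<sigma>\<^sup>2\<close> times the sum of the
  squared weights.
\<close>

lemma second_moment_cutoff_le:
  assumes "0 < u" "u \<le> 1"
  shows "(\<integral>\<^sup>+\<omega>. ennreal ((prime_process \<eta> u \<omega> - cutoff_sum (1 / u) \<omega>)\<^sup>2) \<partial>M) \<le> ennreal (8 * \<sigma>\<^sup>2)"
proof -
  define A where "A = {p::nat. prime p \<and> 1 < ln (real p) \<and> ln (real p) \<le> 1 / u}"
  have A: "finite A" unfolding A_def by (rule finite_subset[OF _ finite_primes_ln_le[of "1 / u"]]) auto
  define w where "w n = real n powr -u - (if 1 < ln (real n) \<and> ln (real n) \<le> 1 / u then 1 else 0)" for n
  define f where "f N \<omega> = (\<Sum>n\<le>N. prime_coeff (\<lambda>n. \<eta> n \<omega>) n * (w n / sqrt (real n)))\<^sup>2" for N \<omega>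
  show ?thesis
  proof (rule nn_integral_limit_le[of f])
    show "f N \<in> borel_measurable M" for N unfolding f_def[abs_def] by measurable
    show "AE \<omega> in M. (\<lambda>N. f N \<omega>) \<longlonglongrightarrow> (prime_process \<eta> u \<omega> - cutoff_sum (1 / u) \<omega>)\<^sup>2"
      using AE_good_event
    proof eventually_elim
      case (elim \<omega>)
      have 1: "(\<lambda>n. prime_coeff (\<lambda>n. \<eta> n \<omega>) n * real n powr -(1/2 + u)) sums prime_process \<eta> u \<omega>"
        using elim assms unfolding prime_series_sums_iff[symmetric] prime_process_def prime_series_def regular_coeffs_def
        by (auto intro: summable_sums)
      have 2: "(\<lambda>n. if n \<in> A then \<eta> n \<omega> / sqrt (real n) else 0) sums cutoff_sum (1 / u) \<omega>"
        unfolding cutoff_sum_def A_def[symmetric] by (rule sums_If_finite_set[OF A])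
      have eq: "prime_coeff (\<lambda>n. \<eta> n \<omega>) n * real n powr -(1/2 + u) -
          (if n \<in> A then \<eta> n \<omega> / sqrt (real n) else 0) = prime_coeff (\<lambda>n. \<eta> n \<omega>) n * (w n / sqrt (real n))" for n
        unfolding minus_add_distrib powr_add powr_minus_half
        by (auto simp: w_def A_def prime_coeff_def algebra_simps diff_divide_distrib)
      have "(\<lambda>n. prime_coeff (\<lambda>n. \<eta> n \<omega>) n * (w n / sqrt (real n))) sums (prime_process \<eta> u \<omega> - cutoff_sum (1 / u) \<omega>)"
        using sums_diff[OF 1 2] unfolding eq .
      then show ?case unfolding f_def sums_def_le by (rule tendsto_power)
    qed
    fix N :: nat
    define I where "I = {p. prime p \<and> p \<le> N}"
    define Z where "Z n \<omega> = (w n / sqrt (real n)) * \<eta> n \<omega>" for n \<omega>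
    have I: "finite I" "I \<subseteq> {1..}"
      by (auto simp: I_def Suc_le_eq prime_gt_0_nat intro: finite_subset[of _ "{..N}"])
    have indepZ: "indep_vars (\<lambda>_. borel) Z I"
      unfolding Z_def by (rule indep_vars_compose2[where Y = "\<lambda>n x. (w n / sqrt (real n)) * x", OF indep_vars_subset[OF indep I(2)]]) auto
    have moments: "integrable M (\<lambda>\<omega>. (Z n \<omega>)\<^sup>2)" "expectation (Z n) = 0"
      "expectation (\<lambda>\<omega>. (Z n \<omega>)\<^sup>2) = (w n)\<^sup>2 / real n * \<sigma>\<^sup>2" if "n \<in> I" for n
    proof -
      have n: "n \<ge> 1" using that I by auto
      show "integrable M (\<lambda>\<omega>. (Z n \<omega>)\<^sup>2)"
        unfolding Z_def power_mult_distrib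
        using coeff_transfer(1)[OF n, of "\<lambda>x. x\<^sup>2"] square_integrable by simp
      show "expectation (Z n) = 0"
        unfolding Z_def[abs_def] using coeff_transfer(2)[OF n, of "\<lambda>x. x"] mean_zero by simp
      show "expectation (\<lambda>\<omega>. (Z n \<omega>)\<^sup>2) = (w n)\<^sup>2 / real n * \<sigma>\<^sup>2"
        unfolding Z_def power_mult_distrib
        using coeff_transfer(2)[OF n, of "\<lambda>x. x\<^sup>2"] variance by (simp add: power_divide)
    qed
    have f_eq: "f N \<omega> = (\<Sum>n\<in>I. Z n \<omega>)\<^sup>2" for \<omega>
      unfolding f_def Z_def
      by (rule arg_cong[where f = "\<lambda>x. x\<^sup>2"], rule sum.mono_neutral_cong_right) (auto simp: I_def prime_coeff_def)
    have "(\<integral>\<^sup>+\<omega>. ennreal (f N \<omega>) \<partial>M) = ennreal (expectation (\<lambda>\<omega>. (\<Sum>n\<in>I. Z n \<omega>)\<^sup>2))"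
      unfolding f_eq by (intro nn_integral_eq_integral second_moment_sum_indep(1)[OF I(1) indepZ]) (auto simp: moments)
    also have "expectation (\<lambda>\<omega>. (\<Sum>n\<in>I. Z n \<omega>)\<^sup>2) = (\<Sum>n\<in>I. (w n)\<^sup>2 / real n) * \<sigma>\<^sup>2"
      unfolding sum_distrib_right
      by (subst second_moment_sum_indep(2)[OF I(1) indepZ]) (auto simp: moments)
    also have "\<dots> \<le> 8 * \<sigma>\<^sup>2"
      using prime_cutoff_weights_le[OF assms, of N] unfolding I_def w_def by (intro mult_right_mono) auto
    finally show "(\<integral>\<^sup>+\<omega>. ennreal (f N \<omega>) \<partial>M) \<le> ennreal (8 * \<sigma>\<^sup>2)"
      by (simp add: ennreal_leI)
  qed
qed

end

section \<open>Paths on the half-line\<close>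

text \<open>
  For continuous functions, a closed condition on an interval is a countable condition.
\<close>

lemma bound_on_rationals_imp_bound:
  fixes f :: "real \<Rightarrow> real"
  assumes "continuous_on {a..b} f" "a < b" "\<And>t. t \<in> \<rat> \<inter> {a..b} \<Longrightarrow> \<bar>f t - c\<bar> \<le> e"
  shows "t \<in> {a..b} \<Longrightarrow> \<bar>f t - c\<bar> \<le> e"
proof (rule ccontr)
  assume t: "t \<in> {a..b}" and "\<not> \<bar>f t - c\<bar> \<le> e"
  then have gap: "\<bar>f t - c\<bar> - e > 0" by simp
  obtain \<delta> where \<delta>: "\<delta> > 0" "\<And>r. r \<in> {a..b} \<Longrightarrow> dist r t < \<delta> \<Longrightarrow> dist (f r) (f t) < \<bar>f t - c\<bar> - e"
    using assms(1) t gap unfolding continuous_on_iff by metis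
  have "max a (t - \<delta>) < min b (t + \<delta>)" using t \<open>\<delta> > 0\<close> \<open>a < b\<close> by auto
  then obtain r where r: "r \<in> \<rat>" "max a (t - \<delta>) < r" "r < min b (t + \<delta>)"
    using Rats_dense_in_real by blast
  then have "dist (f r) (f t) < \<bar>f t - c\<bar> - e" by (intro \<delta>(2)) (auto simp: dist_real_def)
  moreover have "\<bar>f r - c\<bar> \<le> e" using r by (intro assms(3)) auto
  ultimately show False by (simp add: dist_real_def)
qed

text \<open>
  Paths that stay within \<open>1/(k+1)\<close> of the step function with values \<open>q\<close> on consecutive
  cells of length \<open>1/(n+1)\<close>. There are only countably many tubes, and two paths in the same tube are
  uniformly close on the interval covered.
\<close>

definition cpath_tube :: "rat list \<Rightarrow> nat \<Rightarrow> nat \<Rightarrow> cpath set" where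
  "cpath_tube q n k = {g. \<forall>i<length q. \<forall>t\<in>{real i / real (Suc n)..real (Suc i) / real (Suc n)}.
     \<bar>cpath_apply g t - of_rat (q ! i)\<bar> \<le> 1 / real (Suc k)}"

lemma cpath_apply_continuous: "continuous_on {0..} (cpath_apply g)"
  using cpath_apply[of g] by simp

lemma exists_cell:
  fixes t :: real and n :: nat
  assumes "t \<ge> 0"
  obtains i :: nat where "real i / real (Suc n) \<le> t" "t < real (Suc i) / real (Suc n)"
proof
  define i where "i = nat \<lfloor>t * real (Suc n)\<rfloor>"
  have "real i = of_int \<lfloor>t * real (Suc n)\<rfloor>" using assms by (simp add: i_def)
  then have "real i \<le> t * real (Suc n)" "t * real (Suc n) < real i + 1" by linarith+
  then show "real i / real (Suc n) \<le> t" "t < real (Suc i) / real (Suc n)"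
    by (simp_all add: pos_divide_le_eq pos_less_divide_eq add.commute)
qed

text \<open>
  Uniform continuity puts every path of \<open>U\<close> into a tube so thin that it lies in \<open>U\<close>.
\<close>

lemma open_cpath_Union_tubes:
  assumes "open U"
  shows "U = \<Union> ((\<lambda>(q, n, k). cpath_tube q n k) ` {(q, n, k). cpath_tube q n k \<subseteq> U})"
proof (intro equalityI subsetI)
  fix g assume "g \<in> U"
  then obtain T e where T: "T \<ge> 0" "e > 0"
    and ball: "\<And>h. (\<forall>t\<in>{0..T}. \<bar>cpath_apply h t - cpath_apply g t\<bar> < e) \<Longrightarrow> h \<in> U"
    using assms unfolding open_cpath_def by blast
  \<comment> \<open>Two paths in a tube of index k differ by at most 2 / (k + 1).\<close>
  obtain k where k: "1 / real (Suc k) < e / 2"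
    using nat_approx_posE[of "e / 2"] T by auto
  define T0 where "T0 = nat \<lceil>T\<rceil> + 1"
  have T0: "T < real T0" unfolding T0_def by linarith
  define \<epsilon> where "\<epsilon> = 1 / (2 * real (Suc k))"
  have \<epsilon>: "\<epsilon> > 0" by (simp add: \<epsilon>_def)
  have "uniformly_continuous_on {0..real T0} (cpath_apply g)"
    by (intro compact_uniformly_continuous continuous_on_subset[OF cpath_apply_continuous]) auto
  then obtain \<delta> where \<delta>: "\<delta> > 0"
    "\<And>t r. t \<in> {0..real T0} \<Longrightarrow> r \<in> {0..real T0} \<Longrightarrow> dist r t < \<delta> \<Longrightarrow>
      dist (cpath_apply g r) (cpath_apply g t) < \<epsilon>"
    unfolding uniformly_continuous_on_def using \<epsilon> by metis
  obtain n where n: "1 / real (Suc n) < \<delta>" using nat_approx_posE \<delta>(1) by auto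
  have "\<exists>r::rat. \<bar>of_rat r - cpath_apply g (real i / real (Suc n))\<bar> < \<epsilon>" for i :: nat
  proof -
    obtain r where "r \<in> \<rat>" "cpath_apply g (real i / real (Suc n)) - \<epsilon> < r"
      "r < cpath_apply g (real i / real (Suc n)) + \<epsilon>"
      using Rats_dense_in_real[of "cpath_apply g (real i / real (Suc n)) - \<epsilon>"
          "cpath_apply g (real i / real (Suc n)) + \<epsilon>"] \<epsilon> by auto
    moreover from \<open>r \<in> \<rat>\<close> obtain r' where "r = of_rat r'" by (rule Rats_cases)
    ultimately show ?thesis by (intro exI[of _ r']) (simp add: abs_less_iff algebra_simps)
  qed
  then obtain r :: "nat \<Rightarrow> rat" where
    r: "\<And>i. \<bar>of_rat (r i) - cpath_apply g (real i / real (Suc n))\<bar> < \<epsilon>" by metis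
  define q where "q = map r [0..<T0 * Suc n]"
  have q: "length q = T0 * Suc n" "\<And>i. i < length q \<Longrightarrow> q ! i = r i"
    by (simp_all add: q_def)
  have "g \<in> cpath_tube q n k"
    unfolding cpath_tube_def
  proof (intro CollectI allI impI ballI)
    fix i t assume i: "i < length q" and t: "t \<in> {real i / real (Suc n)..real (Suc i) / real (Suc n)}"
    have "real (Suc i) \<le> real T0 * real (Suc n)"
      using i unfolding q(1) by (metis Suc_leI of_nat_le_iff of_nat_mult)
    then have top: "real (Suc i) / real (Suc n) \<le> real T0" by (simp add: pos_divide_le_eq)
    have bot: "0 \<le> real i / real (Suc n)" by simp
    have wid: "real (Suc i) / real (Suc n) = real i / real (Suc n) + 1 / real (Suc n)"
      by (simp add: add_divide_distrib)
    have "dist (cpath_apply g t) (cpath_apply g (real i / real (Suc n))) < \<epsilon>"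
    proof (rule \<delta>(2))
      show "real i / real (Suc n) \<in> {0..real T0}" "t \<in> {0..real T0}"
        using t top bot wid order_trans[OF bot, of t] by (auto simp del: of_nat_Suc)
      show "dist t (real i / real (Suc n)) < \<delta>"
        using t wid n by (auto simp: dist_real_def simp del: of_nat_Suc)
    qed
    then have "\<bar>cpath_apply g t - of_rat (r i)\<bar> \<le> \<epsilon> + \<epsilon>"
      using r[of i] by (simp add: dist_real_def)
    also have "\<epsilon> + \<epsilon> = 1 / real (Suc k)" by (simp add: \<epsilon>_def field_simps)
    finally show "\<bar>cpath_apply g t - of_rat (q ! i)\<bar> \<le> 1 / real (Suc k)"
      using q(2)[OF i] by simp
  qed
  moreover have "cpath_tube q n k \<subseteq> U"
  proof
    fix h assume h: "h \<in> cpath_tube q n k"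
    show "h \<in> U"
    proof (rule ball, rule ballI)
      fix t assume t: "t \<in> {0..T}"
      then obtain i where i: "real i / real (Suc n) \<le> t" "t < real (Suc i) / real (Suc n)"
        using exists_cell[of t n] by auto
      have "real i < real T0 * real (Suc n)"
      proof -
        have "real i \<le> t * real (Suc n)" using i(1) by (subst (asm) pos_divide_le_eq) auto
        also have "\<dots> < real T0 * real (Suc n)" using t T0 by (intro mult_strict_right_mono) auto
        finally show ?thesis .
      qed
      then have "i < length q" unfolding q(1) by (metis of_nat_less_iff of_nat_mult)
      then have "\<bar>cpath_apply h t - of_rat (q ! i)\<bar> \<le> 1 / real (Suc k)"
        "\<bar>cpath_apply g t - of_rat (q ! i)\<bar> \<le> 1 / real (Suc k)"
        using h \<open>g \<in> cpath_tube q n k\<close> i unfolding cpath_tube_def by auto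
      then show "\<bar>cpath_apply h t - cpath_apply g t\<bar> < e" using k by linarith
    qed
  qed
  ultimately show "g \<in> \<Union> ((\<lambda>(q, n, k). cpath_tube q n k) ` {(q, n, k). cpath_tube q n k \<subseteq> U})"
    by blast
qed auto

text \<open>
  Membership in a tube depends on rational times only, and every open set is a countable union of
  tubes.
\<close>

lemma borel_measurable_cpath_of:
  assumes meas: "\<And>t. t \<ge> 0 \<Longrightarrow> X t \<in> borel_measurable M"
    and cont: "\<And>\<omega>. \<omega> \<in> space M \<Longrightarrow> continuous_on {0..} (\<lambda>t. X t \<omega>)"
  shows "(\<lambda>\<omega>. cpath_of (\<lambda>t. X t \<omega>)) \<in> M \<rightarrow>\<^sub>M borel"
proof (rule borel_measurableI)
  fix U :: "cpath set" assume "open U"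
  let ?\<Phi> = "\<lambda>\<omega>. cpath_of (\<lambda>t. X t \<omega>)"
  have tube: "?\<Phi> -` cpath_tube q n k \<inter> space M \<in> sets M" for q n k
  proof -
    let ?I = "\<lambda>i. {real i / real (Suc n)..real (Suc i) / real (Suc n)}"
    have "(?\<Phi> \<omega> \<in> cpath_tube q n k) \<longleftrightarrow>
        (\<forall>i\<in>{..<length q}. \<forall>t\<in>\<rat> \<inter> ?I i. \<bar>X t \<omega> - of_rat (q ! i)\<bar> \<le> 1 / real (Suc k))"
      if \<omega>: "\<omega> \<in> space M" for \<omega>
    proof -
      have nonneg: "t \<ge> 0" if "t \<in> ?I i" for t i
        using that by (meson atLeastAtMost_iff divide_nonneg_nonneg of_nat_0_le_iff order_trans)
      have tube_iff: "(?\<Phi> \<omega> \<in> cpath_tube q n k) \<longleftrightarrow>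
          (\<forall>i\<in>{..<length q}. \<forall>t\<in>?I i. \<bar>X t \<omega> - of_rat (q ! i)\<bar> \<le> 1 / real (Suc k))"
        using cpath_apply_cpath_of[OF cont[OF \<omega>] nonneg] unfolding cpath_tube_def by auto
      have "(\<forall>t\<in>?I i. \<bar>X t \<omega> - of_rat (q ! i)\<bar> \<le> 1 / real (Suc k)) \<longleftrightarrow>
          (\<forall>t\<in>\<rat> \<inter> ?I i. \<bar>X t \<omega> - of_rat (q ! i)\<bar> \<le> 1 / real (Suc k))" for i
      proof
        assume *: "\<forall>t\<in>\<rat> \<inter> ?I i. \<bar>X t \<omega> - of_rat (q ! i)\<bar> \<le> 1 / real (Suc k)"
        have "continuous_on (?I i) (\<lambda>t. X t \<omega>)"
          using nonneg by (intro continuous_on_subset[OF cont[OF \<omega>]]) auto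
        moreover have "real i / real (Suc n) < real (Suc i) / real (Suc n)"
          by (simp add: divide_strict_right_mono)
        ultimately show "\<forall>t\<in>?I i. \<bar>X t \<omega> - of_rat (q ! i)\<bar> \<le> 1 / real (Suc k)"
          using * bound_on_rationals_imp_bound[of _ _ "\<lambda>t. X t \<omega>"] by blast
      qed auto
      then show ?thesis unfolding tube_iff by blast
    qed
    then have "?\<Phi> -` cpath_tube q n k \<inter> space M = {\<omega> \<in> space M.
        \<forall>i\<in>{..<length q}. \<forall>t\<in>\<rat> \<inter> ?I i. \<bar>X t \<omega> - of_rat (q ! i)\<bar> \<le> 1 / real (Suc k)}"
      by blast
    also have "\<dots> \<in> sets M"
    proof (intro sets.sets_Collect_countable_All')
      fix i t assume "t \<in> \<rat> \<inter> ?I i"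
      then have "t \<ge> 0" by (meson IntE atLeastAtMost_iff divide_nonneg_nonneg of_nat_0_le_iff order_trans)
      note [measurable] = meas[OF this]
      show "{\<omega> \<in> space M. \<bar>X t \<omega> - of_rat (q ! i)\<bar> \<le> 1 / real (Suc k)} \<in> sets M"
        by measurable
    qed (auto intro: countable_rat)
    finally show ?thesis .
  qed
  have "?\<Phi> -` U \<inter> space M = (\<Union>z\<in>{(q, n, k). cpath_tube q n k \<subseteq> U}.
      ?\<Phi> -` (case z of (q, n, k) \<Rightarrow> cpath_tube q n k) \<inter> space M)"
    by (subst open_cpath_Union_tubes[OF \<open>open U\<close>]) auto
  also have "\<dots> \<in> sets M"
    by (intro sets.countable_UN') (auto intro: tube)
  finally show "?\<Phi> -` U \<inter> space M \<in> sets M" .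
qed


definition cpath_lipschitz :: "real \<Rightarrow> (cpath \<Rightarrow> real) \<Rightarrow> bool" where
  "cpath_lipschitz K f \<longleftrightarrow> (\<forall>x y d.
     (\<forall>t\<in>{0..K}. \<bar>cpath_apply x t - cpath_apply y t\<bar> \<le> d) \<longrightarrow> \<bar>f x - f y\<bar> \<le> K * d)"

lemma cpath_lipschitz_imp_continuous:
  assumes "cpath_lipschitz K f" "K \<ge> 0"
  shows "continuous_on UNIV f"
proof -
  have "open (f -` V)" if "open V" for V
    unfolding open_cpath_def
  proof
    fix g assume "g \<in> f -` V"
    then obtain e where e: "e > 0" "\<And>x. dist x (f g) < e \<Longrightarrow> x \<in> V"
      using \<open>open V\<close> unfolding open_dist by auto
    define \<delta> where "\<delta> = e / (K + 1)"
    have \<delta>: "\<delta> > 0" "K * \<delta> < e"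
      using e(1) assms(2) by (auto simp: \<delta>_def field_simps)
    have "h \<in> f -` V" if "\<forall>t\<in>{0..K}. \<bar>cpath_apply h t - cpath_apply g t\<bar> < \<delta>" for h
    proof -
      have "\<forall>t\<in>{0..K}. \<bar>cpath_apply h t - cpath_apply g t\<bar> \<le> \<delta>"
        using that by (auto intro: less_imp_le)
      then have "\<bar>f h - f g\<bar> \<le> K * \<delta>"
        using assms(1) unfolding cpath_lipschitz_def by blast
      then have "dist (f h) (f g) < e" using \<delta>(2) by (simp add: dist_real_def)
      then show ?thesis using e(2) by simp
    qed
    then show "\<exists>T\<ge>0. \<exists>e>0. \<forall>h. (\<forall>t\<in>{0..T}. \<bar>cpath_apply h t - cpath_apply g t\<bar> < e) \<longrightarrow> h \<in> f -` V"
      using \<delta>(1) assms(2) by blast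
  qed
  then show ?thesis by (simp add: continuous_on_open_vimage)
qed

text \<open>
  The inf-convolution of \<open>f\<close> with \<open>K\<close> times the supremum distance on \<open>[0, K]\<close>; the upper bounds
  \<open>d\<close> stand in for that distance.
\<close>

definition lipschitz_regularization :: "(cpath \<Rightarrow> real) \<Rightarrow> real \<Rightarrow> cpath \<Rightarrow> real" where
  "lipschitz_regularization f K x = Inf {f y + K * d | y d.
     \<forall>t\<in>{0..K}. \<bar>cpath_apply x t - cpath_apply y t\<bar> \<le> d}"

context
  fixes f :: "cpath \<Rightarrow> real" and b :: real
  assumes bound: "\<And>x. \<bar>f x\<bar> \<le> b"
begin

lemma lipschitz_regularization_le:
  assumes "K \<ge> 0" "\<forall>t\<in>{0..K}. \<bar>cpath_apply x t - cpath_apply y t\<bar> \<le> d"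
  shows "lipschitz_regularization f K x \<le> f y + K * d"
  unfolding lipschitz_regularization_def
proof (rule cInf_lower)
  show "bdd_below {f y + K * d | y d. \<forall>t\<in>{0..K}. \<bar>cpath_apply x t - cpath_apply y t\<bar> \<le> d}"
  proof (rule bdd_belowI)
    fix z assume "z \<in> {f y + K * d | y d. \<forall>t\<in>{0..K}. \<bar>cpath_apply x t - cpath_apply y t\<bar> \<le> d}"
    then obtain y d where z: "z = f y + K * d"
      and d: "\<forall>t\<in>{0..K}. \<bar>cpath_apply x t - cpath_apply y t\<bar> \<le> d" by blast
    have "0 \<in> {0..K}" using assms(1) by simp
    then have "d \<ge> 0" using d by (meson abs_ge_zero order_trans)
    then show "- b \<le> z" using bound[of y] assms(1) unfolding z
      by (smt (verit) mult_nonneg_nonneg)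
  qed
qed (use assms in blast)

lemma lipschitz_regularization_ge:
  assumes "\<And>y d. \<forall>t\<in>{0..K}. \<bar>cpath_apply x t - cpath_apply y t\<bar> \<le> d \<Longrightarrow> c \<le> f y + K * d"
  shows "c \<le> lipschitz_regularization f K x"
  unfolding lipschitz_regularization_def
proof (rule cInf_greatest)
  show "{f y + K * d | y d. \<forall>t\<in>{0..K}. \<bar>cpath_apply x t - cpath_apply y t\<bar> \<le> d} \<noteq> {}"
    by (auto intro!: exI[of _ x] exI[of _ 0])
qed (use assms in blast)

lemma lipschitz_regularization_lipschitz:
  assumes "K \<ge> 0"
  shows "cpath_lipschitz K (lipschitz_regularization f K)"
proof -
  have one_sided: "lipschitz_regularization f K x - K * d \<le> lipschitz_regularization f K y"
    if xy: "\<forall>t\<in>{0..K}. \<bar>cpath_apply x t - cpath_apply y t\<bar> \<le> d" for x y d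
  proof (rule lipschitz_regularization_ge)
    fix z d' assume "\<forall>t\<in>{0..K}. \<bar>cpath_apply y t - cpath_apply z t\<bar> \<le> d'"
    then have "\<forall>t\<in>{0..K}. \<bar>cpath_apply x t - cpath_apply z t\<bar> \<le> d + d'"
      using xy by (smt (verit))
    then have "lipschitz_regularization f K x \<le> f z + K * (d + d')"
      by (rule lipschitz_regularization_le[OF assms])
    then show "lipschitz_regularization f K x - K * d \<le> f z + K * d'"
      by (simp add: algebra_simps)
  qed
  show ?thesis
    unfolding cpath_lipschitz_def
  proof (intro allI impI)
    fix x y d assume xy: "\<forall>t\<in>{0..K}. \<bar>cpath_apply x t - cpath_apply y t\<bar> \<le> d"
    then have yx: "\<forall>t\<in>{0..K}. \<bar>cpath_apply y t - cpath_apply x t\<bar> \<le> d"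
      by (simp add: abs_minus_commute)
    show "\<bar>lipschitz_regularization f K x - lipschitz_regularization f K y\<bar> \<le> K * d"
      using one_sided[OF xy] one_sided[OF yx] by linarith
  qed
qed

lemma lipschitz_regularization_bounds:
  assumes "K \<ge> 0"
  shows "lipschitz_regularization f K x \<le> f x" and "\<bar>lipschitz_regularization f K x\<bar> \<le> b"
proof -
  show le: "lipschitz_regularization f K x \<le> f x"
    using lipschitz_regularization_le[OF assms, of x x 0] by simp
  have "- b \<le> lipschitz_regularization f K x"
  proof (rule lipschitz_regularization_ge)
    fix y d assume d: "\<forall>t\<in>{0..K}. \<bar>cpath_apply x t - cpath_apply y t\<bar> \<le> d"
    have "0 \<in> {0..K}" using assms(1) by simp
    then have "d \<ge> 0" using d by (meson abs_ge_zero order_trans)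
    then show "- b \<le> f y + K * d" using bound[of y] assms(1)
      by (smt (verit) mult_nonneg_nonneg)
  qed
  then show "\<bar>lipschitz_regularization f K x\<bar> \<le> b"
    using le bound[of x] by linarith
qed

text \<open>
  Paths \<open>y\<close> far from \<open>x\<close> on \<open>[0, n]\<close> are excluded by the penalty \<open>n * d\<close> once it exceeds the
  oscillation \<open>2 b\<close>; for the near ones continuity of \<open>f\<close> at \<open>x\<close> applies.
\<close>

lemma lipschitz_regularization_tendsto:
  assumes "continuous_on UNIV f"
  shows "(\<lambda>n. lipschitz_regularization f (real n) x) \<longlonglongrightarrow> f x"
proof (rule LIMSEQ_I)
  fix \<epsilon> :: real assume "\<epsilon> > 0"
  then have "open (f -` {f x - \<epsilon> / 2<..})"
    using assms by (simp add: continuous_on_open_vimage)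
  then obtain T e where T: "T \<ge> 0" "e > 0"
    and near: "\<And>y. (\<forall>t\<in>{0..T}. \<bar>cpath_apply y t - cpath_apply x t\<bar> < e) \<Longrightarrow> f y > f x - \<epsilon> / 2"
  proof -
    have "x \<in> f -` {f x - \<epsilon> / 2<..}" using \<open>\<epsilon> > 0\<close> by simp
    with \<open>open (f -` {f x - \<epsilon> / 2<..})\<close> obtain T e where "T \<ge> 0" "e > 0"
      "\<forall>y. (\<forall>t\<in>{0..T}. \<bar>cpath_apply y t - cpath_apply x t\<bar> < e) \<longrightarrow> y \<in> f -` {f x - \<epsilon> / 2<..}"
      unfolding open_cpath_def by blast
    then show ?thesis by (intro that[of T e]) auto
  qed
  obtain n0 :: nat where n0: "real n0 > max T (2 * b / e)" using reals_Archimedean2 by blast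
  have "norm (lipschitz_regularization f (real n) x - f x) < \<epsilon>" if n: "n \<ge> n0" for n
  proof -
    have "f x - \<epsilon> / 2 \<le> lipschitz_regularization f (real n) x"
    proof (rule lipschitz_regularization_ge)
      fix y d assume d: "\<forall>t\<in>{0..real n}. \<bar>cpath_apply x t - cpath_apply y t\<bar> \<le> d"
      have "0 \<in> {0..real n}" by simp
      then have "d \<ge> 0" using d by (meson abs_ge_zero order_trans)
      show "f x - \<epsilon> / 2 \<le> f y + real n * d"
      proof (cases "d < e")
        case True
        have "\<forall>t\<in>{0..T}. \<bar>cpath_apply y t - cpath_apply x t\<bar> < e"
        proof
          fix t assume "t \<in> {0..T}"
          then have "t \<in> {0..real n}" using n0 n by auto
          with d have "\<bar>cpath_apply x t - cpath_apply y t\<bar> \<le> d" by blast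
          with True show "\<bar>cpath_apply y t - cpath_apply x t\<bar> < e" by linarith
        qed
        then have "f y > f x - \<epsilon> / 2" by (rule near)
        moreover have "real n * d \<ge> 0" using \<open>d \<ge> 0\<close> by simp
        ultimately show ?thesis by linarith
      next
        case False
        have "2 * b / e < real n" using n0 n by auto
        then have "2 * b < real n * e" using T by (simp add: pos_divide_less_eq)
        also have "\<dots> \<le> real n * d" using False by (intro mult_left_mono) auto
        finally show ?thesis using bound[of x] bound[of y] \<open>\<epsilon> > 0\<close> by linarith
      qed
    qed
    moreover have "lipschitz_regularization f (real n) x \<le> f x"
      by (rule lipschitz_regularization_bounds) simp
    ultimately show ?thesis using \<open>\<epsilon> > 0\<close> by simp
  qed
  then show "\<exists>n0. \<forall>n\<ge>n0. norm (lipschitz_regularization f (real n) x - f x) < \<epsilon>" by blast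
qed

end

text \<open>
  The regularizations lie below \<open>f\<close> and converge to it, which gives the lower half of the
  convergence; the upper half is the lower half for \<open>-f\<close>.
\<close>

lemma weakly_converges_lipschitzI:
  fixes \<mu> :: "'i \<Rightarrow> cpath measure"
  assumes \<mu>: "\<forall>\<^sub>F i in F. prob_space (\<mu> i) \<and> sets (\<mu> i) = sets borel"
    and \<nu>: "prob_space \<nu>" "sets \<nu> = sets borel"
    and conv: "\<And>K f. \<lbrakk>bounded (range f); cpath_lipschitz (real K) f\<rbrakk> \<Longrightarrow>
      ((\<lambda>i. \<integral>x. f x \<partial>\<mu> i) \<longlongrightarrow> (\<integral>x. f x \<partial>\<nu>)) F"
  shows "weakly_converges \<mu> \<nu> F"
proof -
  have lower: "\<forall>\<^sub>F i in F. c < (\<integral>x. f x \<partial>\<mu> i)"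
    if f: "continuous_on UNIV f" "bounded (range f)" and c: "c < (\<integral>x. f x \<partial>\<nu>)" for f :: "cpath \<Rightarrow> real" and c
  proof -
    obtain b where b: "\<And>x. \<bar>f x\<bar> \<le> b"
      using f(2) unfolding bounded_iff by (auto simp: image_iff)
    define g where "g n = lipschitz_regularization f (real n)" for n :: nat
    have g_meas: "g n \<in> borel_measurable borel" for n
      unfolding g_def
      by (intro borel_measurable_continuous_onI cpath_lipschitz_imp_continuous[of "real n"]
          lipschitz_regularization_lipschitz[of f b] b) auto
    have f_meas: "f \<in> borel_measurable borel" by (intro borel_measurable_continuous_onI f)
    have g_bound: "\<bar>g n x\<bar> \<le> b" "g n x \<le> f x" for n x
      unfolding g_def using lipschitz_regularization_bounds[of f b "real n" x] b by auto
    have "(\<lambda>n. \<integral>x. g n x \<partial>\<nu>) \<longlonglongrightarrow> (\<integral>x. f x \<partial>\<nu>)"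
    proof (rule integral_dominated_convergence[where w = "\<lambda>_. b"])
      show "AE x in \<nu>. (\<lambda>n. g n x) \<longlonglongrightarrow> f x"
        unfolding g_def using lipschitz_regularization_tendsto[of f b] b f(1) by auto
      show "integrable \<nu> (\<lambda>_. b)" using \<nu>(1) by (simp add: prob_space.finite_measure finite_measure.integrable_const)
    qed (use \<nu>(2) g_meas f_meas g_bound in \<open>auto simp: measurable_cong_sets[OF \<nu>(2) refl]\<close>)
    then have "\<forall>\<^sub>F n in sequentially. c < (\<integral>x. g n x \<partial>\<nu>)"
      using c by (rule order_tendstoD)
    then obtain n where n: "c < (\<integral>x. g n x \<partial>\<nu>)" by (auto simp: eventually_sequentially)
    have "((\<lambda>i. \<integral>x. g n x \<partial>\<mu> i) \<longlongrightarrow> (\<integral>x. g n x \<partial>\<nu>)) F"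
    proof (rule conv)
      show "bounded (range (g n))" unfolding bounded_iff using g_bound by auto
      show "cpath_lipschitz (real n) (g n)"
        unfolding g_def by (rule lipschitz_regularization_lipschitz[of f b]) (use b in auto)
    qed
    then have "\<forall>\<^sub>F i in F. c < (\<integral>x. g n x \<partial>\<mu> i)" using n by (rule order_tendstoD)
    then show ?thesis
      using \<mu>
    proof eventually_elim
      case (elim i)
      then interpret prob_space "\<mu> i" by simp
      have [measurable_cong]: "sets (\<mu> i) = sets borel" using elim by simp
      have int: "integrable (\<mu> i) h" if "h \<in> borel_measurable borel" "\<And>x. \<bar>h x\<bar> \<le> b" for h :: "cpath \<Rightarrow> real"
        using that by (intro integrable_const_bound[of _ b]) (auto simp: measurable_cong_sets[of "\<mu> i" borel])
      have "(\<integral>x. g n x \<partial>\<mu> i) \<le> (\<integral>x. f x \<partial>\<mu> i)"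
        using g_meas f_meas g_bound b by (intro integral_mono int) auto
      then show ?case using elim by linarith
    qed
  qed
  have "((\<lambda>i. \<integral>x. f x \<partial>\<mu> i) \<longlongrightarrow> (\<integral>x. f x \<partial>\<nu>)) F"
    if f: "continuous_on UNIV f" "bounded (range f)" for f :: "cpath \<Rightarrow> real"
  proof (rule order_tendstoI)
    show "\<forall>\<^sub>F i in F. c < (\<integral>x. f x \<partial>\<mu> i)" if "c < (\<integral>x. f x \<partial>\<nu>)" for c
      using lower[OF f that] .
    show "\<forall>\<^sub>F i in F. (\<integral>x. f x \<partial>\<mu> i) < c" if "(\<integral>x. f x \<partial>\<nu>) < c" for c
    proof -
      have "bounded (range (\<lambda>x. - f x))" using f(2) by (auto simp: bounded_iff)
      moreover have "continuous_on UNIV (\<lambda>x. - f x)" using f(1) by (rule continuous_on_minus)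
      ultimately have "\<forall>\<^sub>F i in F. - c < (\<integral>x. - f x \<partial>\<mu> i)"
        using that by (intro lower) auto
      then show ?thesis by eventually_elim simp
    qed
  qed
  then show ?thesis unfolding weakly_converges_def using \<mu> \<nu> by blast
qed

text \<open>
  The polygonal path through the partial sums of \<open>w\<close> at the times \<open>i/n\<close>, for \<open>i \<le> m\<close>, and constant
  afterwards. This form makes linearity in \<open>w\<close> and continuity in \<open>t\<close> evident.
\<close>

definition linear_interpolation :: "nat \<Rightarrow> nat \<Rightarrow> (nat \<Rightarrow> real) \<Rightarrow> real \<Rightarrow> real" where
  "linear_interpolation n m w t = (\<Sum>i<m. w i * max 0 (min 1 (real n * t - real i)))"

lemma continuous_on_linear_interpolation: "continuous_on A (linear_interpolation n m w)"
  unfolding linear_interpolation_def by (intro continuous_intros)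

text \<open>
  Between grid points the interpolation is a convex combination of two consecutive partial sums.
\<close>

lemma linear_interpolation_close:
  assumes "j < m" "real j \<le> real n * t" "real n * t \<le> real (Suc j)"
    and "\<bar>x - (\<Sum>i<j. w i)\<bar> \<le> e" "\<bar>x - (\<Sum>i<Suc j. w i)\<bar> \<le> e"
  shows "\<bar>x - linear_interpolation n m w t\<bar> \<le> e"
proof -
  define l where "l = real n * t - real j"
  have l: "0 \<le> l" "l \<le> 1" using assms by (auto simp: l_def)
  have "linear_interpolation n m w t = (\<Sum>i\<in>{..<j} \<union> {j} \<union> {j<..<m}. w i * max 0 (min 1 (real n * t - real i)))"
    unfolding linear_interpolation_def using assms(1) by (intro sum.cong) auto
  also have "\<dots> = (\<Sum>i<j. w i * max 0 (min 1 (real n * t - real i))) + w j * max 0 (min 1 (real n * t - real j))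
      + (\<Sum>i\<in>{j<..<m}. w i * max 0 (min 1 (real n * t - real i)))"
    by (subst sum.union_disjoint; (subst sum.union_disjoint)?; auto)
  also have "(\<Sum>i<j. w i * max 0 (min 1 (real n * t - real i))) = (\<Sum>i<j. w i)"
  proof (intro sum.cong refl)
    fix i assume "i \<in> {..<j}"
    then have "real i + 1 \<le> real j" by auto
    then have "1 \<le> real n * t - real i" using assms(2) by linarith
    then show "w i * max 0 (min 1 (real n * t - real i)) = w i" by simp
  qed
  also have "(\<Sum>i\<in>{j<..<m}. w i * max 0 (min 1 (real n * t - real i))) = 0"
  proof (intro sum.neutral ballI)
    fix i assume "i \<in> {j<..<m}"
    then have "real (Suc j) \<le> real i" by auto
    then have "real n * t - real i \<le> 0" using assms(3) by linarith
    then show "w i * max 0 (min 1 (real n * t - real i)) = 0" by simp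
  qed
  also have "w j * max 0 (min 1 (real n * t - real j)) = l * w j"
    using l by (simp add: l_def)
  finally have "x - linear_interpolation n m w t =
      (1 - l) * (x - (\<Sum>i<j. w i)) + l * (x - (\<Sum>i<Suc j. w i))"
    by (simp add: algebra_simps)
  also have "\<bar>\<dots>\<bar> \<le> (1 - l) * \<bar>x - (\<Sum>i<j. w i)\<bar> + l * \<bar>x - (\<Sum>i<Suc j. w i)\<bar>"
    using l by (intro order_trans[OF abs_triangle_ineq]) (simp add: abs_mult)
  also have "\<dots> \<le> (1 - l) * e + l * e"
    using assms(4,5) l by (intro add_mono mult_left_mono) auto
  finally show ?thesis by (simp add: algebra_simps)
qed

section \<open>Central limit theorem and joint convergence\<close>

text \<open>
  Hence expectations of functionals of independent variables depend on the marginal laws only, and the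
  variables may be moved to another probability space.
\<close>

lemma (in prob_space) expectation_indep_eq_PiM:
  fixes X :: "'i \<Rightarrow> 'a \<Rightarrow> real" and H :: "('i \<Rightarrow> real) \<Rightarrow> real"
  assumes indep: "indep_vars (\<lambda>_. borel) X I" and "I \<noteq> {}"
    and H: "H \<in> borel_measurable (\<Pi>\<^sub>M i\<in>I. borel)" "\<And>w. H (restrict w I) = H w"
  shows "expectation (\<lambda>\<omega>. H (\<lambda>i. X i \<omega>)) = (\<integral>w. H w \<partial>(\<Pi>\<^sub>M i\<in>I. distr M borel (X i)))"
proof -
  have rv: "random_variable borel (X i)" if "i \<in> I" for i
    using indep that by (auto simp: indep_vars_def)
  have "distr M (\<Pi>\<^sub>M i\<in>I. borel) (\<lambda>\<omega>. \<lambda>i\<in>I. X i \<omega>) = (\<Pi>\<^sub>M i\<in>I. distr M borel (X i))"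
    using indep_vars_iff_distr_eq_PiM'[where X = X and I = I and M' = "\<lambda>_. borel"] assms(2) rv indep by blast
  then have "(\<integral>w. H w \<partial>(\<Pi>\<^sub>M i\<in>I. distr M borel (X i))) =
      (\<integral>w. H w \<partial>distr M (\<Pi>\<^sub>M i\<in>I. borel) (\<lambda>\<omega>. \<lambda>i\<in>I. X i \<omega>))" by simp
  also have "\<dots> = expectation (\<lambda>\<omega>. H (\<lambda>i\<in>I. X i \<omega>))"
    using rv H(1) by (intro integral_distr measurable_restrict) auto
  finally show ?thesis using H(2) by simp
qed

lemma indep_vars_PiM_coordinates:
  assumes "\<And>i. i \<in> I \<Longrightarrow> prob_space (\<Omega> i)" "I \<noteq> {}"
    and Y: "\<And>i. i \<in> I \<Longrightarrow> Y i \<in> borel_measurable (\<Omega> i)"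
  shows "prob_space.indep_vars (\<Pi>\<^sub>M i\<in>I. \<Omega> i) (\<lambda>_. borel) (\<lambda>i \<omega>. Y i (\<omega> i)) I"
    and "i \<in> I \<Longrightarrow> distr (\<Pi>\<^sub>M i\<in>I. \<Omega> i) borel (\<lambda>\<omega>. Y i (\<omega> i)) = distr (\<Omega> i) borel (Y i)"
proof -
  interpret P: prob_space "\<Pi>\<^sub>M i\<in>I. \<Omega> i" by (rule prob_space_PiM) fact
  have component: "distr (\<Pi>\<^sub>M i\<in>I. \<Omega> i) (\<Omega> i) (\<lambda>\<omega>. \<omega> i) = \<Omega> i" if "i \<in> I" for i
    using assms(1) that by (intro distr_PiM_component) auto
  have "distr (\<Pi>\<^sub>M i\<in>I. \<Omega> i) (\<Pi>\<^sub>M i\<in>I. \<Omega> i) (\<lambda>\<omega>. \<lambda>i\<in>I. \<omega> i) = distr (\<Pi>\<^sub>M i\<in>I. \<Omega> i) (\<Pi>\<^sub>M i\<in>I. \<Omega> i) (\<lambda>\<omega>. \<omega>)"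
    by (intro distr_cong) (auto simp: space_PiM PiE_def extensional_restrict)
  also have "\<dots> = (\<Pi>\<^sub>M i\<in>I. distr (\<Pi>\<^sub>M i\<in>I. \<Omega> i) (\<Omega> i) (\<lambda>\<omega>. \<omega> i))"
    by (subst distr_id2) (auto intro!: PiM_cong simp: component)
  finally have "P.indep_vars \<Omega> (\<lambda>i \<omega>. \<omega> i) I"
    by (subst P.indep_vars_iff_distr_eq_PiM') (use assms(2) in auto)
  then show "P.indep_vars (\<lambda>_. borel) (\<lambda>i \<omega>. Y i (\<omega> i)) I"
    by (rule P.indep_vars_compose2) (rule Y)
  assume i: "i \<in> I"
  have "distr (\<Omega> i) borel (Y i) = distr (distr (\<Pi>\<^sub>M i\<in>I. \<Omega> i) (\<Omega> i) (\<lambda>\<omega>. \<omega> i)) borel (Y i)"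
    using component[OF i] by simp
  also have "\<dots> = distr (\<Pi>\<^sub>M i\<in>I. \<Omega> i) borel (\<lambda>\<omega>. Y i (\<omega> i))"
    using i Y by (subst distr_distr) (auto simp: comp_def)
  finally show "distr (\<Pi>\<^sub>M i\<in>I. \<Omega> i) borel (\<lambda>\<omega>. Y i (\<omega> i)) = distr (\<Omega> i) borel (Y i)" ..
qed

text \<open>
  Skorohod's representation, applied to each coordinate, gives variables with the same marginal laws that
  converge pointwise. On the product of the representing spaces they are independent across coordinates,
  so they have the right joint laws, and dominated convergence applies.
\<close>

lemma joint_weak_convergence:
  fixes W :: "nat \<Rightarrow> 'i \<Rightarrow> 'a \<Rightarrow> real" and Z :: "'i \<Rightarrow> 'b \<Rightarrow> real" and H :: "('i \<Rightarrow> real) \<Rightarrow> real"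
  assumes "prob_space M" "prob_space N"
    and indepW: "\<And>k. prob_space.indep_vars M (\<lambda>_. borel) (W k) I"
    and indepZ: "prob_space.indep_vars N (\<lambda>_. borel) Z I"
    and conv: "\<And>i. i \<in> I \<Longrightarrow> weak_conv_m (\<lambda>k. distr M borel (W k i)) (distr N borel (Z i))"
    and H: "H \<in> borel_measurable (\<Pi>\<^sub>M i\<in>I. borel)" "\<And>w. H (restrict w I) = H w" "\<And>w. \<bar>H w\<bar> \<le> b"
    and H_cont: "\<And>x w. (\<And>i. i \<in> I \<Longrightarrow> (\<lambda>k. x k i) \<longlonglongrightarrow> w i) \<Longrightarrow> (\<lambda>k. H (x k)) \<longlonglongrightarrow> H w"
  shows "(\<lambda>k. \<integral>\<omega>. H (\<lambda>i. W k i \<omega>) \<partial>M) \<longlonglongrightarrow> (\<integral>\<omega>. H (\<lambda>i. Z i \<omega>) \<partial>N)"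
proof (cases "I = {}")
  case True
  have const: "H w = H undefined" for w
    using H(2)[of w] H(2)[of undefined] True by (simp add: restrict_def)
  show ?thesis
    using assms(1,2) const[of "\<lambda>i. W _ i _"] const[of "\<lambda>i. Z i _"] by (simp add: prob_space.prob_space)
next
  case False
  interpret M: prob_space M by fact
  interpret N: prob_space N by fact
  have W: "W k i \<in> borel_measurable M" if "i \<in> I" for i k
    using indepW[of k] that unfolding M.indep_vars_def by auto
  have Z: "Z i \<in> borel_measurable N" if "i \<in> I" for i
    using indepZ that unfolding N.indep_vars_def by auto
  \<comment> \<open>Skorohod representations of the i-th coordinate.\<close>
  define coupled where "coupled i \<Omega> Y Y' \<longleftrightarrow> prob_space \<Omega> \<and> (\<forall>k. Y k \<in> borel_measurable \<Omega>) \<and>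
      Y' \<in> borel_measurable \<Omega> \<and> (\<forall>k. distr \<Omega> borel (Y k) = distr M borel (W k i)) \<and>
      distr \<Omega> borel Y' = distr N borel (Z i) \<and> (\<forall>x\<in>space \<Omega>. (\<lambda>k. Y k x) \<longlonglongrightarrow> Y' x)"
    for i and \<Omega> :: "real measure" and Y :: "nat \<Rightarrow> real \<Rightarrow> real" and Y' :: "real \<Rightarrow> real"
  have "\<exists>\<Omega> Y Y'. coupled i \<Omega> Y Y'" if i: "i \<in> I" for i
  proof -
    have rd: "real_distribution (distr M borel (W k i))" "real_distribution (distr N borel (Z i))" for k
      using W[OF i] Z[OF i] by (auto intro: M.real_distribution_distr N.real_distribution_distr)
    obtain \<Omega> :: "real measure" and Y Y' where *: "prob_space \<Omega>" "\<forall>k. Y k \<in> borel_measurable \<Omega>"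
      "\<forall>k. distr \<Omega> borel (Y k) = distr M borel (W k i)" "Y' \<in> \<Omega> \<rightarrow>\<^sub>M lborel"
      "distr \<Omega> borel Y' = distr N borel (Z i)" "\<forall>x\<in>space \<Omega>. (\<lambda>k. Y k x) \<longlonglongrightarrow> Y' x"
      using Skorohod[OF rd conv[OF i]] by blast
    moreover have "Y' \<in> borel_measurable \<Omega>" using *(4) by simp
    ultimately have "coupled i \<Omega> Y Y'" unfolding coupled_def by blast
    then show ?thesis by blast
  qed
  then obtain \<Omega> Y Y' where coupled: "\<And>i. i \<in> I \<Longrightarrow> coupled i (\<Omega> i) (Y i) (Y' i)" by metis
  have prob: "prob_space (\<Omega> i)" and Y: "Y i k \<in> borel_measurable (\<Omega> i)" "Y' i \<in> borel_measurable (\<Omega> i)"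
    and laws: "distr (\<Omega> i) borel (Y i k) = distr M borel (W k i)" "distr (\<Omega> i) borel (Y' i) = distr N borel (Z i)"
    and lim: "x \<in> space (\<Omega> i) \<Longrightarrow> (\<lambda>k. Y i k x) \<longlonglongrightarrow> Y' i x" if "i \<in> I" for i k x
    using coupled[OF that] unfolding coupled_def by auto
  let ?P = "\<Pi>\<^sub>M i\<in>I. \<Omega> i"
  interpret P: prob_space ?P by (rule prob_space_PiM) (rule prob)
  have law_P: "distr ?P borel (\<lambda>\<omega>. Y i k (\<omega> i)) = distr M borel (W k i)"
    "distr ?P borel (\<lambda>\<omega>. Y' i (\<omega> i)) = distr N borel (Z i)" if "i \<in> I" for i k
    using indep_vars_PiM_coordinates(2)[OF prob False, where Y = "\<lambda>i. Y i k" and i = i]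
      indep_vars_PiM_coordinates(2)[OF prob False, where Y = Y' and i = i] Y laws that by auto
  note indepY = indep_vars_PiM_coordinates[OF prob False Y(1)] indep_vars_PiM_coordinates[OF prob False Y(2)]
  have eqW: "(\<integral>\<omega>. H (\<lambda>i. W k i \<omega>) \<partial>M) = (\<integral>\<omega>. H (\<lambda>i. Y i k (\<omega> i)) \<partial>?P)" for k
  proof -
    have "(\<integral>\<omega>. H (\<lambda>i. W k i \<omega>) \<partial>M) = (\<integral>w. H w \<partial>(\<Pi>\<^sub>M i\<in>I. distr M borel (\<lambda>\<omega>. W k i \<omega>)))"
      by (rule M.expectation_indep_eq_PiM[OF indepW False H(1,2)])
    also have "(\<Pi>\<^sub>M i\<in>I. distr M borel (\<lambda>\<omega>. W k i \<omega>)) = (\<Pi>\<^sub>M i\<in>I. distr ?P borel (\<lambda>\<omega>. Y i k (\<omega> i)))"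
      by (intro PiM_cong) (simp_all add: law_P)
    also have "(\<integral>w. H w \<partial>\<dots>) = (\<integral>\<omega>. H (\<lambda>i. Y i k (\<omega> i)) \<partial>?P)"
      by (rule P.expectation_indep_eq_PiM[OF indepY(1) False H(1,2), symmetric])
    finally show ?thesis .
  qed
  have eqZ: "(\<integral>\<omega>. H (\<lambda>i. Z i \<omega>) \<partial>N) = (\<integral>\<omega>. H (\<lambda>i. Y' i (\<omega> i)) \<partial>?P)"
  proof -
    have "(\<integral>\<omega>. H (\<lambda>i. Z i \<omega>) \<partial>N) = (\<integral>w. H w \<partial>(\<Pi>\<^sub>M i\<in>I. distr N borel (\<lambda>\<omega>. Z i \<omega>)))"
      by (rule N.expectation_indep_eq_PiM[OF indepZ False H(1,2)])
    also have "(\<Pi>\<^sub>M i\<in>I. distr N borel (\<lambda>\<omega>. Z i \<omega>)) = (\<Pi>\<^sub>M i\<in>I. distr ?P borel (\<lambda>\<omega>. Y' i (\<omega> i)))"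
      by (intro PiM_cong) (simp_all add: law_P)
    also have "(\<integral>w. H w \<partial>\<dots>) = (\<integral>\<omega>. H (\<lambda>i. Y' i (\<omega> i)) \<partial>?P)"
      by (rule P.expectation_indep_eq_PiM[OF indepY(3) False H(1,2), symmetric])
    finally show ?thesis .
  qed
  have meas: "(\<lambda>\<omega>. H (\<lambda>i. V i (\<omega> i))) \<in> borel_measurable ?P"
    if "\<And>i. i \<in> I \<Longrightarrow> V i \<in> borel_measurable (\<Omega> i)" for V :: "'i \<Rightarrow> real \<Rightarrow> real"
  proof -
    have "(\<lambda>\<omega>. \<lambda>i\<in>I. V i (\<omega> i)) \<in> ?P \<rightarrow>\<^sub>M (\<Pi>\<^sub>M i\<in>I. borel)"
    proof (rule measurable_restrict)
      fix i assume i: "i \<in> I"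
      have "(\<lambda>\<omega>. \<omega> i) \<in> ?P \<rightarrow>\<^sub>M \<Omega> i" using i by (rule measurable_component_singleton)
      from measurable_compose[OF this that[OF i]] show "(\<lambda>\<omega>. V i (\<omega> i)) \<in> borel_measurable ?P" .
    qed
    from measurable_compose[OF this H(1)] show ?thesis by (simp add: H(2))
  qed
  show ?thesis
    unfolding eqW eqZ
  proof (rule integral_dominated_convergence[where w = "\<lambda>_. b"])
    show "AE \<omega> in ?P. (\<lambda>k. H (\<lambda>i. Y i k (\<omega> i))) \<longlonglongrightarrow> H (\<lambda>i. Y' i (\<omega> i))"
      by (intro AE_I2 H_cont lim) (auto simp: space_PiM)
  qed (use H(3) meas Y in auto)
qed

text \<open>
  Factors of modulus at most 1 can be exchanged one by one, and the errors add.
\<close>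

lemma prod_char_approx:
  fixes c :: "'i \<Rightarrow> real" and \<phi> :: "real \<Rightarrow> complex"
  assumes "finite I" "\<And>t. cmod (\<phi> t) \<le> 1" "q \<ge> 0"
    and approx: "\<And>n. n \<in> I \<Longrightarrow> cmod (\<phi> (c n) - complex_of_real (exp (- q * (c n)\<^sup>2))) \<le> \<epsilon> * (c n)\<^sup>2"
  shows "cmod ((\<Prod>n\<in>I. \<phi> (c n)) - complex_of_real (exp (- q * (\<Sum>n\<in>I. (c n)\<^sup>2)))) \<le> \<epsilon> * (\<Sum>n\<in>I. (c n)\<^sup>2)"
proof -
  have "complex_of_real (exp (- q * (\<Sum>n\<in>I. (c n)\<^sup>2))) = (\<Prod>n\<in>I. complex_of_real (exp (- q * (c n)\<^sup>2)))"
    using assms(1) by (simp add: sum_distrib_left exp_sum flip: sum_negf)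
  also have "cmod ((\<Prod>n\<in>I. \<phi> (c n)) - \<dots>) \<le> (\<Sum>n\<in>I. cmod (\<phi> (c n) - complex_of_real (exp (- q * (c n)\<^sup>2))))"
    by (rule norm_prod_diff) (use assms(2,3) in auto)
  also have "\<dots> \<le> (\<Sum>n\<in>I. \<epsilon> * (c n)\<^sup>2)" by (intro sum_mono approx)
  finally show ?thesis by (simp add: sum_distrib_left)
qed

lemma exp_minus_linear_le:
  fixes y :: real
  assumes "y \<ge> 0"
  shows "\<bar>exp (- y) - (1 - y)\<bar> \<le> y\<^sup>2"
proof -
  have "1 - y \<le> exp (- y)" using exp_ge_add_one_self[of "- y"] by simp
  moreover have "exp (- y) \<le> 1 - y + y\<^sup>2" using exp_le_quadratic[of "- y"] assms by simp
  ultimately show ?thesis by simp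
qed

context iid_coefficients
begin

text \<open>
  The integral tends to 0 with \<open>\<delta>\<close> by dominated convergence, so this is the second-order expansion with an
  error, relative to \<open>t\<^sup>2\<close>, that is uniform over \<open>\<bar>t\<bar> \<le> \<delta>\<close>.
\<close>

lemma char_D_approx:
  assumes "\<bar>t\<bar> \<le> \<delta>"
  shows "cmod (char D t - complex_of_real (exp (- (\<sigma>\<^sup>2 / 2) * t\<^sup>2))) \<le>
    ((\<integral>x. min (6 * x\<^sup>2) (\<delta> * \<bar>x\<bar> ^ 3) \<partial>D) / 6 + \<sigma> ^ 4 * \<delta>\<^sup>2 / 4) * t\<^sup>2"
proof -
  have int: "integrable D (\<lambda>x. min (6 * x\<^sup>2) (d * \<bar>x\<bar> ^ 3))" if "d \<ge> 0" for d
    using that by (intro Bochner_Integration.integrable_bound[OF integrable_mult_right[OF square_integrable, of 6]]) auto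
  have t2: "t\<^sup>2 \<le> \<delta>\<^sup>2" using assms by (metis abs_ge_zero power2_abs power_mono)
  have "cmod (char D t - complex_of_real (1 - t\<^sup>2 * \<sigma>\<^sup>2 / 2)) \<le>
      t\<^sup>2 / 6 * (\<integral>x. min (6 * x\<^sup>2) (\<bar>t\<bar> * \<bar>x\<bar> ^ 3) \<partial>D)"
    by (rule D.char_approx3) (use square_integrable mean_zero variance in auto)
  also have "\<dots> \<le> t\<^sup>2 / 6 * (\<integral>x. min (6 * x\<^sup>2) (\<delta> * \<bar>x\<bar> ^ 3) \<partial>D)"
    using assms by (intro mult_left_mono integral_mono int min.mono order_refl mult_right_mono) auto
  finally have 1: "cmod (char D t - complex_of_real (1 - t\<^sup>2 * \<sigma>\<^sup>2 / 2)) \<le>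
      t\<^sup>2 / 6 * (\<integral>x. min (6 * x\<^sup>2) (\<delta> * \<bar>x\<bar> ^ 3) \<partial>D)" .
  have "cmod (complex_of_real (1 - t\<^sup>2 * \<sigma>\<^sup>2 / 2) - complex_of_real (exp (- (\<sigma>\<^sup>2 / 2) * t\<^sup>2))) =
      \<bar>exp (- (\<sigma>\<^sup>2 / 2 * t\<^sup>2)) - (1 - \<sigma>\<^sup>2 / 2 * t\<^sup>2)\<bar>"
    by (simp only: of_real_diff[symmetric] norm_of_real) (simp add: abs_minus_commute mult_ac)
  also have "\<dots> \<le> (\<sigma>\<^sup>2 / 2 * t\<^sup>2)\<^sup>2" by (rule exp_minus_linear_le) simp
  also have "\<dots> = \<sigma> ^ 4 / 4 * t\<^sup>2 * t\<^sup>2" by (simp add: power2_eq_square power4_eq_xxxx)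
  also have "\<dots> \<le> \<sigma> ^ 4 / 4 * \<delta>\<^sup>2 * t\<^sup>2" using t2 by (intro mult_right_mono mult_left_mono) auto
  finally have 2: "cmod (complex_of_real (1 - t\<^sup>2 * \<sigma>\<^sup>2 / 2) - complex_of_real (exp (- (\<sigma>\<^sup>2 / 2) * t\<^sup>2))) \<le>
      \<sigma> ^ 4 / 4 * \<delta>\<^sup>2 * t\<^sup>2" .
  show ?thesis
    using norm_triangle_mono[OF 1 2] by (simp add: algebra_simps)
qed

text \<open>
  A central limit theorem for weighted sums of identically distributed variables. Uniform
  smallness of the weights plays the part of the Lindeberg condition, since all factors are values
  near 0 of one characteristic function.
\<close>

lemma char_weighted_sum_tendsto:
  fixes I :: "nat \<Rightarrow> nat set" and c :: "nat \<Rightarrow> nat \<Rightarrow> real"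
  assumes I: "\<And>k. finite (I k)" "\<And>k. I k \<subseteq> {1..}"
    and small: "\<And>k n. n \<in> I k \<Longrightarrow> \<bar>c k n\<bar> \<le> e k" "e \<longlonglongrightarrow> 0" "\<And>k. e k \<ge> 0"
    and V: "(\<lambda>k. \<Sum>n\<in>I k. (c k n)\<^sup>2) \<longlonglongrightarrow> V"
  shows "(\<lambda>k. char (distr M borel (\<lambda>\<omega>. \<Sum>n\<in>I k. c k n * \<eta> n \<omega>)) \<theta>) \<longlonglongrightarrow>
    complex_of_real (exp (- (\<sigma>\<^sup>2 / 2) * (\<theta>\<^sup>2 * V)))"
proof -
  define g where "g k = (\<integral>x. min (6 * x\<^sup>2) (e k * \<bar>\<theta>\<bar> * \<bar>x\<bar> ^ 3) \<partial>D) / 6 + \<sigma> ^ 4 * (e k * \<bar>\<theta>\<bar>)\<^sup>2 / 4" for k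
  define S where "S k = (\<Sum>n\<in>I k. (\<theta> * c k n)\<^sup>2)" for k
  have S: "S \<longlonglongrightarrow> \<theta>\<^sup>2 * V"
    unfolding S_def power_mult_distrib sum_distrib_left[symmetric] by (intro tendsto_intros V)
  have "(\<lambda>k. \<integral>x. min (6 * x\<^sup>2) (e k * \<bar>\<theta>\<bar> * \<bar>x\<bar> ^ 3) \<partial>D) \<longlonglongrightarrow> (\<integral>x. 0 \<partial>D)"
  proof (rule integral_dominated_convergence[where w = "\<lambda>x. 6 * x\<^sup>2"])
    show "AE x in D. (\<lambda>k. min (6 * x\<^sup>2) (e k * \<bar>\<theta>\<bar> * \<bar>x\<bar> ^ 3)) \<longlonglongrightarrow> 0"
    proof (rule AE_I2)
      fix x
      have "(\<lambda>k. min (6 * x\<^sup>2) (e k * \<bar>\<theta>\<bar> * \<bar>x\<bar> ^ 3)) \<longlonglongrightarrow> min (6 * x\<^sup>2) (0 * \<bar>\<theta>\<bar> * \<bar>x\<bar> ^ 3)"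
        by (intro tendsto_intros small(2))
      also have "min (6 * x\<^sup>2) (0 * \<bar>\<theta>\<bar> * \<bar>x\<bar> ^ 3) = 0" by simp
      finally show "(\<lambda>k. min (6 * x\<^sup>2) (e k * \<bar>\<theta>\<bar> * \<bar>x\<bar> ^ 3)) \<longlonglongrightarrow> 0" .
    qed
  qed (use square_integrable small(3) in auto)
  then have "g \<longlonglongrightarrow> 0 / 6 + \<sigma> ^ 4 * (0 * \<bar>\<theta>\<bar>)\<^sup>2 / 4"
    unfolding g_def by (intro tendsto_intros small(2)) auto
  then have "(\<lambda>k. g k * S k) \<longlonglongrightarrow> 0 * (\<theta>\<^sup>2 * V)" by (intro tendsto_mult S) simp
  then have error: "(\<lambda>k. g k * S k) \<longlonglongrightarrow> 0" by simp
  have char_eq: "char (distr M borel (\<lambda>\<omega>. \<Sum>n\<in>I k. c k n * \<eta> n \<omega>)) \<theta> = (\<Prod>n\<in>I k. char D (\<theta> * c k n))" for k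
  proof -
    have "indep_vars (\<lambda>_. borel) (\<lambda>n \<omega>. c k n * \<eta> n \<omega>) (I k)"
      by (rule indep_vars_compose2[where Y = "\<lambda>n x. c k n * x", OF indep_vars_subset[OF indep I(2)]]) auto
    then have "char (distr M borel (\<lambda>\<omega>. \<Sum>n\<in>I k. c k n * \<eta> n \<omega>)) \<theta> =
        (\<Prod>n\<in>I k. char (distr M borel (\<lambda>\<omega>. c k n * \<eta> n \<omega>)) \<theta>)"
      by (rule char_distr_sum)
    also have "\<dots> = (\<Prod>n\<in>I k. char D (\<theta> * c k n))"
    proof (rule prod.cong[OF refl])
      fix n assume "n \<in> I k"
      then have n: "n \<ge> 1" using I(2) by auto
      have "char (distr M borel (\<lambda>\<omega>. c k n * \<eta> n \<omega>)) \<theta> = (CLINT \<omega>|M. iexp (\<theta> * (c k n * \<eta> n \<omega>)))"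
        unfolding char_def using n by (subst integral_distr) auto
      also have "\<dots> = char (distr M borel (\<eta> n)) (\<theta> * c k n)"
        unfolding char_def using n by (subst integral_distr) (auto simp: mult.assoc)
      finally show "char (distr M borel (\<lambda>\<omega>. c k n * \<eta> n \<omega>)) \<theta> = char D (\<theta> * c k n)"
        using law[OF n] by simp
    qed
    finally show ?thesis .
  qed
  have "cmod ((\<Prod>n\<in>I k. char D (\<theta> * c k n)) - complex_of_real (exp (- (\<sigma>\<^sup>2 / 2) * S k))) \<le> g k * S k" for k
    unfolding S_def
  proof (rule prod_char_approx[OF I(1)])
    fix n assume "n \<in> I k"
    then have "\<bar>\<theta> * c k n\<bar> \<le> e k * \<bar>\<theta>\<bar>"
      using small(1) by (simp add: abs_mult mult.commute mult_left_mono)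
    from char_D_approx[OF this]
    show "cmod (char D (\<theta> * c k n) - complex_of_real (exp (- (\<sigma>\<^sup>2 / 2) * (\<theta> * c k n)\<^sup>2))) \<le> g k * (\<theta> * c k n)\<^sup>2"
      unfolding g_def .
  qed (auto simp: D.cmod_char_le_1)
  then have "(\<lambda>k. (\<Prod>n\<in>I k. char D (\<theta> * c k n)) - complex_of_real (exp (- (\<sigma>\<^sup>2 / 2) * S k))) \<longlonglongrightarrow> 0"
    by (intro Lim_null_comparison[OF _ error]) auto
  moreover have "(\<lambda>k. complex_of_real (exp (- (\<sigma>\<^sup>2 / 2) * S k))) \<longlonglongrightarrow>
      complex_of_real (exp (- (\<sigma>\<^sup>2 / 2) * (\<theta>\<^sup>2 * V)))"
    by (intro tendsto_intros S)
  ultimately show ?thesis unfolding char_eq using tendsto_add[of "\<lambda>k. (\<Prod>n\<in>I k. char D (\<theta> * c k n)) - complex_of_real (exp (- (\<sigma>\<^sup>2 / 2) * S k))"]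
    by (fastforce simp del: mult_minus_left of_real_exp exp_of_real)
qed

end

text \<open>
  The limit law of the block sums, in the form delivered by the central limit theorem.
\<close>

lemma char_brownian_increment:
  assumes "standard_brownian_motion N B" "0 \<le> r" "r < t"
  shows "char (distr N borel (\<lambda>\<omega>. \<sigma> * (B t \<omega> - B r \<omega>))) \<theta> =
    complex_of_real (exp (- (\<sigma>\<^sup>2 / 2) * (\<theta>\<^sup>2 * (t - r))))"
proof -
  interpret N: prob_space N using assms(1) by (simp add: standard_brownian_motion_def)
  define h where "h = sqrt (t - r)"
  have h: "h > 0" "h\<^sup>2 = t - r" using assms by (simp_all add: h_def)
  have B[measurable]: "B t \<in> borel_measurable N" "B r \<in> borel_measurable N"
    using assms by (auto simp: standard_brownian_motion_def)
  have "distributed N lborel (\<lambda>\<omega>. B t \<omega> - B r \<omega>) (normal_density 0 h)"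
    using assms by (auto simp: standard_brownian_motion_def h_def)
  then have "distributed N lborel (\<lambda>\<omega>. (B t \<omega> - B r \<omega>) / h) std_normal_density"
    using N.normal_standard_normal_convert[OF h(1), of "\<lambda>\<omega>. B t \<omega> - B r \<omega>" 0] by simp
  then have "distr N lborel (\<lambda>\<omega>. (B t \<omega> - B r \<omega>) / h) = std_normal_distribution"
    by (rule distributed_distr_eq_density)
  moreover have "distr N lborel (\<lambda>\<omega>. (B t \<omega> - B r \<omega>) / h) = distr N borel (\<lambda>\<omega>. (B t \<omega> - B r \<omega>) / h)"
    by (rule distr_cong) auto
  ultimately have law: "distr N borel (\<lambda>\<omega>. (B t \<omega> - B r \<omega>) / h) = std_normal_distribution" by simp
  have "char (distr N borel (\<lambda>\<omega>. \<sigma> * (B t \<omega> - B r \<omega>))) \<theta> =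
      (CLINT \<omega>|N. iexp (\<theta> * (\<sigma> * (B t \<omega> - B r \<omega>))))"
    unfolding char_def by (subst integral_distr) auto
  also have "\<dots> = (CLINT \<omega>|N. iexp ((\<theta> * \<sigma> * h) * ((B t \<omega> - B r \<omega>) / h)))"
    using h by (simp add: mult_ac)
  also have "\<dots> = char (distr N borel (\<lambda>\<omega>. (B t \<omega> - B r \<omega>) / h)) (\<theta> * \<sigma> * h)"
    unfolding char_def by (subst integral_distr) auto
  also have "\<dots> = complex_of_real (exp (- ((\<theta> * \<sigma> * h)\<^sup>2) / 2))"
    unfolding law by (simp add: char_std_normal_distribution)
  also have "- ((\<theta> * \<sigma> * h)\<^sup>2) / 2 = - (\<sigma>\<^sup>2 / 2) * (\<theta>\<^sup>2 * (t - r))"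
    by (simp add: power_mult_distrib h(2))
  finally show ?thesis .
qed

section \<open>Dyadic chaining\<close>

lemma dyadic_floor_step:
  fixes t :: real
  assumes "t \<ge> 0"
  shows "nat \<lfloor>t * 2 ^ Suc j\<rfloor> = 2 * nat \<lfloor>t * 2 ^ j\<rfloor> \<or> nat \<lfloor>t * 2 ^ Suc j\<rfloor> = Suc (2 * nat \<lfloor>t * 2 ^ j\<rfloor>)"
proof -
  define m where "m = \<lfloor>t * 2 ^ j\<rfloor>"
  have m: "m \<ge> 0" "of_int m \<le> t * 2 ^ j" "t * 2 ^ j < of_int m + 1"
    using assms unfolding m_def by auto
  have "2 * m \<le> \<lfloor>t * 2 ^ Suc j\<rfloor>" "\<lfloor>t * 2 ^ Suc j\<rfloor> < 2 * m + 2"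
    using m by (auto simp: le_floor_iff floor_less_iff)
  then have "\<lfloor>t * 2 ^ Suc j\<rfloor> = 2 * m \<or> \<lfloor>t * 2 ^ Suc j\<rfloor> = 2 * m + 1" by linarith
  then show ?thesis using m(1) unfolding m_def[symmetric] by auto
qed

text \<open>
  The dyadic approximations \<open>\<lfloor>t 2^j\<rfloor> / 2^j\<close> of \<open>t\<close> move from level \<open>j\<close> to the next by at most one
  grid step, and \<open>x\<close> is continuous.
\<close>

lemma dyadic_chaining:
  fixes x :: "real \<Rightarrow> real" and d :: "nat \<Rightarrow> real" and K J :: nat
  assumes cont: "continuous_on {0..} x" and d: "summable d"
    and inc: "\<And>j i. J \<le> j \<Longrightarrow> i < K * 2 ^ j \<Longrightarrow> \<bar>x (real (Suc i) / 2 ^ j) - x (real i / 2 ^ j)\<bar> \<le> d j"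
    and i: "i < K * 2 ^ J" and t: "real i / 2 ^ J \<le> t" "t \<le> real (Suc i) / 2 ^ J"
  shows "\<bar>x t - x (real i / 2 ^ J)\<bar> \<le> (\<Sum>j. d (j + J))" "\<bar>x t - x (real (Suc i) / 2 ^ J)\<bar> \<le> (\<Sum>j. d (j + J))"
proof -
  have K: "K > 0" using i by (cases K) auto
  have d_nonneg: "d (j + J) \<ge> 0" for j
  proof -
    have "\<bar>x (real (Suc 0) / 2 ^ (j + J)) - x (real 0 / 2 ^ (j + J))\<bar> \<le> d (j + J)"
      using K by (intro inc) auto
    then show ?thesis by (rule order_trans[OF abs_ge_zero])
  qed
  have dJ: "summable (\<lambda>j. d (j + J))" using d by (subst summable_iff_shift)
  have split: "(\<Sum>j. d (j + J)) = (\<Sum>j. d (Suc j + J)) + d J"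
    using suminf_split_head[OF dJ] by simp
  have dSJ: "summable (\<lambda>j. d (Suc j + J))" using dJ by (subst summable_Suc_iff[of "\<lambda>j. d (j + J)"])
  have dS_nonneg: "0 \<le> d (Suc j + J)" for j by (rule d_nonneg)
  have dSJ_nonneg: "(\<Sum>j. d (Suc j + J)) \<ge> 0"
    using dS_nonneg by (rule suminf_nonneg[OF dSJ])
  \<comment> \<open>The right end point of the cell is treated apart: its dyadic approximations do not start at i.\<close>
  have both: "\<bar>x t - x (real i / 2 ^ J)\<bar> \<le> (\<Sum>j. d (j + J)) \<and> \<bar>x t - x (real (Suc i) / 2 ^ J)\<bar> \<le> (\<Sum>j. d (j + J))"
  proof (cases "t = real (Suc i) / 2 ^ J")
    case True
    then show ?thesis
      using inc[OF order_refl i] dSJ_nonneg d_nonneg[of 0] unfolding split True add_0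
      by (intro conjI) linarith+
  next
    case False
    then have t': "t < real (Suc i) / 2 ^ J" using t by simp
    have t0: "t \<ge> 0" using t(1) by (rule order_trans[rotated]) simp
    have "real (Suc i) \<le> real (K * 2 ^ J)" using i by (subst of_nat_le_iff) simp
    then have tK: "t < real K"
      using t' by (simp add: less_le_trans pos_divide_le_eq del: of_nat_Suc)
    define m where "m n = nat \<lfloor>t * 2 ^ (n + J)\<rfloor>" for n
    have m: "real (m n) \<le> t * 2 ^ (n + J)" "t * 2 ^ (n + J) < real (m n) + 1" for n
    proof -
      have "real (m n) = of_int \<lfloor>t * 2 ^ (n + J)\<rfloor>" using t0 by (simp add: m_def)
      then show "real (m n) \<le> t * 2 ^ (n + J)" "t * 2 ^ (n + J) < real (m n) + 1" by linarith+
    qed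
    define y where "y n = x (real (m n) / 2 ^ (n + J))" for n
    have "m 0 = i"
    proof -
      have "real i \<le> t * 2 ^ J" "t * 2 ^ J < real i + 1"
        using t(1) t' by (auto simp: pos_divide_le_eq pos_less_divide_eq)
      then have "\<lfloor>t * 2 ^ J\<rfloor> = int i" by (intro floor_unique) auto
      then show ?thesis by (simp add: m_def)
    qed
    then have y0: "y 0 = x (real i / 2 ^ J)" by (simp add: y_def)
    have step: "\<bar>y (Suc n) - y n\<bar> \<le> d (Suc n + J)" for n
    proof -
      have same: "real (2 * m n) / 2 ^ (Suc n + J) = real (m n) / 2 ^ (n + J)" by simp
      from dyadic_floor_step[OF t0, of "n + J"]
      have "m (Suc n) = 2 * m n \<or> m (Suc n) = Suc (2 * m n)" by (simp add: m_def)
      then show ?thesis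
      proof
        assume "m (Suc n) = 2 * m n"
        then show ?thesis unfolding y_def using same d_nonneg[of "Suc n"] by simp
      next
        assume *: "m (Suc n) = Suc (2 * m n)"
        have "real (m n) < real (K * 2 ^ (n + J))"
        proof -
          have "t * 2 ^ (n + J) < real K * 2 ^ (n + J)" by (intro mult_strict_right_mono tK) simp
          with m(1)[of n] have "real (m n) < real K * 2 ^ (n + J)" by (rule le_less_trans)
          then show ?thesis by simp
        qed
        then have "m n < K * 2 ^ (n + J)" by (simp only: of_nat_less_iff)
        then have "2 * m n < K * 2 ^ (Suc n + J)" by simp
        then have "\<bar>x (real (Suc (2 * m n)) / 2 ^ (Suc n + J)) - x (real (2 * m n) / 2 ^ (Suc n + J))\<bar> \<le> d (Suc n + J)"
          by (intro inc) auto
        then show ?thesis unfolding y_def * same .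
      qed
    qed
    have partial: "\<bar>y n - y 0\<bar> \<le> (\<Sum>j<n. d (Suc j + J))" for n
    proof (induction n)
      case (Suc n)
      then show ?case using step[of n] by simp
    qed simp
    have "\<bar>y n - y 0\<bar> \<le> (\<Sum>j. d (Suc j + J))" for n
      using dS_nonneg by (intro order_trans[OF partial sum_le_suminf[OF dSJ]]) simp_all
    moreover have y_lim: "y \<longlonglongrightarrow> x t"
    proof -
      have "(\<lambda>n. real (m n) / 2 ^ (n + J)) \<longlonglongrightarrow> t"
      proof (rule real_tendsto_sandwich)
        show "\<forall>\<^sub>F n in sequentially. t - (1/2) ^ (n + J) \<le> real (m n) / 2 ^ (n + J)"
        proof (intro always_eventually allI)
          fix n
          have "t * 2 ^ (n + J) - 1 \<le> real (m n)" using m(2)[of n] by simp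
          then have "(t * 2 ^ (n + J) - 1) / 2 ^ (n + J) \<le> real (m n) / 2 ^ (n + J)"
            by (intro divide_right_mono) auto
          moreover have "(t * 2 ^ (n + J) - 1) / 2 ^ (n + J) = t - 1 / 2 ^ (n + J)"
            by (subst diff_divide_distrib) simp
          ultimately show "t - (1/2) ^ (n + J) \<le> real (m n) / 2 ^ (n + J)"
            unfolding power_one_over by linarith
        qed
        show "\<forall>\<^sub>F n in sequentially. real (m n) / 2 ^ (n + J) \<le> t"
          using m(1) by (intro always_eventually allI) (simp add: pos_divide_le_eq)
        have "(\<lambda>n. (1/2 :: real) ^ (n + J)) \<longlonglongrightarrow> 0"
          by (rule LIMSEQ_ignore_initial_segment) (rule LIMSEQ_realpow_zero; simp)
        from tendsto_diff[OF tendsto_const this, of t]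
        show "(\<lambda>n. t - (1/2) ^ (n + J)) \<longlonglongrightarrow> t" by simp
      qed simp
      then show ?thesis
        unfolding y_def using t0
        by (intro continuous_on_tendsto_compose[OF cont]) auto
    qed
    ultimately have "\<bar>x t - y 0\<bar> \<le> (\<Sum>j. d (Suc j + J))"
      by (intro LIMSEQ_le_const2[OF tendsto_rabs[OF tendsto_diff[OF y_lim tendsto_const]]]) blast
    then show ?thesis
      using inc[OF order_refl i] d_nonneg[of 0] unfolding y0 split add_0 by (intro conjI) linarith+
  qed
  show "\<bar>x t - x (real i / 2 ^ J)\<bar> \<le> (\<Sum>j. d (j + J))"
    using both by (rule conjunct1)
  show "\<bar>x t - x (real (Suc i) / 2 ^ J)\<bar> \<le> (\<Sum>j. d (j + J))"
    using both by (rule conjunct2)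
qed

text \<open>
  Bounds the maximum of finitely many increments by a constant plus their sum of fourth powers.
\<close>

lemma abs_le_fourth_power:
  fixes x c :: real
  assumes "c > 0"
  shows "\<bar>x\<bar> \<le> c + x ^ 4 / c ^ 3"
proof (cases "\<bar>x\<bar> \<le> c")
  case True
  have "x ^ 4 / c ^ 3 \<ge> 0" using assms by simp
  with True show ?thesis by linarith
next
  case False
  then have "c ^ 3 \<le> \<bar>x\<bar> ^ 3" using assms by (intro power_mono) auto
  then have "\<bar>x\<bar> * c ^ 3 \<le> \<bar>x\<bar> * \<bar>x\<bar> ^ 3" by (intro mult_left_mono) auto
  also have "\<dots> = x ^ 4" by (simp add: power_abs[symmetric] abs_mult[symmetric] eval_nat_numeral)
  finally have "\<bar>x\<bar> \<le> x ^ 4 / c ^ 3" using assms by (simp add: pos_le_divide_eq)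
  then show ?thesis using assms by linarith
qed

text \<open>
  Level \<open>j\<close> has \<open>K 2^j\<close> increments with fourth moment at most \<open>C / 4^j\<close>. At the threshold
  \<open>c = (9/10)^j\<close> the expected sum of fourth powers divided by \<open>c^3\<close> is \<open>K C\<close> times the \<open>j\<close>-th power of
  \<open>2 * (1/4) * (10/9)^3 = 500/729\<close>. Any ratio between \<open>2 powr (-1/3)\<close> and 1 in place of \<open>9/10\<close>
  would make both geometric series converge.
\<close>

definition chaining_term :: "real \<Rightarrow> nat \<Rightarrow> nat \<Rightarrow> real" where
  "chaining_term C K j = (9/10) ^ j + real K * C * (500/729) ^ j"

lemma chaining_term_summable: "summable (chaining_term C K)"
  unfolding chaining_term_def by (intro summable_add summable_mult summable_geometric) auto

lemma chaining_term_nonneg: "C \<ge> 0 \<Longrightarrow> chaining_term C K j \<ge> 0"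
  by (simp add: chaining_term_def)

lemma chaining_tail_tendsto: "(\<lambda>J. \<Sum>j. chaining_term C K (j + J)) \<longlonglongrightarrow> 0"
proof (rule LIMSEQ_I)
  fix r :: real assume "r > 0"
  then show "\<exists>n0. \<forall>n\<ge>n0. norm ((\<Sum>j. chaining_term C K (j + n)) - 0) < r"
    using suminf_exist_split[OF \<open>r > 0\<close> chaining_term_summable[of C K]] by simp
qed

text \<open>
  Kolmogorov's continuity criterion in quantitative form: continuity of the paths is given, and the bound
  on the oscillation within the cells of level \<open>J\<close> is uniform over all processes with the same moment
  constant.
\<close>

lemma dyadic_oscillation_expectation:
  fixes X :: "real \<Rightarrow> 'a \<Rightarrow> real" and C :: real and K :: nat
  assumes meas: "\<And>t. t \<ge> 0 \<Longrightarrow> X t \<in> borel_measurable M" and "prob_space M"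
    and cont: "AE \<omega> in M. continuous_on {0..} (\<lambda>t. X t \<omega>)" and "C \<ge> 0"
    and moment: "\<And>r t. 0 \<le> r \<Longrightarrow> r \<le> t \<Longrightarrow> (\<integral>\<^sup>+\<omega>. ennreal ((X t \<omega> - X r \<omega>) ^ 4) \<partial>M) \<le> ennreal (C * (t - r)\<^sup>2)"
  obtains G where "G \<in> borel_measurable M" "\<And>\<omega>. G \<omega> \<ge> 0"
    "(\<integral>\<^sup>+\<omega>. ennreal (G \<omega>) \<partial>M) \<le> ennreal (\<Sum>j. chaining_term C K (j + J))"
    "AE \<omega> in M. \<forall>i<K * 2 ^ J. \<forall>t\<in>{real i / 2 ^ J..real (Suc i) / 2 ^ J}.
      \<bar>X t \<omega> - X (real i / 2 ^ J) \<omega>\<bar> \<le> G \<omega> \<and> \<bar>X t \<omega> - X (real (Suc i) / 2 ^ J) \<omega>\<bar> \<le> G \<omega>"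
proof
  interpret prob_space M by fact
  define q :: real where "q = 9/10"
  have q: "q > 0" by (simp add: q_def)
  define \<Delta> where "\<Delta> j i \<omega> = X (real (Suc i) / 2 ^ j) \<omega> - X (real i / 2 ^ j) \<omega>" for j i \<omega>
  define d where "d j \<omega> = q ^ j + (\<Sum>i<K * 2 ^ j. \<Delta> j i \<omega> ^ 4) / (q ^ j) ^ 3" for j \<omega>
  have \<Delta>_meas [measurable]: "\<Delta> j i \<in> borel_measurable M" for j i
    unfolding \<Delta>_def by (intro borel_measurable_diff meas) auto
  have d_meas: "d j \<in> borel_measurable M" for j unfolding d_def[abs_def] by measurable
  have d_nonneg: "d j \<omega> \<ge> 0" for j \<omega>
    unfolding d_def using q by (auto intro!: add_nonneg_nonneg divide_nonneg_nonneg sum_nonneg)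
  have d_int: "(\<integral>\<^sup>+\<omega>. ennreal (d j \<omega>) \<partial>M) \<le> ennreal (chaining_term C K j)" for j
  proof -
    have "(\<integral>\<^sup>+\<omega>. ennreal (d j \<omega>) \<partial>M) =
        (\<integral>\<^sup>+\<omega>. ennreal (q ^ j) + (\<Sum>i<K * 2 ^ j. ennreal (\<Delta> j i \<omega> ^ 4)) * ennreal (1 / (q ^ j) ^ 3) \<partial>M)"
      using q by (intro nn_integral_cong)
        (simp add: d_def ennreal_plus sum_nonneg sum_ennreal ennreal_mult'[symmetric] del: ennreal_plus flip: ennreal_plus)
    also have "\<dots> = ennreal (q ^ j) + (\<Sum>i<K * 2 ^ j. \<integral>\<^sup>+\<omega>. ennreal (\<Delta> j i \<omega> ^ 4) \<partial>M) * ennreal (1 / (q ^ j) ^ 3)"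
      by (subst nn_integral_add, simp, simp, subst nn_integral_multc, simp, subst nn_integral_sum)
        (simp_all add: emeasure_space_1)
    also have "\<dots> \<le> ennreal (q ^ j) + (\<Sum>i<K * 2 ^ j. ennreal (C * (1 / 2 ^ j)\<^sup>2)) * ennreal (1 / (q ^ j) ^ 3)"
    proof (intro add_left_mono mult_right_mono sum_mono)
      fix i
      have "real (Suc i) / 2 ^ j - real i / 2 ^ j = 1 / 2 ^ j" by (simp add: diff_divide_distrib[symmetric])
      then show "(\<integral>\<^sup>+\<omega>. ennreal (\<Delta> j i \<omega> ^ 4) \<partial>M) \<le> ennreal (C * (1 / 2 ^ j)\<^sup>2)"
        unfolding \<Delta>_def using moment[of "real i / 2 ^ j" "real (Suc i) / 2 ^ j"]
        by (simp add: divide_right_mono)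
    qed simp
    also have "\<dots> = ennreal (q ^ j + real (K * 2 ^ j) * (C * (1 / 2 ^ j)\<^sup>2) * (1 / (q ^ j) ^ 3))"
      using q \<open>C \<ge> 0\<close> by (simp add: ennreal_mult'[symmetric] ennreal_of_nat_eq_real_of_nat flip: ennreal_plus)
    also have "q ^ j + real (K * 2 ^ j) * (C * (1 / 2 ^ j)\<^sup>2) * (1 / (q ^ j) ^ 3) = chaining_term C K j"
    proof -
      have "(500/729 :: real) = 2 * (1/2)\<^sup>2 * (1 / q ^ 3)" by (simp add: q_def power_divide)
      then have "(500/729 :: real) ^ j = 2 ^ j * ((1/2) ^ j)\<^sup>2 * (1 / (q ^ j) ^ 3)"
        by (simp only: power_mult_distrib power_one_over power_mult[symmetric] mult.commute[of j])
      then show ?thesis unfolding chaining_term_def by (simp add: q_def power_one_over)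
    qed
    finally show ?thesis .
  qed
  \<comment> \<open>The maximum with 0 only matters where the series diverges.\<close>
  define G where "G \<omega> = max 0 (\<Sum>j. d (j + J) \<omega>)" for \<omega>
  have summ: "summable (\<lambda>j. chaining_term C K (j + J))"
    using chaining_term_summable[of C K] by (subst summable_iff_shift)
  show "G \<in> borel_measurable M" unfolding G_def[abs_def] by (intro borel_measurable_max borel_measurable_suminf d_meas) auto
  show "(\<integral>\<^sup>+\<omega>. ennreal (G \<omega>) \<partial>M) \<le> ennreal (\<Sum>j. chaining_term C K (j + J))"
    unfolding G_def ennreal_max_0
    by (rule nn_integral_suminf_le(2)) (use d_meas d_nonneg d_int \<open>C \<ge> 0\<close> chaining_term_nonneg summ in auto)
  have "AE \<omega> in M. summable (\<lambda>j. d j \<omega>)"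
    by (rule nn_integral_suminf_le(1)[OF d_meas d_nonneg d_int chaining_term_nonneg[OF \<open>C \<ge> 0\<close>] chaining_term_summable])
  then show "AE \<omega> in M. \<forall>i<K * 2 ^ J. \<forall>t\<in>{real i / 2 ^ J..real (Suc i) / 2 ^ J}.
      \<bar>X t \<omega> - X (real i / 2 ^ J) \<omega>\<bar> \<le> G \<omega> \<and> \<bar>X t \<omega> - X (real (Suc i) / 2 ^ J) \<omega>\<bar> \<le> G \<omega>"
    using cont
  proof eventually_elim
    case (elim \<omega>)
    have "\<bar>X (real (Suc i) / 2 ^ j) \<omega> - X (real i / 2 ^ j) \<omega>\<bar> \<le> d j \<omega>" if "i < K * 2 ^ j" for i j
    proof -
      have "\<bar>\<Delta> j i \<omega>\<bar> \<le> q ^ j + \<Delta> j i \<omega> ^ 4 / (q ^ j) ^ 3"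
        by (rule abs_le_fourth_power) (use q in simp)
      also have "\<Delta> j i \<omega> ^ 4 \<le> (\<Sum>i<K * 2 ^ j. \<Delta> j i \<omega> ^ 4)"
        by (rule member_le_sum) (use that in auto)
      finally show ?thesis unfolding d_def \<Delta>_def using q by (simp add: divide_right_mono)
    qed
    from dyadic_chaining[OF elim(2,1) this] show ?case unfolding G_def by (auto intro: max.coboundedI2)
  qed
  show "G \<omega> \<ge> 0" for \<omega>
    by (simp add: G_def)
qed

section \<open>Weak convergence of the processes\<close>

definition prime_block :: "real \<Rightarrow> real \<Rightarrow> nat set" where
  "prime_block x y = {p. prime p \<and> x < ln (real p) \<and> ln (real p) \<le> y}"

lemma finite_prime_block: "finite (prime_block x y)"
  unfolding prime_block_def by (rule finite_subset[OF _ finite_primes_ln_le[of y]]) auto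

lemma prime_block_ge_1: "prime_block x y \<subseteq> {1..}"
  by (auto simp: prime_block_def Suc_le_eq prime_gt_0_nat)

lemma prime_block_union:
  assumes "x \<le> y" "y \<le> z"
  shows "prime_block x z = prime_block x y \<union> prime_block y z" "prime_block x y \<inter> prime_block y z = {}"
  using assms by (auto simp: prime_block_def)

text \<open>
  Up to the factor \<open>\<sigma>\<^sup>2\<close>, the sum is the variance of a block of the random series at \<open>u = 0\<close>.
\<close>

lemma prime_block_reciprocal_sum:
  assumes "1 \<le> x" "x \<le> y"
  shows "\<bar>(\<Sum>p\<in>prime_block x y. 1 / real p) - (ln y - ln x)\<bar> \<le> 6"
proof -
  have un: "{p. prime p \<and> ln (real p) \<le> y} = {p. prime p \<and> ln (real p) \<le> x} \<union> prime_block x y"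
    and disj: "{p. prime p \<and> ln (real p) \<le> x} \<inter> prime_block x y = {}"
    using assms by (auto simp: prime_block_def)
  have "(\<Sum>p | prime p \<and> ln (real p) \<le> y. 1 / real p) =
      (\<Sum>p | prime p \<and> ln (real p) \<le> x. 1 / real p) + (\<Sum>p\<in>prime_block x y. 1 / real p)"
    unfolding un by (rule sum.union_disjoint[OF finite_primes_ln_le finite_prime_block disj])
  then show ?thesis
    using prime_reciprocal_sum_bounds[of x] prime_reciprocal_sum_bounds[of y] assms
    unfolding abs_le_iff by linarith
qed

lemma linear_interpolation_cong:
  "(\<And>i. i < m \<Longrightarrow> w i = w' i) \<Longrightarrow> linear_interpolation n m w t = linear_interpolation n m w' t"
  unfolding linear_interpolation_def by (intro sum.cong) auto

lemma linear_interpolation_diff_le: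
  "\<bar>linear_interpolation n m w t - linear_interpolation n m w' t\<bar> \<le> (\<Sum>i<m. \<bar>w i - w' i\<bar>)"
proof -
  have "linear_interpolation n m w t - linear_interpolation n m w' t =
      (\<Sum>i<m. (w i - w' i) * max 0 (min 1 (real n * t - real i)))"
    unfolding linear_interpolation_def by (simp add: sum_subtractf left_diff_distrib)
  also have "\<bar>\<dots>\<bar> \<le> (\<Sum>i<m. \<bar>(w i - w' i) * max 0 (min 1 (real n * t - real i))\<bar>)"
    by (rule sum_abs)
  also have "\<dots> \<le> (\<Sum>i<m. \<bar>w i - w' i\<bar> * 1)"
    unfolding abs_mult by (intro sum_mono mult_left_mono) auto
  finally show ?thesis by simp
qed

text \<open>
  As a function of finitely many real variables, \<open>F\<close> of the interpolated path is within the scope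
  of the joint convergence of the block sums.
\<close>

definition interpolated_functional :: "(cpath \<Rightarrow> real) \<Rightarrow> nat \<Rightarrow> nat \<Rightarrow> (nat \<Rightarrow> real) \<Rightarrow> real" where
  "interpolated_functional F n m w = F (cpath_of (linear_interpolation n m w))"

lemma interpolated_functional_restrict:
  "interpolated_functional F n m (restrict w {..<m}) = interpolated_functional F n m w"
proof -
  have "linear_interpolation n m (restrict w {..<m}) = linear_interpolation n m w"
    by (intro ext linear_interpolation_cong) simp
  then show ?thesis by (simp add: interpolated_functional_def)
qed

lemma cpath_lipschitz_functional_le:
  assumes "cpath_lipschitz K F" "continuous_on {0..} x" "continuous_on {0..} y"
    and "\<And>t. t \<in> {0..K} \<Longrightarrow> \<bar>x t - y t\<bar> \<le> d"
  shows "\<bar>F (cpath_of x) - F (cpath_of y)\<bar> \<le> K * d"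
proof -
  have "\<forall>t\<in>{0..K}. \<bar>cpath_apply (cpath_of x) t - cpath_apply (cpath_of y) t\<bar> \<le> d"
    using assms by (auto simp: cpath_apply_cpath_of)
  then show ?thesis using assms(1) unfolding cpath_lipschitz_def by blast
qed

lemma interpolated_functional_measurable:
  assumes "F \<in> borel_measurable borel"
  shows "interpolated_functional F n m \<in> borel_measurable (\<Pi>\<^sub>M i\<in>{..<m}. borel)"
proof -
  have "(\<lambda>w. cpath_of (\<lambda>t. linear_interpolation n m w t)) \<in> (\<Pi>\<^sub>M i\<in>{..<m}. borel) \<rightarrow>\<^sub>M borel"
  proof (rule borel_measurable_cpath_of)
    show "(\<lambda>w. linear_interpolation n m w t) \<in> borel_measurable (\<Pi>\<^sub>M i\<in>{..<m}. borel)" for t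
      unfolding linear_interpolation_def
      by (intro borel_measurable_sum borel_measurable_times borel_measurable_const measurable_component_singleton)
  qed (rule continuous_on_linear_interpolation)
  from measurable_compose[OF this assms] show ?thesis
    by (simp add: interpolated_functional_def[abs_def])
qed

lemma interpolated_functional_tendsto:
  assumes "cpath_lipschitz K F" and "\<And>i. i \<in> {..<m} \<Longrightarrow> (\<lambda>k. x k i) \<longlonglongrightarrow> w i"
  shows "(\<lambda>k. interpolated_functional F n m (x k)) \<longlonglongrightarrow> interpolated_functional F n m w"
proof -
  have "(\<lambda>k. K * (\<Sum>i<m. \<bar>x k i - w i\<bar>)) \<longlonglongrightarrow> K * (\<Sum>i<m. \<bar>w i - w i\<bar>)"
    by (intro tendsto_intros assms(2))
  then have lim: "(\<lambda>k. K * (\<Sum>i<m. \<bar>x k i - w i\<bar>)) \<longlonglongrightarrow> 0" by simp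
  have "\<bar>interpolated_functional F n m (x k) - interpolated_functional F n m w\<bar> \<le> K * (\<Sum>i<m. \<bar>x k i - w i\<bar>)" for k
    unfolding interpolated_functional_def
    by (rule cpath_lipschitz_functional_le[OF assms(1)])
      (auto intro: continuous_on_linear_interpolation linear_interpolation_diff_le)
  then have "(\<lambda>k. interpolated_functional F n m (x k) - interpolated_functional F n m w) \<longlonglongrightarrow> 0"
    by (intro Lim_null_comparison[OF _ lim]) auto
  then show ?thesis by (simp add: LIM_zero_iff)
qed

text \<open>
  The grid extends to \<open>K + 1\<close>, so that \<open>t = K\<close> lies in a cell even for \<open>K = 0\<close>.
\<close>

lemma dyadic_cell:
  fixes t :: real and K J :: nat
  assumes "t \<in> {0..real K}"
  obtains j where "j < Suc K * 2 ^ J" "real j / 2 ^ J \<le> t" "t \<le> real (Suc j) / 2 ^ J"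
proof -
  have "t \<ge> 0" using assms by simp
  then obtain j where j: "real j / real (Suc (2 ^ J - 1)) \<le> t" "t < real (Suc j) / real (Suc (2 ^ J - 1))"
    by (rule exists_cell)
  have eq: "real (Suc (2 ^ J - 1)) = 2 ^ J" by (simp add: of_nat_diff)
  have "real j \<le> t * 2 ^ J" using j(1) unfolding eq by (simp add: pos_divide_le_eq)
  also have "\<dots> \<le> real K * 2 ^ J" using assms by (intro mult_right_mono) auto
  also have "\<dots> < real (Suc K) * 2 ^ J" by (intro mult_strict_right_mono) auto
  finally have "real j < real (Suc K * 2 ^ J)"
    by (simp only: of_nat_mult of_nat_power of_nat_numeral)
  then have "j < Suc K * 2 ^ J" by (simp only: of_nat_less_iff)
  then show ?thesis using j that[of j] unfolding eq by auto
qed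

lemma dyadic_interpolation_close:
  fixes x :: "real \<Rightarrow> real" and w :: "nat \<Rightarrow> real" and K J :: nat
  assumes "t \<in> {0..real K}"
    and close: "\<And>j t. j < Suc K * 2 ^ J \<Longrightarrow> t \<in> {real j / 2 ^ J..real (Suc j) / 2 ^ J} \<Longrightarrow>
      \<bar>x t - (\<Sum>i<j. w i)\<bar> \<le> e \<and> \<bar>x t - (\<Sum>i<Suc j. w i)\<bar> \<le> e"
  shows "\<bar>x t - linear_interpolation (2 ^ J) (Suc K * 2 ^ J) w t\<bar> \<le> e"
proof -
  obtain j where j: "j < Suc K * 2 ^ J" "real j / 2 ^ J \<le> t" "t \<le> real (Suc j) / 2 ^ J"
    by (rule dyadic_cell[OF assms(1)])
  have "real j \<le> real (2 ^ J) * t" "real (2 ^ J) * t \<le> real (Suc j)"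
    using j(2,3) by (simp_all add: pos_divide_le_eq pos_le_divide_eq mult.commute)
  moreover have "\<bar>x t - (\<Sum>i<j. w i)\<bar> \<le> e \<and> \<bar>x t - (\<Sum>i<Suc j. w i)\<bar> \<le> e"
    using j by (intro close) auto
  ultimately show ?thesis
    using j(1) by (intro linear_interpolation_close[of j]) blast+
qed

text \<open>
  Almost surely \<open>B 0 = 0\<close>, hence the partial sums of the increments are the values of the path at the grid
  points, and uniform continuity on \<open>[0, K + 1]\<close> gives uniform convergence of the interpolations.
\<close>

lemma brownian_interpolation_tendsto:
  assumes BM: "standard_brownian_motion N B" and F: "\<And>x. \<bar>F x\<bar> \<le> b" "cpath_lipschitz (real K) F"
  shows "(\<lambda>J. \<integral>\<omega>. interpolated_functional F (2 ^ J) (Suc K * 2 ^ J)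
      (\<lambda>i. \<sigma> * (B (real (Suc i) / 2 ^ J) \<omega> - B (real i / 2 ^ J) \<omega>)) \<partial>N) \<longlonglongrightarrow>
    (\<integral>\<omega>. F (cpath_of (\<lambda>t. \<sigma> * B t \<omega>)) \<partial>N)"
proof -
  interpret N: prob_space N using BM by (simp add: standard_brownian_motion_def)
  have B: "B t \<in> borel_measurable N" if "t \<ge> 0" for t
    using BM that by (simp add: standard_brownian_motion_def)
  have cont: "continuous_on {0..} (\<lambda>t. \<sigma> * B t \<omega>)" if "\<omega> \<in> space N" for \<omega>
    using BM that by (auto simp: standard_brownian_motion_def intro!: continuous_intros)
  have F_meas: "F \<in> borel_measurable borel"
    by (intro borel_measurable_continuous_onI cpath_lipschitz_imp_continuous[OF F(2)]) simp
  have pathB: "(\<lambda>\<omega>. cpath_of (\<lambda>t. \<sigma> * B t \<omega>)) \<in> N \<rightarrow>\<^sub>M borel"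
    using B cont by (intro borel_measurable_cpath_of) auto
  define w where "w J \<omega> i = \<sigma> * (B (real (Suc i) / 2 ^ J) \<omega> - B (real i / 2 ^ J) \<omega>)" for J :: nat and \<omega> and i :: nat
  have w_meas: "(\<lambda>\<omega>. w J \<omega> i) \<in> borel_measurable N" for J i
    unfolding w_def by (intro borel_measurable_times borel_measurable_diff borel_measurable_const B) auto
  have meas: "(\<lambda>\<omega>. interpolated_functional F (2 ^ J) (Suc K * 2 ^ J) (w J \<omega>)) \<in> borel_measurable N" for J
  proof -
    have "(\<lambda>\<omega>. \<lambda>i\<in>{..<Suc K * 2 ^ J}. w J \<omega> i) \<in> N \<rightarrow>\<^sub>M (\<Pi>\<^sub>M i\<in>{..<Suc K * 2 ^ J}. borel)"
      by (intro measurable_restrict w_meas)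
    from measurable_compose[OF this interpolated_functional_measurable[OF F_meas]]
    show ?thesis by (simp only: interpolated_functional_restrict)
  qed
  have "(\<lambda>J. \<integral>\<omega>. interpolated_functional F (2 ^ J) (Suc K * 2 ^ J) (w J \<omega>) \<partial>N) \<longlonglongrightarrow>
    (\<integral>\<omega>. F (cpath_of (\<lambda>t. \<sigma> * B t \<omega>)) \<partial>N)"
  proof (rule integral_dominated_convergence[where w = "\<lambda>_. b"])
    have "AE \<omega> in N. B 0 \<omega> = 0" using BM by (simp add: standard_brownian_motion_def)
    then show "AE \<omega> in N. (\<lambda>J. interpolated_functional F (2 ^ J) (Suc K * 2 ^ J) (w J \<omega>)) \<longlonglongrightarrow>
        F (cpath_of (\<lambda>t. \<sigma> * B t \<omega>))"
      using AE_space
    proof eventually_elim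
      case (elim \<omega>)
      define x where "x t = \<sigma> * B t \<omega>" for t
      have x: "continuous_on {0..} x" unfolding x_def[abs_def] using elim by (intro cont)
      have sum_w: "(\<Sum>i<j. w J \<omega> i) = x (real j / 2 ^ J)" for j J
        using elim by (induction j) (simp_all add: w_def x_def algebra_simps)
      show ?case
      proof (rule LIMSEQ_I)
        fix r :: real assume r: "r > 0"
        define e where "e = r / (real K + 1)"
        have e: "e > 0" "real K * e < r" using r by (auto simp: e_def field_simps)
        have "uniformly_continuous_on {0..real (Suc K)} x"
          by (intro compact_uniformly_continuous continuous_on_subset[OF x]) auto
        then obtain \<delta> where \<delta>: "\<delta> > 0"
          "\<And>t s. t \<in> {0..real (Suc K)} \<Longrightarrow> s \<in> {0..real (Suc K)} \<Longrightarrow> dist s t < \<delta> \<Longrightarrow> dist (x s) (x t) < e"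
          unfolding uniformly_continuous_on_def using e(1) by metis
        obtain J0 where J0: "(1/2 :: real) ^ J0 < \<delta>"
          using real_arch_pow_inv[OF \<delta>(1), of "1/2"] by auto
        have "norm (interpolated_functional F (2 ^ J) (Suc K * 2 ^ J) (w J \<omega>) - F (cpath_of x)) < r"
          if J: "J \<ge> J0" for J
        proof -
          have "(1/2 :: real) ^ J \<le> (1/2) ^ J0" using J by (intro power_decreasing) auto
          then have small: "1 / 2 ^ J < \<delta>" using J0 unfolding power_one_over by linarith
          have close: "\<bar>x t - (\<Sum>i<j. w J \<omega> i)\<bar> \<le> e \<and> \<bar>x t - (\<Sum>i<Suc j. w J \<omega> i)\<bar> \<le> e"
            if j: "j < Suc K * 2 ^ J" and t: "t \<in> {real j / 2 ^ J..real (Suc j) / 2 ^ J}" for j t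
          proof -
            have width: "real (Suc j) / 2 ^ J = real j / 2 ^ J + 1 / 2 ^ J"
              by (simp add: add_divide_distrib)
            have "real (Suc j) \<le> real (Suc K * 2 ^ J)" using j by (subst of_nat_le_iff) simp
            then have "real (Suc j) \<le> real (Suc K) * 2 ^ J"
              by (simp only: of_nat_mult of_nat_power of_nat_numeral)
            then have top: "real (Suc j) / 2 ^ J \<le> real (Suc K)"
              by (subst pos_divide_le_eq) simp_all
            have bot: "0 \<le> real j / 2 ^ J" by simp
            have "0 \<le> t" using order_trans[OF bot, of t] t by simp
            have "dist (x t) (x (real j / 2 ^ J)) < e"
              using t top bot small width \<open>0 \<le> t\<close> by (intro \<delta>(2)) (auto simp: dist_real_def simp del: of_nat_Suc)
            moreover have "dist (x t) (x (real (Suc j) / 2 ^ J)) < e"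
              using t top bot small width \<open>0 \<le> t\<close> by (intro \<delta>(2)) (auto simp: dist_real_def simp del: of_nat_Suc)
            ultimately show ?thesis unfolding sum_w dist_real_def by auto
          qed
          have "\<bar>F (cpath_of x) - F (cpath_of (linear_interpolation (2 ^ J) (Suc K * 2 ^ J) (w J \<omega>)))\<bar> \<le> real K * e"
            by (rule cpath_lipschitz_functional_le[OF F(2) x continuous_on_linear_interpolation])
              (rule dyadic_interpolation_close[OF _ close])
          then show ?thesis using e(2) unfolding interpolated_functional_def by (simp add: abs_minus_commute)
        qed
        then show "\<exists>J0. \<forall>J\<ge>J0. norm (interpolated_functional F (2 ^ J) (Suc K * 2 ^ J) (w J \<omega>) -
            F (cpath_of (\<lambda>t. \<sigma> * B t \<omega>))) < r"
          unfolding x_def[abs_def] by blast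
      qed
    qed
  qed (use F(1) meas measurable_compose[OF pathB F_meas] in \<open>auto simp: interpolated_functional_def\<close>)
  then show ?thesis unfolding w_def .
qed

context iid_coefficients
begin

definition scaled_process :: "real \<Rightarrow> real \<Rightarrow> 'a \<Rightarrow> real" where
  "scaled_process s t \<omega> = 1 / sqrt (ln (1 / s)) * prime_process \<eta> (s powr t) \<omega>"

definition block_increment :: "real \<Rightarrow> nat \<Rightarrow> nat \<Rightarrow> 'a \<Rightarrow> real" where
  "block_increment s n i \<omega> = (\<Sum>p\<in>prime_block ((1 / s) powr (real i / real n)) ((1 / s) powr (real (Suc i) / real n)).
     1 / (sqrt (real p) * sqrt (ln (1 / s))) * \<eta> p \<omega>)"

lemma scaled_process_measurable: "scaled_process s t \<in> borel_measurable M"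
  unfolding scaled_process_def[abs_def] by measurable

lemma scaled_process_continuous:
  assumes "0 < s"
  shows "continuous_on {0..} (\<lambda>t. scaled_process s t \<omega>)"
proof -
  have "continuous_on {0..} (\<lambda>t. prime_process \<eta> (s powr t) \<omega>)"
    by (rule continuous_on_compose2[OF prime_process_continuous]) (use assms in \<open>auto intro!: continuous_intros\<close>)
  then show ?thesis unfolding scaled_process_def by (intro continuous_intros)
qed

lemma scaled_process_path_measurable:
  assumes "0 < s"
  shows "(\<lambda>\<omega>. cpath_of (\<lambda>t. scaled_process s t \<omega>)) \<in> M \<rightarrow>\<^sub>M borel"
  using scaled_process_measurable scaled_process_continuous[OF assms] by (rule borel_measurable_cpath_of)

lemma block_points_mono:
  fixes s a b :: real
  assumes "0 < s" "s < 1" "a \<le> b"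
  shows "(1 / s) powr a \<le> (1 / s) powr b"
  using assms by (intro powr_mono) auto

lemma cutoff_sum_eq: "cutoff_sum y \<omega> = (\<Sum>p\<in>prime_block 1 y. \<eta> p \<omega> / sqrt (real p))"
  unfolding cutoff_sum_def prime_block_def ..

text \<open>
  At \<open>t = 0\<close> the cut-off is 1 and \<open>cutoff_sum 1\<close> is empty, which is why the primes with \<open>ln p \<le> 1\<close>
  are left out of \<open>cutoff_sum\<close>.
\<close>

lemma block_increment_sum:
  assumes s: "0 < s" "s < 1"
  shows "(\<Sum>i<j. block_increment s n i \<omega>) = cutoff_sum ((1 / s) powr (real j / real n)) \<omega> / sqrt (ln (1 / s))"
proof (induction j)
  case 0
  have "prime_block 1 1 = {}" by (auto simp: prime_block_def)
  then show ?case using s by (simp add: cutoff_sum_eq)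
next
  case (Suc j)
  let ?y = "\<lambda>j. (1 / s) powr (real j / real n)"
  have "1 \<le> ?y j" "?y j \<le> ?y (Suc j)"
    using s block_points_mono[OF s, of 0 "real j / real n"]
      block_points_mono[OF s, of "real j / real n" "real (Suc j) / real n"]
    by (auto simp: divide_right_mono)
  note un = prime_block_union[OF this]
  have "cutoff_sum (?y (Suc j)) \<omega> = cutoff_sum (?y j) \<omega> + (\<Sum>p\<in>prime_block (?y j) (?y (Suc j)). \<eta> p \<omega> / sqrt (real p))"
    unfolding cutoff_sum_eq un(1) by (rule sum.union_disjoint[OF finite_prime_block finite_prime_block un(2)])
  moreover have "block_increment s n j \<omega> =
      (\<Sum>p\<in>prime_block (?y j) (?y (Suc j)). \<eta> p \<omega> / sqrt (real p)) / sqrt (ln (1 / s))"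
    unfolding block_increment_def sum_divide_distrib by (intro sum.cong refl) simp
  ultimately show ?case using Suc by (simp add: add_divide_distrib)
qed

lemma block_increment_measurable: "block_increment s n i \<in> borel_measurable M"
  unfolding block_increment_def
  using prime_block_ge_1 by (intro borel_measurable_sum borel_measurable_times borel_measurable_const coeff_measurable) auto

text \<open>
  The blocks are pairwise disjoint sets of indices.
\<close>

lemma block_increment_indep:
  assumes s: "0 < s" "s < 1"
  shows "indep_vars (\<lambda>_. borel) (block_increment s n) I"
proof -
  define A where "A i = prime_block ((1 / s) powr (real i / real n)) ((1 / s) powr (real (Suc i) / real n))" for i
  define g where "g i f = (\<Sum>p\<in>A i. 1 / (sqrt (real p) * sqrt (ln (1 / s))) * f p)" for i and f :: "nat \<Rightarrow> real"
  have disj: "A i \<inter> A j = {}" if "i < j" for i j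
  proof -
    have "(1 / s) powr (real (Suc i) / real n) \<le> (1 / s) powr (real j / real n)"
      using that by (intro block_points_mono[OF s] divide_right_mono) auto
    then show ?thesis unfolding A_def prime_block_def by auto
  qed
  have "disjoint_family_on A I"
    unfolding disjoint_family_on_def using disj by (metis Int_commute linorder_neqE_nat)
  then have "indep_vars (\<lambda>j. PiM (A j) (\<lambda>_. borel)) (\<lambda>j \<omega>. restrict (\<lambda>i. \<eta> i \<omega>) (A j)) I"
  proof (intro indep_vars_restrict[OF indep])
    show "A j \<subseteq> {1..}" for j unfolding A_def by (rule prime_block_ge_1)
  qed
  then have "indep_vars (\<lambda>_. borel) (\<lambda>j \<omega>. g j (restrict (\<lambda>i. \<eta> i \<omega>) (A j))) I"
  proof (rule indep_vars_compose2)
    show "g j \<in> borel_measurable (PiM (A j) (\<lambda>_. borel))" for j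
      unfolding g_def
      by (intro borel_measurable_sum borel_measurable_times borel_measurable_const measurable_component_singleton)
  qed
  also have "(\<lambda>j \<omega>. g j (restrict (\<lambda>i. \<eta> i \<omega>) (A j))) = block_increment s n"
    unfolding g_def block_increment_def A_def by (intro ext sum.cong) auto
  finally show ?thesis .
qed

text \<open>
  The weights are at most \<open>1 / sqrt L\<close>, and their squares add up to \<open>1/n\<close> within \<open>6 / L\<close>.
\<close>

lemma block_increment_weak_conv:
  assumes S: "\<And>k. 0 < S k" "\<And>k. S k < 1" "S \<longlonglongrightarrow> 0" and "n > 0"
    and BM: "standard_brownian_motion N B"
  shows "weak_conv_m (\<lambda>k. distr M borel (block_increment (S k) n i))
    (distr N borel (\<lambda>\<omega>. \<sigma> * (B (real (Suc i) / real n) \<omega> - B (real i / real n) \<omega>)))"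
proof -
  interpret N: prob_space N using BM by (simp add: standard_brownian_motion_def)
  have B: "B t \<in> borel_measurable N" if "t \<ge> 0" for t
    using BM that by (simp add: standard_brownian_motion_def)
  define L where "L k = ln (1 / S k)" for k
  have L: "L k > 0" for k using S(1,2)[of k] by (simp add: L_def)
  have S_right: "filterlim S (at_right 0) sequentially"
    using S by (intro tendsto_imp_filterlim_at_right) auto
  have "((\<lambda>s::real. 1 / ln (1 / s)) \<longlongrightarrow> 0) (at_right 0)" by real_asymp
  from filterlim_compose[OF this S_right] have invL1: "(\<lambda>k. 1 / L k) \<longlonglongrightarrow> 0"
    unfolding L_def .
  have "((\<lambda>s::real. 1 / sqrt (ln (1 / s))) \<longlongrightarrow> 0) (at_right 0)" by real_asymp
  from filterlim_compose[OF this S_right] have invL2: "(\<lambda>k. 1 / sqrt (L k)) \<longlonglongrightarrow> 0"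
    unfolding L_def .
  define A where "A k = prime_block ((1 / S k) powr (real i / real n)) ((1 / S k) powr (real (Suc i) / real n))" for k
  define c where "c k p = 1 / (sqrt (real p) * sqrt (L k))" for k and p :: nat
  have increment: "block_increment (S k) n i = (\<lambda>\<omega>. \<Sum>p\<in>A k. c k p * \<eta> p \<omega>)" for k
    unfolding block_increment_def A_def c_def L_def ..
  have variance: "(\<lambda>k. \<Sum>p\<in>A k. (c k p)\<^sup>2) \<longlonglongrightarrow> 1 / real n"
  proof -
    have "\<bar>(\<Sum>p\<in>A k. (c k p)\<^sup>2) - 1 / real n\<bar> \<le> 6 * (1 / L k)" for k
    proof -
      let ?x = "(1 / S k) powr (real i / real n)" and ?y = "(1 / S k) powr (real (Suc i) / real n)"
      have "1 \<le> ?x" "?x \<le> ?y"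
        using block_points_mono[OF S(1,2), of 0 "real i / real n" k]
          block_points_mono[OF S(1,2), of "real i / real n" "real (Suc i) / real n" k] S(1)[of k]
        by (auto simp: divide_right_mono)
      then have "\<bar>(\<Sum>p\<in>A k. 1 / real p) - (ln ?y - ln ?x)\<bar> \<le> 6"
        unfolding A_def by (rule prime_block_reciprocal_sum)
      also have "ln ?y - ln ?x = L k / real n"
      proof -
        have "ln ?y - ln ?x = (real (Suc i) / real n - real i / real n) * L k"
          using S(1)[of k] by (simp only: L_def ln_powr left_diff_distrib)
        also have "real (Suc i) / real n - real i / real n = 1 / real n"
          by (simp add: diff_divide_distrib[symmetric])
        finally show ?thesis by simp
      qed
      finally have "\<bar>(\<Sum>p\<in>A k. 1 / real p) - L k / real n\<bar> / L k \<le> 6 / L k"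
        using L by (intro divide_right_mono) (auto intro: less_imp_le)
      moreover have "(\<Sum>p\<in>A k. (c k p)\<^sup>2) - 1 / real n = ((\<Sum>p\<in>A k. 1 / real p) - L k / real n) / L k"
      proof -
        have "(c k p)\<^sup>2 = 1 / real p / L k" for p
          using L[of k] by (simp add: c_def power_divide power_mult_distrib)
        then have "(\<Sum>p\<in>A k. (c k p)\<^sup>2) = (\<Sum>p\<in>A k. 1 / real p) / L k"
          by (simp only: sum_divide_distrib)
        then show ?thesis using L[of k] by (simp add: diff_divide_distrib)
      qed
      ultimately show ?thesis using L[of k] by (simp add: abs_divide)
    qed
    then have "\<forall>\<^sub>F k in sequentially. norm ((\<Sum>p\<in>A k. (c k p)\<^sup>2) - 1 / real n) \<le> 6 * (1 / L k)"
      by (intro always_eventually allI) (simp only: real_norm_def)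
    moreover have "(\<lambda>k. 6 * (1 / L k)) \<longlonglongrightarrow> 0" using tendsto_mult_left[OF invL1, of 6] by simp
    ultimately have "(\<lambda>k. (\<Sum>p\<in>A k. (c k p)\<^sup>2) - 1 / real n) \<longlonglongrightarrow> 0"
      by (rule Lim_null_comparison)
    then show ?thesis by (simp add: LIM_zero_iff)
  qed
  show ?thesis
  proof (rule levy_continuity)
    show "real_distribution (distr M borel (block_increment (S k) n i))" for k
      by (rule real_distribution_distr) (rule block_increment_measurable)
    show "real_distribution (distr N borel (\<lambda>\<omega>. \<sigma> * (B (real (Suc i) / real n) \<omega> - B (real i / real n) \<omega>)))"
      using B by (intro N.real_distribution_distr borel_measurable_times borel_measurable_diff) auto
    fix \<theta>
    have "(\<lambda>k. char (distr M borel (\<lambda>\<omega>. \<Sum>p\<in>A k. c k p * \<eta> p \<omega>)) \<theta>) \<longlonglongrightarrow>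
        complex_of_real (exp (- (\<sigma>\<^sup>2 / 2) * (\<theta>\<^sup>2 * (1 / real n))))"
    proof (rule char_weighted_sum_tendsto[OF _ _ _ invL2 _ variance])
      show "finite (A k)" "A k \<subseteq> {1..}" for k
        unfolding A_def by (rule finite_prime_block, rule prime_block_ge_1)
      fix k p assume p: "p \<in> A k"
      then have "sqrt (real p) \<ge> 1" using prime_block_ge_1 by (auto simp: A_def)
      then have "sqrt (L k) \<le> sqrt (real p) * sqrt (L k)"
        using L[of k] mult_right_mono[of 1 "sqrt (real p)" "sqrt (L k)"] by simp
      then show "\<bar>c k p\<bar> \<le> 1 / sqrt (L k)"
        unfolding c_def using L[of k] by (simp add: abs_mult frac_le)
    qed (use L in \<open>auto intro: less_imp_le\<close>)
    also have "complex_of_real (exp (- (\<sigma>\<^sup>2 / 2) * (\<theta>\<^sup>2 * (1 / real n)))) =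
        char (distr N borel (\<lambda>\<omega>. \<sigma> * (B (real (Suc i) / real n) \<omega> - B (real i / real n) \<omega>))) \<theta>"
    proof -
      have "real (Suc i) / real n - real i / real n = 1 / real n"
        by (simp add: diff_divide_distrib[symmetric])
      then show ?thesis
        using \<open>n > 0\<close> by (subst char_brownian_increment[OF BM]) (auto simp: divide_strict_right_mono)
    qed
    finally show "(\<lambda>k. char (distr M borel (block_increment (S k) n i)) \<theta>) \<longlonglongrightarrow>
        char (distr N borel (\<lambda>\<omega>. \<sigma> * (B (real (Suc i) / real n) \<omega> - B (real i / real n) \<omega>))) \<theta>"
      unfolding increment .
  qed
qed


lemma abs_le_square_plus_1: "\<bar>z :: real\<bar> \<le> z\<^sup>2 + 1"
proof -
  have "0 \<le> (\<bar>z\<bar> - 1)\<^sup>2 + \<bar>z\<bar>" by simp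
  also have "\<dots> = z\<^sup>2 + 1 - \<bar>z\<bar>" by (simp add: power2_eq_square algebra_simps)
  finally show ?thesis by simp
qed

lemma bounded_series_measurable:
  "(\<lambda>\<omega>. prime_series (\<lambda>n. bounded_part n \<omega>) u) \<in> borel_measurable M"
  unfolding prime_series_eq
  by (intro borel_measurable_suminf borel_measurable_times borel_measurable_const prime_coeff_measurable)

lemma remainder_bound_measurable: "remainder_bound \<in> borel_measurable M"
  unfolding remainder_bound_def[abs_def]
  by (intro borel_measurable_suminf borel_measurable_times borel_measurable_const borel_measurable_abs prime_coeff_measurable)

lemma cutoff_sum_measurable: "cutoff_sum y \<in> borel_measurable M"
  unfolding cutoff_sum_eq[abs_def]
  using prime_block_ge_1 by (intro borel_measurable_sum borel_measurable_divide borel_measurable_const coeff_measurable) auto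

text \<open>
  On the time scale \<open>u = s powr t\<close> the fourth moment bound reads \<open>((t - r) L)\<^sup>2\<close>, and the normalisation
  divides by \<open>L\<^sup>2\<close>: the dependence on \<open>s\<close> disappears.
\<close>

lemma bounded_series_oscillation:
  assumes s: "0 < s" "s < 1"
  defines "X \<equiv> \<lambda>t \<omega>. prime_series (\<lambda>n. bounded_part n \<omega>) (s powr t) / sqrt (ln (1 / s))"
  obtains G where "G \<in> borel_measurable M" "\<And>\<omega>. G \<omega> \<ge> 0"
    "(\<integral>\<^sup>+\<omega>. ennreal (G \<omega>) \<partial>M) \<le> ennreal (\<Sum>j. chaining_term (768 * exp (\<sigma>\<^sup>2)) K (j + J))"
    "AE \<omega> in M. \<forall>i<K * 2 ^ J. \<forall>t\<in>{real i / 2 ^ J..real (Suc i) / 2 ^ J}.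
      \<bar>X t \<omega> - X (real i / 2 ^ J) \<omega>\<bar> \<le> G \<omega> \<and> \<bar>X t \<omega> - X (real (Suc i) / 2 ^ J) \<omega>\<bar> \<le> G \<omega>"
proof -
  define L where "L = ln (1 / s)"
  have L: "L > 0" using s by (simp add: L_def)
  have X_meas: "X t \<in> borel_measurable M" for t
    unfolding X_def by (intro borel_measurable_divide bounded_series_measurable borel_measurable_const)
  have cont: "AE \<omega> in M. continuous_on {0..} (\<lambda>t. X t \<omega>)"
    using bounded_part_regular
  proof eventually_elim
    case (elim \<omega>)
    then have "continuous_on {0<..} (prime_series (\<lambda>n. bounded_part n \<omega>))"
      by (simp add: regular_coeffs_def)
    then have "continuous_on {0..} (\<lambda>t. prime_series (\<lambda>n. bounded_part n \<omega>) (s powr t))"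
      by (rule continuous_on_compose2) (use s in \<open>auto intro!: continuous_intros\<close>)
    then show ?case unfolding X_def by (rule continuous_on_divide[OF _ continuous_on_const]) (use L in \<open>simp add: L_def\<close>)
  qed
  have moment: "(\<integral>\<^sup>+\<omega>. ennreal ((X t \<omega> - X r \<omega>) ^ 4) \<partial>M) \<le> ennreal (768 * exp (\<sigma>\<^sup>2) * (t - r)\<^sup>2)"
    if "0 \<le> r" "r \<le> t" for r t
  proof -
    have uv: "0 < s powr t" "s powr t \<le> s powr r"
      using s that by (auto simp: powr_mono')
    have "s powr r / s powr t = (1 / s) powr (t - r)"
      using s by (simp add: powr_diff powr_divide)
    then have ln_eq: "ln (s powr r / s powr t) = (t - r) * L"
      using s by (simp add: ln_powr L_def)
    define \<Delta> where "\<Delta> \<omega> = prime_series (\<lambda>n. bounded_part n \<omega>) (s powr t) - prime_series (\<lambda>n. bounded_part n \<omega>) (s powr r)" for \<omega>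
    have \<Delta>: "\<Delta> \<in> borel_measurable M"
      unfolding \<Delta>_def[abs_def] by (intro borel_measurable_diff bounded_series_measurable)
    have "(X t \<omega> - X r \<omega>) ^ 4 = 1 / L\<^sup>2 * \<Delta> \<omega> ^ 4" for \<omega>
    proof -
      have "sqrt L ^ 4 = ((sqrt L)\<^sup>2)\<^sup>2" by simp
      then have "sqrt L ^ 4 = L\<^sup>2" using L by simp
      then show ?thesis
        unfolding X_def \<Delta>_def L_def[symmetric] diff_divide_distrib[symmetric] power_divide by simp
    qed
    then have "(\<integral>\<^sup>+\<omega>. ennreal ((X t \<omega> - X r \<omega>) ^ 4) \<partial>M) = (\<integral>\<^sup>+\<omega>. ennreal (1 / L\<^sup>2) * ennreal (\<Delta> \<omega> ^ 4) \<partial>M)"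
      by (simp only: ennreal_mult' zero_le_divide_1_iff zero_le_power2)
    also have "\<dots> = ennreal (1 / L\<^sup>2) * (\<integral>\<^sup>+\<omega>. ennreal (\<Delta> \<omega> ^ 4) \<partial>M)"
      using \<Delta> by (intro nn_integral_cmult) measurable
    also have "\<dots> \<le> ennreal (1 / L\<^sup>2) * ennreal (768 * exp (\<sigma>\<^sup>2) * ((t - r) * L)\<^sup>2)"
      unfolding \<Delta>_def ln_eq[symmetric] by (intro mult_left_mono fourth_moment_increment_le uv) simp
    also have "\<dots> = ennreal (1 / L\<^sup>2 * (768 * exp (\<sigma>\<^sup>2) * ((t - r) * L)\<^sup>2))"
      by (rule ennreal_mult'[symmetric]) simp
    also have "1 / L\<^sup>2 * (768 * exp (\<sigma>\<^sup>2) * ((t - r) * L)\<^sup>2) = 768 * exp (\<sigma>\<^sup>2) * (t - r)\<^sup>2"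
      using L by (simp add: power_mult_distrib)
    finally show ?thesis .
  qed
  show ?thesis
    by (rule dyadic_oscillation_expectation[where X = X and C = "768 * exp (\<sigma>\<^sup>2)" and J = J and K = K])
      (use X_meas prob_space_axioms cont moment that in auto)
qed

lemma cutoff_error_expectation:
  assumes s: "0 < s" "s < 1" and "t \<ge> 0"
  shows "(\<integral>\<^sup>+\<omega>. ennreal (\<bar>prime_process \<eta> (s powr t) \<omega> - cutoff_sum ((1 / s) powr t) \<omega>\<bar>) \<partial>M) \<le> ennreal (8 * \<sigma>\<^sup>2 + 1)"
proof -
  define Z where "Z \<omega> = prime_process \<eta> (s powr t) \<omega> - cutoff_sum ((1 / s) powr t) \<omega>" for \<omega>
  have Z: "Z \<in> borel_measurable M"
    unfolding Z_def[abs_def] by (intro borel_measurable_diff prime_process_measurable cutoff_sum_measurable)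
  have u: "0 < s powr t" "s powr t \<le> 1" "1 / s powr t = (1 / s) powr t"
    using s \<open>t \<ge> 0\<close> powr_mono'[of 0 t s] by (auto simp: powr_divide)
  have "(\<integral>\<^sup>+\<omega>. ennreal \<bar>Z \<omega>\<bar> \<partial>M) \<le> (\<integral>\<^sup>+\<omega>. ennreal ((Z \<omega>)\<^sup>2) + ennreal 1 \<partial>M)"
    by (intro nn_integral_mono) (simp add: ennreal_leI abs_le_square_plus_1 flip: ennreal_plus ennreal_1)
  also have "\<dots> = (\<integral>\<^sup>+\<omega>. ennreal ((Z \<omega>)\<^sup>2) \<partial>M) + ennreal 1"
    using Z by (subst nn_integral_add) (simp_all add: emeasure_space_1)
  also have "\<dots> \<le> ennreal (8 * \<sigma>\<^sup>2) + ennreal 1"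
    unfolding Z_def u(3)[symmetric] by (intro add_right_mono second_moment_cutoff_le u)
  also have "\<dots> = ennreal (8 * \<sigma>\<^sup>2 + 1)" by (rule ennreal_plus[symmetric]) auto
  finally show ?thesis unfolding Z_def .
qed

text \<open>
  At a time in the cell of a grid point, the distance between the process and the partial block
  sum has three sources: the remainder of the truncation (twice), the oscillation of the truncated
  series within the cell, and the error of the cut-off at the grid point. Only the oscillation is not
  divided by \<open>sqrt L\<close>.
\<close>

lemma interpolation_error_le:
  assumes s: "0 < s" "s < 1" and F: "\<And>x. \<bar>F x\<bar> \<le> b" "cpath_lipschitz (real K) F"
  shows "\<bar>(\<integral>\<omega>. F (cpath_of (\<lambda>t. scaled_process s t \<omega>)) \<partial>M) -
      (\<integral>\<omega>. interpolated_functional F (2 ^ J) (Suc K * 2 ^ J) (\<lambda>i. block_increment s (2 ^ J) i \<omega>) \<partial>M)\<bar>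
    \<le> real K * ((\<Sum>j. chaining_term (768 * exp (\<sigma>\<^sup>2)) (Suc K) (j + J)) +
        real (Suc K * 2 ^ J + 2) * (8 * \<sigma>\<^sup>2 + 1) / sqrt (ln (1 / s)))"
proof -
  define L where "L = ln (1 / s)"
  define m where "m = Suc K * 2 ^ J"
  define \<tau> where "\<tau> = (\<Sum>j. chaining_term (768 * exp (\<sigma>\<^sup>2)) (Suc K) (j + J))"
  have L: "L > 0" using s by (simp add: L_def)
  have \<tau>: "\<tau> \<ge> 0"
    unfolding \<tau>_def using chaining_term_summable[of "768 * exp (\<sigma>\<^sup>2)" "Suc K"]
    by (intro suminf_nonneg chaining_term_nonneg) (auto simp: summable_iff_shift)
  define X where "X t \<omega> = prime_series (\<lambda>n. bounded_part n \<omega>) (s powr t) / sqrt L" for t \<omega>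
  obtain G where G: "G \<in> borel_measurable M" "\<And>\<omega>. G \<omega> \<ge> 0" "(\<integral>\<^sup>+\<omega>. ennreal (G \<omega>) \<partial>M) \<le> ennreal \<tau>"
    and osc: "AE \<omega> in M. \<forall>i<m. \<forall>t\<in>{real i / 2 ^ J..real (Suc i) / 2 ^ J}.
      \<bar>X t \<omega> - X (real i / 2 ^ J) \<omega>\<bar> \<le> G \<omega> \<and> \<bar>X t \<omega> - X (real (Suc i) / 2 ^ J) \<omega>\<bar> \<le> G \<omega>"
    unfolding \<tau>_def m_def X_def L_def by (rule bounded_series_oscillation[OF s, where K = "Suc K" and J = J]) blast
  define w where "w \<omega> i = block_increment s (2 ^ J) i \<omega>" for \<omega> i
  define err where "err j \<omega> = \<bar>prime_process \<eta> (s powr (real j / 2 ^ J)) \<omega> - cutoff_sum ((1 / s) powr (real j / 2 ^ J)) \<omega>\<bar>" for j :: nat and \<omega>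
  define E where "E \<omega> = G \<omega> + (2 * remainder_bound \<omega> + (\<Sum>j\<le>m. err j \<omega>)) / sqrt L" for \<omega>
  define f where "f \<omega> = F (cpath_of (\<lambda>t. scaled_process s t \<omega>))" for \<omega>
  define h where "h \<omega> = interpolated_functional F (2 ^ J) m (w \<omega>)" for \<omega>
  have F_meas: "F \<in> borel_measurable borel"
    by (intro borel_measurable_continuous_onI cpath_lipschitz_imp_continuous[OF F(2)]) simp
  have err_meas: "err j \<in> borel_measurable M" for j
    unfolding err_def[abs_def]
    by (intro borel_measurable_abs borel_measurable_diff prime_process_measurable cutoff_sum_measurable)
  have E_meas: "E \<in> borel_measurable M"
    unfolding E_def[abs_def]
    by (intro borel_measurable_add borel_measurable_divide borel_measurable_times borel_measurable_const
        borel_measurable_sum G(1) err_meas remainder_bound_measurable)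
  have f_meas: "f \<in> borel_measurable M"
    unfolding f_def[abs_def] by (rule measurable_compose[OF scaled_process_path_measurable[OF s(1)] F_meas])
  have h_meas: "h \<in> borel_measurable M"
  proof -
    have "(\<lambda>\<omega>. \<lambda>i\<in>{..<m}. w \<omega> i) \<in> M \<rightarrow>\<^sub>M (\<Pi>\<^sub>M i\<in>{..<m}. borel)"
      unfolding w_def by (intro measurable_restrict block_increment_measurable)
    from measurable_compose[OF this interpolated_functional_measurable[OF F_meas]]
    show ?thesis by (simp only: interpolated_functional_restrict h_def[abs_def])
  qed
  have bnd: "\<bar>f \<omega>\<bar> \<le> b" "\<bar>h \<omega>\<bar> \<le> b" for \<omega>
    using F(1) by (auto simp: f_def h_def interpolated_functional_def)
  have int: "integrable M f" "integrable M h"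
    using bnd f_meas h_meas by (auto intro!: integrable_const_bound[of _ b])
  have "AE \<omega> in M. \<bar>f \<omega> - h \<omega>\<bar> \<le> real K * E \<omega>"
    using osc AE_good_event
  proof eventually_elim
    case (elim \<omega>)
    have close_X: "\<bar>scaled_process s t \<omega> - X t \<omega>\<bar> \<le> remainder_bound \<omega> / sqrt L" for t
    proof -
      have "scaled_process s t \<omega> - X t \<omega> =
          (prime_process \<eta> (s powr t) \<omega> - prime_series (\<lambda>n. bounded_part n \<omega>) (s powr t)) / sqrt L"
        unfolding scaled_process_def X_def L_def by (simp add: diff_divide_distrib)
      moreover have "\<bar>prime_process \<eta> (s powr t) \<omega> - prime_series (\<lambda>n. bounded_part n \<omega>) (s powr t)\<bar> \<le> remainder_bound \<omega>"
        using elim(2) s by simp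
      ultimately show ?thesis using L by (simp add: abs_divide divide_right_mono)
    qed
    have sum_w: "(\<Sum>i<j. w \<omega> i) = cutoff_sum ((1 / s) powr (real j / 2 ^ J)) \<omega> / sqrt L" for j
      unfolding w_def L_def using block_increment_sum[OF s, where n = "2 ^ J" and j = j and \<omega> = \<omega>] by simp
    have close_w: "\<bar>scaled_process s (real j / 2 ^ J) \<omega> - (\<Sum>i<j. w \<omega> i)\<bar> \<le> (\<Sum>j\<le>m. err j \<omega>) / sqrt L" if "j \<le> m" for j
    proof -
      have "\<bar>scaled_process s (real j / 2 ^ J) \<omega> - (\<Sum>i<j. w \<omega> i)\<bar> = err j \<omega> / sqrt L"
        unfolding sum_w scaled_process_def err_def using L
        by (simp add: L_def abs_divide flip: diff_divide_distrib)
      also have "err j \<omega> \<le> (\<Sum>j\<le>m. err j \<omega>)"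
        using that by (intro member_le_sum) (auto simp: err_def)
      finally show ?thesis using L by (simp add: divide_right_mono)
    qed
    have "\<bar>scaled_process s t \<omega> - (\<Sum>i<j. w \<omega> i)\<bar> \<le> E \<omega> \<and> \<bar>scaled_process s t \<omega> - (\<Sum>i<Suc j. w \<omega> i)\<bar> \<le> E \<omega>"
      if "j < Suc K * 2 ^ J" "t \<in> {real j / 2 ^ J..real (Suc j) / 2 ^ J}" for j t
    proof -
      have j: "j < m" using that(1) by (simp add: m_def)
      have E: "E \<omega> = G \<omega> + remainder_bound \<omega> / sqrt L + remainder_bound \<omega> / sqrt L + (\<Sum>j\<le>m. err j \<omega>) / sqrt L"
        by (simp add: E_def add_divide_distrib)
      have G1: "\<bar>X t \<omega> - X (real j / 2 ^ J) \<omega>\<bar> \<le> G \<omega>" and G2: "\<bar>X t \<omega> - X (real (Suc j) / 2 ^ J) \<omega>\<bar> \<le> G \<omega>"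
        using elim(1) j that(2) by blast+
      have "\<bar>scaled_process s t \<omega> - (\<Sum>i<j. w \<omega> i)\<bar> \<le> E \<omega>"
        using G1 close_X[of t] close_X[of "real j / 2 ^ J"] close_w[of j] j unfolding E by linarith
      moreover have "\<bar>scaled_process s t \<omega> - (\<Sum>i<Suc j. w \<omega> i)\<bar> \<le> E \<omega>"
        using G2 close_X[of t] close_X[of "real (Suc j) / 2 ^ J"] close_w[of "Suc j"] j unfolding E by linarith
      ultimately show ?thesis by blast
    qed
    then have "\<bar>scaled_process s t \<omega> - linear_interpolation (2 ^ J) (Suc K * 2 ^ J) (w \<omega>) t\<bar> \<le> E \<omega>"
      if "t \<in> {0..real K}" for t
      by (rule dyadic_interpolation_close[OF that])
    then show ?case
      unfolding f_def h_def interpolated_functional_def m_def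
      by (rule cpath_lipschitz_functional_le[OF F(2) scaled_process_continuous[OF s(1)] continuous_on_linear_interpolation])
  qed
  then have "(\<integral>\<^sup>+\<omega>. ennreal \<bar>f \<omega> - h \<omega>\<bar> \<partial>M) \<le> (\<integral>\<^sup>+\<omega>. ennreal (real K) * ennreal (E \<omega>) \<partial>M)"
    by (intro nn_integral_mono_AE, eventually_elim) (simp add: ennreal_leI flip: ennreal_mult')
  also have "\<dots> = ennreal (real K) * (\<integral>\<^sup>+\<omega>. ennreal (E \<omega>) \<partial>M)"
    using E_meas by (intro nn_integral_cmult) measurable
  also have "(\<integral>\<^sup>+\<omega>. ennreal (E \<omega>) \<partial>M) \<le> ennreal (\<tau> + real (m + 2) * (8 * \<sigma>\<^sup>2 + 1) / sqrt L)"
  proof -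
    have rem_le: "(\<integral>\<^sup>+\<omega>. ennreal (remainder_bound \<omega>) \<partial>M) \<le> ennreal (4 * \<sigma>\<^sup>2)"
      by (rule remainder_summable(2))
    have err_le: "(\<integral>\<^sup>+\<omega>. ennreal (err j \<omega>) \<partial>M) \<le> ennreal (8 * \<sigma>\<^sup>2 + 1)" for j
      unfolding err_def by (rule cutoff_error_expectation[OF s]) simp
    have "(\<integral>\<^sup>+\<omega>. ennreal (E \<omega>) \<partial>M) \<le> (\<integral>\<^sup>+\<omega>. ennreal (G \<omega>) +
        (ennreal 2 * ennreal (remainder_bound \<omega>) + (\<Sum>j\<le>m. ennreal (err j \<omega>))) * ennreal (1 / sqrt L) \<partial>M)"
    proof (intro nn_integral_mono)
      fix \<omega>
      \<comment> \<open>Where its defining series diverges, the remainder bound may have any sign.\<close>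
      have "E \<omega> \<le> G \<omega> + (2 * max 0 (remainder_bound \<omega>) + (\<Sum>j\<le>m. err j \<omega>)) * (1 / sqrt L)"
        unfolding E_def using L by (simp add: divide_right_mono)
      moreover have "ennreal (G \<omega> + (2 * max 0 (remainder_bound \<omega>) + (\<Sum>j\<le>m. err j \<omega>)) * (1 / sqrt L)) =
          ennreal (G \<omega>) + (ennreal 2 * ennreal (remainder_bound \<omega>) + (\<Sum>j\<le>m. ennreal (err j \<omega>))) * ennreal (1 / sqrt L)"
      proof -
        have nn: "err j \<omega> \<ge> 0" for j by (simp add: err_def)
        have "ennreal (2 * max 0 (remainder_bound \<omega>) + (\<Sum>j\<le>m. err j \<omega>)) =
            ennreal 2 * ennreal (remainder_bound \<omega>) + (\<Sum>j\<le>m. ennreal (err j \<omega>))"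
          using nn by (subst ennreal_plus) (auto simp: sum_ennreal sum_nonneg ennreal_mult' ennreal_max_0)
        then show ?thesis
          using nn L G(2)[of \<omega>]
          by (subst ennreal_plus, simp, simp add: sum_nonneg, subst ennreal_mult'') auto
      qed
      ultimately show "ennreal (E \<omega>) \<le> ennreal (G \<omega>) +
          (ennreal 2 * ennreal (remainder_bound \<omega>) + (\<Sum>j\<le>m. ennreal (err j \<omega>))) * ennreal (1 / sqrt L)"
        by (metis ennreal_leI)
    qed
    also have "\<dots> = (\<integral>\<^sup>+\<omega>. ennreal (G \<omega>) \<partial>M) + (ennreal 2 * (\<integral>\<^sup>+\<omega>. ennreal (remainder_bound \<omega>) \<partial>M) +
        (\<Sum>j\<le>m. \<integral>\<^sup>+\<omega>. ennreal (err j \<omega>) \<partial>M)) * ennreal (1 / sqrt L)"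
    proof -
      note [measurable] = G(1) err_meas remainder_bound_measurable
      show ?thesis
        by (subst nn_integral_add, measurable, subst nn_integral_multc, measurable,
            subst nn_integral_add, measurable, subst nn_integral_cmult, measurable,
            subst nn_integral_sum, measurable)
    qed
    also have "\<dots> \<le> ennreal \<tau> + (ennreal 2 * ennreal (4 * \<sigma>\<^sup>2) + (\<Sum>j\<le>m. ennreal (8 * \<sigma>\<^sup>2 + 1))) * ennreal (1 / sqrt L)"
      by (intro add_mono mult_right_mono mult_left_mono sum_mono G(3) rem_le err_le) auto
    also have "\<dots> = ennreal (\<tau> + (8 * \<sigma>\<^sup>2 + real (Suc m) * (8 * \<sigma>\<^sup>2 + 1)) * (1 / sqrt L))"
    proof -
      have "(\<Sum>j\<le>m. ennreal (8 * \<sigma>\<^sup>2 + 1)) = ennreal (real (Suc m) * (8 * \<sigma>\<^sup>2 + 1))"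
        by (subst sum_ennreal) auto
      moreover have "ennreal 2 * ennreal (4 * \<sigma>\<^sup>2) = ennreal (8 * \<sigma>\<^sup>2)"
        by (subst ennreal_mult'[symmetric]) auto
      ultimately show ?thesis
        using \<tau> L by (simp only: ennreal_plus[symmetric] ennreal_mult'[symmetric] zero_le_divide_1_iff
            real_sqrt_ge_0_iff less_imp_le add_nonneg_nonneg mult_nonneg_nonneg zero_le_power2 zero_le_numeral
            zero_le_one of_nat_0_le_iff)
    qed
    also have "\<dots> \<le> ennreal (\<tau> + real (m + 2) * (8 * \<sigma>\<^sup>2 + 1) / sqrt L)"
    proof (rule ennreal_leI)
      have "8 * \<sigma>\<^sup>2 + real (Suc m) * (8 * \<sigma>\<^sup>2 + 1) \<le> real (m + 2) * (8 * \<sigma>\<^sup>2 + 1)"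
        by (simp add: algebra_simps)
      then show "\<tau> + (8 * \<sigma>\<^sup>2 + real (Suc m) * (8 * \<sigma>\<^sup>2 + 1)) * (1 / sqrt L) \<le> \<tau> + real (m + 2) * (8 * \<sigma>\<^sup>2 + 1) / sqrt L"
        using L by (simp add: divide_right_mono)
    qed
    finally show ?thesis .
  qed
  finally have "(\<integral>\<^sup>+\<omega>. ennreal \<bar>f \<omega> - h \<omega>\<bar> \<partial>M) \<le> ennreal (real K) * ennreal (\<tau> + real (m + 2) * (8 * \<sigma>\<^sup>2 + 1) / sqrt L)"
    by (simp add: mult_left_mono)
  also have "\<dots> = ennreal (real K * (\<tau> + real (m + 2) * (8 * \<sigma>\<^sup>2 + 1) / sqrt L))"
    by (rule ennreal_mult'[symmetric]) simp
  also have "(\<integral>\<^sup>+\<omega>. ennreal \<bar>f \<omega> - h \<omega>\<bar> \<partial>M) = ennreal (\<integral>\<omega>. \<bar>f \<omega> - h \<omega>\<bar> \<partial>M)"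
    using int by (intro nn_integral_eq_integral integrable_abs Bochner_Integration.integrable_diff) auto
  finally have "(\<integral>\<omega>. \<bar>f \<omega> - h \<omega>\<bar> \<partial>M) \<le> real K * (\<tau> + real (m + 2) * (8 * \<sigma>\<^sup>2 + 1) / sqrt L)"
    using \<tau> L by (subst (asm) ennreal_le_iff) auto
  moreover have "\<bar>(\<integral>\<omega>. f \<omega> \<partial>M) - (\<integral>\<omega>. h \<omega> \<partial>M)\<bar> \<le> (\<integral>\<omega>. \<bar>f \<omega> - h \<omega>\<bar> \<partial>M)"
    using int integral_abs_bound[of M "\<lambda>\<omega>. f \<omega> - h \<omega>"] by simp
  ultimately show ?thesis unfolding f_def h_def w_def \<tau>_def m_def L_def by linarith
qed

text \<open>
  The grid is chosen first, so that the oscillation and the Brownian interpolation error are small; then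
  \<open>k\<close> tends to infinity.
\<close>

lemma functional_expectation_tendsto:
  assumes S: "\<And>k. 0 < S k" "\<And>k. S k < 1" "S \<longlonglongrightarrow> 0"
    and BM: "standard_brownian_motion N B" and F: "\<And>x. \<bar>F x\<bar> \<le> b" "cpath_lipschitz (real K) F"
  shows "(\<lambda>k. \<integral>\<omega>. F (cpath_of (\<lambda>t. scaled_process (S k) t \<omega>)) \<partial>M) \<longlonglongrightarrow>
    (\<integral>\<omega>. F (cpath_of (\<lambda>t. \<sigma> * B t \<omega>)) \<partial>N)"
proof -
  interpret N: prob_space N using BM by (simp add: standard_brownian_motion_def)
  define a where "a k = (\<integral>\<omega>. F (cpath_of (\<lambda>t. scaled_process (S k) t \<omega>)) \<partial>M)" for k
  define A where "A = (\<integral>\<omega>. F (cpath_of (\<lambda>t. \<sigma> * B t \<omega>)) \<partial>N)"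
  define m where "m J = Suc K * 2 ^ J" for J
  define \<Delta> where "\<Delta> J i \<omega> = \<sigma> * (B (real (Suc i) / 2 ^ J) \<omega> - B (real i / 2 ^ J) \<omega>)" for J i :: nat and \<omega>
  define c where "c J k = (\<integral>\<omega>. interpolated_functional F (2 ^ J) (m J) (\<lambda>i. block_increment (S k) (2 ^ J) i \<omega>) \<partial>M)" for J k
  define C where "C J = (\<integral>\<omega>. interpolated_functional F (2 ^ J) (m J) (\<lambda>i. \<Delta> J i \<omega>) \<partial>N)" for J
  define \<tau> where "\<tau> J = (\<Sum>j. chaining_term (768 * exp (\<sigma>\<^sup>2)) (Suc K) (j + J))" for J
  have F_meas: "F \<in> borel_measurable borel"
    by (intro borel_measurable_continuous_onI cpath_lipschitz_imp_continuous[OF F(2)]) simp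
  have error: "\<bar>a k - c J k\<bar> \<le> real K * (\<tau> J + real (m J + 2) * (8 * \<sigma>\<^sup>2 + 1) * (1 / sqrt (ln (1 / S k))))" for J k
    using interpolation_error_le[OF S(1,2) F, of k J]
    unfolding a_def c_def \<tau>_def m_def by (simp only: times_divide_eq_right mult_1_right)
  have C_lim: "C \<longlonglongrightarrow> A"
    unfolding C_def A_def \<Delta>_def m_def by (rule brownian_interpolation_tendsto[OF BM F])
  have c_lim: "c J \<longlonglongrightarrow> C J" for J
    unfolding c_def C_def
  proof (rule joint_weak_convergence[where W = "\<lambda>k. block_increment (S k) (2 ^ J)" and Z = "\<Delta> J" and b = b
        and I = "{..<m J}" and H = "interpolated_functional F (2 ^ J) (m J)"])
    show "prob_space M" by (rule prob_space_axioms)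
    show "prob_space N" by (rule N.prob_space_axioms)
    show "indep_vars (\<lambda>_. borel) (block_increment (S k) (2 ^ J)) {..<m J}" for k
      by (rule block_increment_indep[OF S(1,2)])
    have "\<forall>i<m J. real i / 2 ^ J \<le> real (Suc i) / 2 ^ J" by (simp add: divide_right_mono)
    moreover have "0 \<le> real 0 / (2 :: real) ^ J" by simp
    ultimately have "N.indep_vars (\<lambda>_. borel) (\<lambda>i \<omega>. B (real (Suc i) / 2 ^ J) \<omega> - B (real i / 2 ^ J) \<omega>) {..<m J}"
      using BM unfolding standard_brownian_motion_def
      by (elim conjE) (erule allE[of _ "m J"], erule allE[of _ "\<lambda>i. real i / 2 ^ J"], blast)
    then show "N.indep_vars (\<lambda>_. borel) (\<Delta> J) {..<m J}"
      unfolding \<Delta>_def by (rule N.indep_vars_compose2[where Y = "\<lambda>_ x. \<sigma> * x"]) simp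
    show "weak_conv_m (\<lambda>k. distr M borel (block_increment (S k) (2 ^ J) i)) (distr N borel (\<Delta> J i))" for i
      unfolding \<Delta>_def using block_increment_weak_conv[OF S _ BM, of "2 ^ J" i] by simp
    show "interpolated_functional F (2 ^ J) (m J) \<in> borel_measurable (\<Pi>\<^sub>M i\<in>{..<m J}. borel)"
      by (rule interpolated_functional_measurable[OF F_meas])
    show "interpolated_functional F (2 ^ J) (m J) (restrict w {..<m J}) = interpolated_functional F (2 ^ J) (m J) w" for w
      by (rule interpolated_functional_restrict)
    show "\<bar>interpolated_functional F (2 ^ J) (m J) w\<bar> \<le> b" for w
      unfolding interpolated_functional_def by (rule F(1))
    show "(\<lambda>k. interpolated_functional F (2 ^ J) (m J) (x k)) \<longlonglongrightarrow> interpolated_functional F (2 ^ J) (m J) w"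
      if "\<And>i. i \<in> {..<m J} \<Longrightarrow> (\<lambda>k. x k i) \<longlonglongrightarrow> w i" for x w
      by (rule interpolated_functional_tendsto[OF F(2) that])
  qed
  have "filterlim S (at_right 0) sequentially"
    using S by (intro tendsto_imp_filterlim_at_right) auto
  moreover have "((\<lambda>s::real. 1 / sqrt (ln (1 / s))) \<longlongrightarrow> 0) (at_right 0)" by real_asymp
  ultimately have invL: "(\<lambda>k. 1 / sqrt (ln (1 / S k))) \<longlonglongrightarrow> 0"
    by (rule filterlim_compose[rotated])
  have "a \<longlonglongrightarrow> A"
  proof (rule LIMSEQ_I)
    fix \<epsilon> :: real assume \<epsilon>: "\<epsilon> > 0"
    have "\<tau> \<longlonglongrightarrow> 0"
      unfolding \<tau>_def by (rule chaining_tail_tendsto)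
    then have "(\<lambda>J. real K * \<tau> J + \<bar>C J - A\<bar>) \<longlonglongrightarrow> real K * 0 + \<bar>A - A\<bar>"
      by (intro tendsto_intros C_lim)
    then have "\<forall>\<^sub>F J in sequentially. real K * \<tau> J + \<bar>C J - A\<bar> < \<epsilon>"
      by (rule order_tendstoD) (use \<epsilon> in simp)
    then obtain J where J: "real K * \<tau> J + \<bar>C J - A\<bar> < \<epsilon>"
      by (auto simp: eventually_sequentially)
    define q where "q k = real K * (\<tau> J + real (m J + 2) * (8 * \<sigma>\<^sup>2 + 1) * (1 / sqrt (ln (1 / S k)))) + \<bar>c J k - A\<bar>" for k
    have "q \<longlonglongrightarrow> real K * (\<tau> J + real (m J + 2) * (8 * \<sigma>\<^sup>2 + 1) * 0) + \<bar>C J - A\<bar>"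
      unfolding q_def by (intro tendsto_intros invL c_lim)
    then have "\<forall>\<^sub>F k in sequentially. q k < \<epsilon>"
      by (rule order_tendstoD) (use J in simp)
    then obtain k0 where k0: "\<And>k. k \<ge> k0 \<Longrightarrow> q k < \<epsilon>" by (auto simp: eventually_sequentially)
    have "norm (a k - A) < \<epsilon>" if "k \<ge> k0" for k
      using k0[OF that] error[of k J] unfolding q_def real_norm_def by linarith
    then show "\<exists>k0. \<forall>k\<ge>k0. norm (a k - A) < \<epsilon>" by blast
  qed
  then show ?thesis unfolding a_def A_def .
qed

end

theorem theorem1:
  fixes M :: "'a measure" and \<eta> :: "nat \<Rightarrow> 'a \<Rightarrow> real"
    and P :: "'c measure" and \<xi> :: "'c \<Rightarrow> real" and \<sigma> :: real
    and N :: "'b measure" and B :: "real \<Rightarrow> 'b \<Rightarrow> real"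
  assumes "prob_space P"
    and "\<xi> \<in> borel_measurable P"
    and "integrable P (\<lambda>x. (\<xi> x)\<^sup>2)"
    and "(\<integral>x. \<xi> x \<partial>P) = 0"
    and "\<sigma> > 0"
    and "\<sigma>\<^sup>2 = (\<integral>x. (\<xi> x)\<^sup>2 \<partial>P)"
    and "prob_space M"
    and "prob_space.indep_vars M (\<lambda>_. borel) \<eta> {1..}"
    and "\<And>n. n \<ge> 1 \<Longrightarrow> distr M borel (\<eta> n) = distr P borel \<xi>"
    and "standard_brownian_motion N B"
  shows "weakly_converges
    (\<lambda>s. distr M borel
       (\<lambda>\<omega>. cpath_of (\<lambda>t. 1 / sqrt (ln (1 / s)) * prime_process \<eta> (s powr t) \<omega>)))
    (distr N borel (\<lambda>\<omega>. cpath_of (\<lambda>t. \<sigma> * B t \<omega>)))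
    (at_right (0 :: real))"
proof -
  interpret N: prob_space N using assms(10) by (simp add: standard_brownian_motion_def)
  interpret iid_coefficients M \<eta> "distr P borel \<xi>" \<sigma>
  proof (intro iid_coefficients.intro iid_coefficients_axioms.intro)
    show "prob_space M" by (rule assms(7))
    show "prob_space.indep_vars M (\<lambda>_. borel) \<eta> {1..}" by (rule assms(8))
    show "distr M borel (\<eta> n) = distr P borel \<xi>" if "n \<ge> 1" for n by (rule assms(9)[OF that])
    show "integrable (distr P borel \<xi>) (\<lambda>x. x\<^sup>2)"
      using assms(2,3) by (subst integrable_distr_eq) auto
    show "(\<integral>x. x \<partial>distr P borel \<xi>) = 0"
      using assms(2,4) by (subst integral_distr) auto
    show "(\<integral>x. x\<^sup>2 \<partial>distr P borel \<xi>) = \<sigma>\<^sup>2"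
      using assms(2,6) by (subst integral_distr) auto
  qed
  let ?X = "\<lambda>s \<omega>. cpath_of (\<lambda>t. scaled_process s t \<omega>)"
  let ?B = "\<lambda>\<omega>. cpath_of (\<lambda>t. \<sigma> * B t \<omega>)"
  have pathB: "?B \<in> N \<rightarrow>\<^sub>M borel"
  proof (rule borel_measurable_cpath_of)
    show "(\<lambda>\<omega>. \<sigma> * B t \<omega>) \<in> borel_measurable N" if "t \<ge> 0" for t
      using assms(10) that by (auto simp: standard_brownian_motion_def)
    show "continuous_on {0..} (\<lambda>t. \<sigma> * B t \<omega>)" if "\<omega> \<in> space N" for \<omega>
      using assms(10) that by (auto simp: standard_brownian_motion_def intro!: continuous_intros)
  qed
  have "weakly_converges (\<lambda>s. distr M borel (?X s)) (distr N borel ?B) (at_right 0)"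
  proof (rule weakly_converges_lipschitzI)
    have "\<forall>\<^sub>F s :: real in at_right 0. 0 < s"
      by (rule eventually_at_right_less)
    then show "\<forall>\<^sub>F s in at_right 0. prob_space (distr M borel (?X s)) \<and> sets (distr M borel (?X s)) = sets borel"
      by eventually_elim (auto intro: prob_space_distr scaled_process_path_measurable)
    show "prob_space (distr N borel ?B)" using pathB by (rule N.prob_space_distr)
    show "sets (distr N borel ?B) = sets borel" by simp
    fix K and F :: "cpath \<Rightarrow> real"
    assume "bounded (range F)" and lip: "cpath_lipschitz (real K) F"
    then obtain b where b: "\<And>x. \<bar>F x\<bar> \<le> b"
      unfolding bounded_iff by (auto simp: image_iff)
    have F_meas: "F \<in> borel_measurable borel"
      by (intro borel_measurable_continuous_onI cpath_lipschitz_imp_continuous[OF lip]) simp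
    show "((\<lambda>s. \<integral>x. F x \<partial>distr M borel (?X s)) \<longlongrightarrow> (\<integral>x. F x \<partial>distr N borel ?B)) (at_right 0)"
    proof (rule tendsto_at_right_sequentially[of 0 1])
      fix S :: "nat \<Rightarrow> real"
      assume S: "\<And>k. 0 < S k" "\<And>k. S k < 1" "S \<longlonglongrightarrow> 0"
      have "(\<integral>x. F x \<partial>distr M borel (?X (S k))) = (\<integral>\<omega>. F (?X (S k) \<omega>) \<partial>M)" for k
        by (rule integral_distr[OF scaled_process_path_measurable[OF S(1)] F_meas])
      moreover have "(\<integral>x. F x \<partial>distr N borel ?B) = (\<integral>\<omega>. F (?B \<omega>) \<partial>N)"
        by (rule integral_distr[OF pathB F_meas])
      ultimately show "(\<lambda>k. \<integral>x. F x \<partial>distr M borel (?X (S k))) \<longlonglongrightarrow> (\<integral>x. F x \<partial>distr N borel ?B)"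
        using functional_expectation_tendsto[OF S assms(10) b lip] by simp
    qed simp
  qed
  then show ?thesis unfolding scaled_process_def .
qed

end
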